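(* Let $q$ be a prime power, $n\geq 3$ an odd integer, and let $F=\mathbb{F}_{q^{2n}}(x,y)$ with $$y^{q^n+1}=(x^q+x)\left((x^q+x)^{q-1}-1\right)^{q+1}.$$ Let $\alpha_1,\dots,\alpha_q\in\mathbb{F}_{q^{2n}}$ be the (distinct) roots of $x^q+x$, and for $1\leq k\leq q$ let $Q_k$ be the unique place of $F$ over the zero of $x-\alpha_k$. Let $1\leq k\leq q$ and $m=(q^n+1)/(q+1)$. Then $$G(Q_k)=\left\{(q^n+1)j+i\;\Big|\;1\leq i\leq q^n,\ 0\leq j\leq q+(q^2-q)\left\lceil\frac{i}{m}\right\rceil-\left\lfloor\frac{iq^3}{q^n+1}\right\rfloor-2\right\}$$ and $$H(Q_k)=\left\langle q^n+1,\ (q^n+1)\left(q+(q^2-q)\left\lceil\frac{i}{m}\right\rceil-\left\lfloor\frac{iq^3}{q^n+1}\right\rfloor-1\right)+i\;:\;1\leq i\leq q^n\right\rangle.$$ Moreover, $H(Q_k)$ is symmetric if and only if $n=3$.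
   Context: $F$ is the function field of the GGS curve $GGS(q,n)$, of genus $g=\frac12(q-1)(q^{n+1}+q^n-q^2)$; the places $Q_k$ are totally ramified over $\mathbb{F}_{q^{2n}}(x)$ and rational. For a rational place $P$ of $F$, $H(P)=\{n\in\mathbb{N}_0 : \exists z\in F,\ (z)_\infty=nP\}$, where $(z)_\infty$ is the pole divisor, and $G(P)=\mathbb{N}_0\setminus H(P)$. $H(P)$ is symmetric if the largest element of $G(P)$ equals $2g-1$. $\langle\cdot\rangle$ denotes the generated additive submonoid of $\mathbb{N}_0$. *)

theory Defs
  imports Complex_Main "HOL-Computational_Algebra.Polynomial" "HOL-Number_Theory.Prime_Powers"
begin

text \<open>
  Algebraic function fields are described inside an ambient field type: a function field
  \<open>L/K\<close> is a pair of subfields \<open>K \<subseteq> L\<close> of the type, both given as sets. The terminology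
  follows Stichtenoth, Algebraic Function Fields and Codes, Chapter 1.
\<close>

subsection \<open>Subfields and ideals\<close>

definition is_subring :: "'a::field set \<Rightarrow> bool" where
  "is_subring R \<longleftrightarrow> 0 \<in> R \<and> 1 \<in> R \<and> (\<forall>a\<in>R. \<forall>b\<in>R. a + b \<in> R \<and> a - b \<in> R \<and> a * b \<in> R)"

definition is_subfield :: "'a::field set \<Rightarrow> bool" where
  "is_subfield L \<longleftrightarrow> is_subring L \<and> (\<forall>a\<in>L. inverse a \<in> L)"

definition adjoin :: "'a::field set \<Rightarrow> 'a set \<Rightarrow> 'a set" where
  "adjoin K A = is_subfield hull (K \<union> A)"

definition transcendental_over :: "'a::field set \<Rightarrow> 'a \<Rightarrow> bool" where
  "transcendental_over K x \<longleftrightarrow> (\<forall>p. (\<forall>i. coeff p i \<in> K) \<and> poly p x = 0 \<longrightarrow> p = 0)"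

definition is_ideal :: "'a::field set \<Rightarrow> 'a set \<Rightarrow> bool" where
  "is_ideal R I \<longleftrightarrow> I \<subseteq> R \<and> 0 \<in> I \<and> (\<forall>a\<in>I. \<forall>b\<in>I. a + b \<in> I) \<and> (\<forall>r\<in>R. \<forall>a\<in>I. r * a \<in> I)"

definition is_maximal_ideal :: "'a::field set \<Rightarrow> 'a set \<Rightarrow> bool" where
  "is_maximal_ideal R M \<longleftrightarrow>
     is_ideal R M \<and> M \<noteq> R \<and> (\<forall>J. is_ideal R J \<and> M \<subseteq> J \<longrightarrow> J = M \<or> J = R)"

subsection \<open>Dimension of a quotient space\<close>

text \<open>
  For \<open>K\<close>-subspaces \<open>W \<subseteq> V\<close>: \<open>B \<subseteq> V\<close> is a set of representatives of a \<open>K\<close>-basis of \<open>V/W\<close>,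
  and \<open>quotient_dim K V W\<close> is the dimension of \<open>V/W\<close> when this is finite.
\<close>

definition quotient_basis :: "'a::field set \<Rightarrow> 'a set \<Rightarrow> 'a set \<Rightarrow> 'a set \<Rightarrow> bool" where
  "quotient_basis K V W B \<longleftrightarrow> finite B \<and> B \<subseteq> V \<and>
     (\<forall>c. (\<forall>b\<in>B. c b \<in> K) \<and> (\<Sum>b\<in>B. c b * b) \<in> W \<longrightarrow> (\<forall>b\<in>B. c b = 0)) \<and>
     (\<forall>v\<in>V. \<exists>c. (\<forall>b\<in>B. c b \<in> K) \<and> v - (\<Sum>b\<in>B. c b * b) \<in> W)"

definition quotient_dim :: "'a::field set \<Rightarrow> 'a set \<Rightarrow> 'a set \<Rightarrow> nat" where
  "quotient_dim K V W = (THE d. \<exists>B. quotient_basis K V W B \<and> card B = d)"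

subsection \<open>Places and valuations\<close>

definition is_valuation_ring :: "'a::field set \<Rightarrow> 'a set \<Rightarrow> 'a set \<Rightarrow> bool" where
  "is_valuation_ring K L R \<longleftrightarrow>
     is_subring R \<and> K \<subset> R \<and> R \<subset> L \<and> (\<forall>z\<in>L. z \<in> R \<or> inverse z \<in> R)"

definition is_place :: "'a::field set \<Rightarrow> 'a set \<Rightarrow> 'a set \<Rightarrow> bool" where
  "is_place K L P \<longleftrightarrow> (\<exists>R. is_valuation_ring K L R \<and> is_maximal_ideal R P)"

definition place_ring :: "'a::field set \<Rightarrow> 'a set \<Rightarrow> 'a set \<Rightarrow> 'a set" where
  "place_ring K L P = (THE R. is_valuation_ring K L R \<and> is_maximal_ideal R P)"

definition place_degree :: "'a::field set \<Rightarrow> 'a set \<Rightarrow> 'a set \<Rightarrow> nat" where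
  "place_degree K L P = quotient_dim K (place_ring K L P) P"

text \<open>
  \<open>val K L P z\<close> is the \<open>m\<close> with \<open>z = t\<^sup>m u\<close>, where \<open>t\<close> is a prime element of \<open>P\<close> and \<open>u\<close> is a unit
  of the valuation ring. It is meaningful only for \<open>z \<noteq> 0\<close>; the convention
  \<open>v\<^sub>P(0) = \<infinity>\<close> is treated by separate case distinctions.
\<close>

definition val :: "'a::field set \<Rightarrow> 'a set \<Rightarrow> 'a set \<Rightarrow> 'a \<Rightarrow> int" where
  "val K L P z = (THE m. \<exists>t u. P = (\<lambda>r. t * r) ` place_ring K L P \<and>
     u \<in> place_ring K L P \<and> u \<noteq> 0 \<and> inverse u \<in> place_ring K L P \<and> z = t powi m * u)"

definition the_zero_of :: "'a::field set \<Rightarrow> 'a set \<Rightarrow> 'a \<Rightarrow> 'a set" where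
  "the_zero_of K L z = (THE P. is_place K L P \<and> val K L P z > 0)"

definition the_place_over :: "'a::field set \<Rightarrow> 'a set \<Rightarrow> 'a set \<Rightarrow> 'a set" where
  "the_place_over K L P = (THE Q. is_place K L Q \<and> P \<subseteq> Q)"

subsection \<open>Divisors and the genus\<close>

definition is_divisor :: "'a::field set \<Rightarrow> 'a set \<Rightarrow> ('a set \<Rightarrow> int) \<Rightarrow> bool" where
  "is_divisor K L A \<longleftrightarrow> finite {P. A P \<noteq> 0} \<and> (\<forall>P. A P \<noteq> 0 \<longrightarrow> is_place K L P)"

definition divisor_degree :: "'a::field set \<Rightarrow> 'a set \<Rightarrow> ('a set \<Rightarrow> int) \<Rightarrow> int" where
  "divisor_degree K L A = (\<Sum>P | A P \<noteq> 0. A P * int (place_degree K L P))"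

definition riemann_roch_space :: "'a::field set \<Rightarrow> 'a set \<Rightarrow> ('a set \<Rightarrow> int) \<Rightarrow> 'a set" where
  "riemann_roch_space K L A =
     {z \<in> L. z = 0 \<or> (\<forall>P. is_place K L P \<longrightarrow> val K L P z \<ge> - A P)}"

definition divisor_dim :: "'a::field set \<Rightarrow> 'a set \<Rightarrow> ('a set \<Rightarrow> int) \<Rightarrow> nat" where
  "divisor_dim K L A = quotient_dim K (riemann_roch_space K L A) {0}"

definition genus :: "'a::field set \<Rightarrow> 'a set \<Rightarrow> int" where
  "genus K L = (GREATEST d. \<exists>A. is_divisor K L A \<and>
     d = divisor_degree K L A - int (divisor_dim K L A) + 1)"

subsection \<open>Weierstrass semigroups\<close>

definition pole_divisor :: "'a::field set \<Rightarrow> 'a set \<Rightarrow> 'a \<Rightarrow> 'a set \<Rightarrow> int" where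
  "pole_divisor K L z = (\<lambda>P. if is_place K L P \<and> val K L P z < 0 then - val K L P z else 0)"

definition pole_numbers :: "'a::field set \<Rightarrow> 'a set \<Rightarrow> 'a set \<Rightarrow> nat set" where
  "pole_numbers K L P =
     {s. \<exists>z\<in>L. z \<noteq> 0 \<and> pole_divisor K L z = (\<lambda>P'. if P' = P then int s else 0)}"

definition gap_numbers :: "'a::field set \<Rightarrow> 'a set \<Rightarrow> 'a set \<Rightarrow> nat set" where
  "gap_numbers K L P = UNIV - pole_numbers K L P"

definition semigroup_symmetric :: "'a::field set \<Rightarrow> 'a set \<Rightarrow> 'a set \<Rightarrow> bool" where
  "semigroup_symmetric K L P \<longleftrightarrow>
     (\<exists>s\<in>gap_numbers K L P. (\<forall>s'\<in>gap_numbers K L P. s' \<le> s) \<and> int s = 2 * genus K L - 1)"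

definition is_submonoid :: "nat set \<Rightarrow> bool" where
  "is_submonoid M \<longleftrightarrow> 0 \<in> M \<and> (\<forall>a\<in>M. \<forall>b\<in>M. a + b \<in> M)"

end

theory Submission
  imports Defs
begin

text \<open>
  Put \<open>N = q^n + 1\<close>, \<open>u = 1/(x - \<alpha>\<^sub>k)\<close> and let \<open>v\<close> be the valuation at \<open>Q = Q\<^sub>k\<close>. Then \<open>K(u)/K\<close> has
  its pole of \<open>u\<close> below \<open>Q\<close>, and \<open>y^N = A B^(q+1) / u^(q^3)\<close> with \<open>A = 1 + u^(q-1)\<close> and
  \<open>B = A^(q-1) - u^(q(q-1))\<close>, where \<open>u A B = u - u^(q^2)\<close> is squarefree. As \<open>y^N\<close> has valuation \<open>1\<close>
  on \<open>K(u)\<close>, the place \<open>Q\<close> is the only one above it and \<open>v(\<Sum> a\<^sub>i y^i)\<close> is the minimum of the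
  numbers \<open>N v(a\<^sub>i) + i\<close>, which are distinct. Averaging over the automorphisms \<open>y \<mapsto> \<zeta> y\<close> with
  \<open>\<zeta>^N = 1\<close> shows that \<open>\<Sum> a\<^sub>i y^i\<close> is regular away from \<open>Q\<close> if and only if every term is, that is,
  if \<open>a\<^sub>i^N (y^N)^i\<close> is a polynomial in \<open>u\<close>. Since \<open>u A B\<close> is squarefree, this means that \<open>a\<^sub>i\<close> is a
  polynomial multiple of \<open>u^c / B^b\<close> with \<open>c = \<lceil>i q^3 / N\<rceil>\<close> and \<open>b = \<lfloor>i / m\<rfloor>\<close>. The pole orders of these
  terms form \<open>H(Q)\<close>.

  For the symmetry statement the genus has to be identified with the number of gaps. Riemann's
  inequality \<open>deg A - dim A + 1 \<le> g\<close> follows by comparing a divisor with one of the form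
  \<open>s Q + (z)\<close>, where \<open>z\<close> is regular away from \<open>Q\<close>. The bound needed there, that \<open>z\<close> has at most
  \<open>- v z\<close> zeros, holds because more than \<open>- v z\<close> functions are linearly dependent over \<open>K(z)\<close>, by
  counting dimensions in the spaces \<open>L(s Q)\<close>.
\<close>

subsection \<open>Subrings and subfields\<close>

text \<open>Passing from \<open>x\<close> to \<open>u\<close> turns the zero of x - alpha_k into a
  pole, so the functions sought are expansions over the polynomial ring K[u]. Since alpha_k^q +
  alpha_k = 0, the root drops out of the equation, which is why all \<open>Q k\<close> have the same
  semigroup. The obstacle is that \<open>val\<close>, \<open>place_degree\<close> and
  \<open>genus\<close> are given by description operators over all places, and a place is at first
  only the maximal ideal of some valuation ring, perhaps not discrete, perhaps of infinite degree.
  What overcomes this is a finiteness fact: if a subring T of the function field contains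
  \<open>K\<close> and a nonzero z that is regular away from \<open>Q\<close>, then dim T/zT is at
  most the pole order of z. For valuation rings it yields discreteness and finite degree, for
  semilocal rings the bound on the number of zeros. The symmetry criterion asks whether 2g - 1 = N
  (q^2 - 2) + (N - q^3) is the largest gap. For n = 3 the last summand is 1 and it is; for n >= 5
  the residue class of N - q^3 has at most q - 1 gaps, too few to reach that far.\<close>

lemma subring_zero: "is_subring R \<Longrightarrow> 0 \<in> R"
  and subring_one: "is_subring R \<Longrightarrow> 1 \<in> R"
  and subring_add: "is_subring R \<Longrightarrow> a \<in> R \<Longrightarrow> b \<in> R \<Longrightarrow> a + b \<in> R"
  and subring_diff: "is_subring R \<Longrightarrow> a \<in> R \<Longrightarrow> b \<in> R \<Longrightarrow> a - b \<in> R"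
  and subring_mult: "is_subring R \<Longrightarrow> a \<in> R \<Longrightarrow> b \<in> R \<Longrightarrow> a * b \<in> R"
  by (auto simp: is_subring_def)

lemma subring_uminus: "is_subring R \<Longrightarrow> a \<in> R \<Longrightarrow> - a \<in> R"
  using subring_diff[of R 0 a] subring_zero by auto

lemma subring_power: "is_subring R \<Longrightarrow> a \<in> R \<Longrightarrow> a ^ k \<in> R"
  by (induction k) (auto simp: subring_one subring_mult)

lemma subring_sum: "is_subring R \<Longrightarrow> (\<And>i. i \<in> I \<Longrightarrow> f i \<in> R) \<Longrightarrow> sum f I \<in> R"
  by (induction I rule: infinite_finite_induct) (auto simp: subring_zero subring_add)

lemma subring_prod: "is_subring R \<Longrightarrow> (\<And>i. i \<in> I \<Longrightarrow> f i \<in> R) \<Longrightarrow> prod f I \<in> R"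
  by (induction I rule: infinite_finite_induct) (auto simp: subring_one subring_mult)

lemma subfield_subring: "is_subfield L \<Longrightarrow> is_subring L"
  by (simp add: is_subfield_def)

lemma subfield_inverse: "is_subfield L \<Longrightarrow> a \<in> L \<Longrightarrow> inverse a \<in> L"
  by (simp add: is_subfield_def)

lemma subfield_divide: "is_subfield L \<Longrightarrow> a \<in> L \<Longrightarrow> b \<in> L \<Longrightarrow> a / b \<in> L"
  by (simp add: divide_inverse subfield_inverse subfield_subring subring_mult)

lemma subfield_power_int: "is_subfield L \<Longrightarrow> a \<in> L \<Longrightarrow> a powi k \<in> L"
  by (simp add: power_int_def subfield_inverse subfield_subring subring_power)

lemmas subring_closed = subring_zero subring_one subring_add subring_diff subring_mult subring_uminus
  subring_power subring_sum subring_prod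

lemmas ring_closed = subring_closed subfield_subring subfield_inverse subfield_divide

lemma is_subfield_UNIV: "is_subfield (UNIV :: 'a::field set)"
  by (simp add: is_subfield_def is_subring_def)

lemma is_subfield_adjoin: "is_subfield (adjoin K A)"
  unfolding adjoin_def
proof (rule hull_in)
  show "\<And>T. Ball T is_subfield \<Longrightarrow> is_subfield (\<Inter>T)"
    by (auto simp: is_subfield_def is_subring_def)
qed

lemma adjoin_superset: "K \<union> A \<subseteq> adjoin K A"
  unfolding adjoin_def by (rule hull_subset)

lemma adjoin_least: "is_subfield L \<Longrightarrow> K \<union> A \<subseteq> L \<Longrightarrow> adjoin K A \<subseteq> L"
  unfolding adjoin_def by (rule hull_minimal)

text \<open>Serves to cancel from a relation the lowest power of \<open>t\<close> occurring in it,
  so that a constant term survives modulo \<open>t\<close>.\<close>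

lemma sum_power_split_least:
  fixes c :: "nat \<Rightarrow> 'a::comm_ring_1"
  assumes "k < n" "\<And>i. i < k \<Longrightarrow> c i = 0"
  shows "(\<Sum>i<n. c i * t ^ i) = t ^ k * (c k + t * (\<Sum>i\<in>{k<..<n}. c i * t ^ (i - k - 1)))"
proof -
  have "{..<n} = {..<k} \<union> insert k {k<..<n}" using assms(1) by auto
  then have "(\<Sum>i<n. c i * t ^ i) = (\<Sum>i\<in>{..<k} \<union> insert k {k<..<n}. c i * t ^ i)" by simp
  also have "\<dots> = (\<Sum>i<k. c i * t ^ i) + (\<Sum>i\<in>insert k {k<..<n}. c i * t ^ i)"
    by (intro sum.union_disjoint) auto
  also have "(\<Sum>i<k. c i * t ^ i) = 0" using assms(2) by simp
  also have "(\<Sum>i\<in>{k<..<n}. c i * t ^ i) = t ^ k * t * (\<Sum>i\<in>{k<..<n}. c i * t ^ (i - k - 1))"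
    unfolding sum_distrib_left
  proof (intro sum.cong refl)
    fix i assume "i \<in> {k<..<n}"
    then have "t ^ i = t ^ (k + (1 + (i - k - 1)))" by simp
    also have "\<dots> = t ^ k * t * t ^ (i - k - 1)" by (simp only: power_add) simp
    finally show "c i * t ^ i = t ^ k * t * (c i * t ^ (i - k - 1))" by (simp add: mult_ac)
  qed
  then have "(\<Sum>i\<in>insert k {k<..<n}. c i * t ^ i) =
      t ^ k * (c k + t * (\<Sum>i\<in>{k<..<n}. c i * t ^ (i - k - 1)))"
    by (simp add: algebra_simps)
  finally show ?thesis by simp
qed

subsection \<open>Quotient spaces\<close>

definition subspace_over :: "'a::field set \<Rightarrow> 'a set \<Rightarrow> bool" where
  "subspace_over K V \<longleftrightarrow> 0 \<in> V \<and> (\<forall>a\<in>V. \<forall>b\<in>V. a + b \<in> V) \<and> (\<forall>c\<in>K. \<forall>a\<in>V. c * a \<in> V)"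

lemma subspace_overD:
  assumes "subspace_over K V"
  shows "0 \<in> V" and "a \<in> V \<Longrightarrow> b \<in> V \<Longrightarrow> a + b \<in> V" and "c \<in> K \<Longrightarrow> a \<in> V \<Longrightarrow> c * a \<in> V"
  using assms by (auto simp: subspace_over_def)

lemma subspace_over_diff:
  assumes "is_subfield K" "subspace_over K V" "a \<in> V" "b \<in> V"
  shows "a - b \<in> V"
proof -
  have "(-1) * b \<in> V"
    using assms by (intro subspace_overD(3)) (auto intro: subring_uminus subring_one subfield_subring)
  then show ?thesis
    using subspace_overD(2)[OF assms(2,3), of "(-1) * b"] by simp
qed

lemma subspace_over_sum:
  assumes "subspace_over K V" "\<And>i. i \<in> I \<Longrightarrow> f i \<in> V"
  shows "sum f I \<in> V"
  using assms(2) by (induction I rule: infinite_finite_induct) (auto simp: subspace_overD[OF assms(1)])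

lemma subspace_over_lincomb:
  assumes "subspace_over K V" "\<And>i. i \<in> I \<Longrightarrow> c i \<in> K" "\<And>i. i \<in> I \<Longrightarrow> f i \<in> V"
  shows "(\<Sum>i\<in>I. c i * f i) \<in> V"
  using assms by (intro subspace_over_sum[OF assms(1)] subspace_overD(3)) auto

text \<open>Gaussian elimination: a member of the family with nonzero coefficient at
  \<open>b\<close> is the pivot, and subtracting multiples of it from the others leaves a family
  with one member fewer that \<open>B\<close> alone spans modulo \<open>W\<close>.\<close>

lemma steinitz_mod:
  assumes K: "is_subfield K" and W: "subspace_over K W" and "finite B"
    and "finite I" "card B < card I"
    and "\<And>i. i \<in> I \<Longrightarrow> \<exists>c. (\<forall>b\<in>B. c b \<in> K) \<and> f i - (\<Sum>b\<in>B. c b * b) \<in> W"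
  shows "\<exists>d. (\<forall>i\<in>I. d i \<in> K) \<and> (\<exists>i\<in>I. d i \<noteq> 0) \<and> (\<Sum>i\<in>I. d i * f i) \<in> W"
  using assms(3-)
proof (induction B arbitrary: I f rule: finite_induct)
  case empty
  then obtain i where "i \<in> I" by fastforce
  moreover have "(\<Sum>i\<in>I. 1 * f i) \<in> W"
    using empty by (intro subspace_over_lincomb[OF W]) (auto intro: subring_one subfield_subring K)
  ultimately show ?case
    by (intro exI[of _ "\<lambda>_. 1"]) (auto intro: subring_one subfield_subring K)
next
  case (insert b B)
  obtain k where k: "\<And>i b'. i \<in> I \<Longrightarrow> b' \<in> insert b B \<Longrightarrow> k i b' \<in> K"
      "\<And>i. i \<in> I \<Longrightarrow> f i - (\<Sum>b\<in>insert b B. k i b * b) \<in> W"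
    using insert.prems(3) by metis
  show ?case
  proof (cases "\<exists>i0\<in>I. k i0 b \<noteq> 0")
    case False
    have "\<exists>c. (\<forall>b\<in>B. c b \<in> K) \<and> f i - (\<Sum>b\<in>B. c b * b) \<in> W" if "i \<in> I" for i
      using k[OF that] False that insert.hyps by (intro exI[of _ "k i"]) auto
    with insert show ?thesis by simp
  next
    case True
    then obtain i0 where i0: "i0 \<in> I" "k i0 b \<noteq> 0" by blast
    define r where "r i = k i b / k i0 b" for i
    have rK: "r i \<in> K" if "i \<in> I" for i
      unfolding r_def using that i0 by (intro subfield_divide K k) auto
    define f' where "f' i = f i - r i * f i0" for i
    have "\<exists>d. (\<forall>i\<in>I - {i0}. d i \<in> K) \<and> (\<exists>i\<in>I - {i0}. d i \<noteq> 0) \<and> (\<Sum>i\<in>I - {i0}. d i * f' i) \<in> W"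
    proof (rule insert.IH)
      show "finite (I - {i0})" using insert by simp
      show "card B < card (I - {i0})" using insert i0 by (simp add: card_Diff_singleton)
      fix i assume i: "i \<in> I - {i0}"
      have "(f i - (\<Sum>b\<in>insert b B. k i b * b)) - r i * (f i0 - (\<Sum>b\<in>insert b B. k i0 b * b)) \<in> W"
        using i i0 by (intro subspace_over_diff[OF K W] subspace_overD(3)[OF W] k rK) auto
      also have "(f i - (\<Sum>b\<in>insert b B. k i b * b)) - r i * (f i0 - (\<Sum>b\<in>insert b B. k i0 b * b))
        = f' i - (\<Sum>b\<in>B. (k i b - r i * k i0 b) * b)"
        using insert.hyps i0(2)
        by (simp add: f'_def algebra_simps sum_subtractf sum_distrib_left r_def)
      finally show "\<exists>c. (\<forall>b\<in>B. c b \<in> K) \<and> f' i - (\<Sum>b\<in>B. c b * b) \<in> W"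
        using i i0 K by (intro exI[of _ "\<lambda>b. k i b - r i * k i0 b"])
          (auto intro!: subring_diff subring_mult subfield_subring k rK)
    qed
    then obtain d where d: "\<And>i. i \<in> I - {i0} \<Longrightarrow> d i \<in> K" "\<exists>i\<in>I - {i0}. d i \<noteq> 0"
        "(\<Sum>i\<in>I - {i0}. d i * f' i) \<in> W" by blast
    \<comment> \<open>The coefficient at the pivot collects what was subtracted from the other
      members.\<close>
    define d' where "d' = d(i0 := - (\<Sum>i\<in>I - {i0}. d i * r i))"
    have "(\<Sum>i\<in>I. d' i * f i) = d' i0 * f i0 + (\<Sum>i\<in>I - {i0}. d' i * f i)"
      using insert.prems i0 by (simp add: sum.remove)
    also have "(\<Sum>i\<in>I - {i0}. d' i * f i) = (\<Sum>i\<in>I - {i0}. d i * f i)"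
      by (intro sum.cong) (auto simp: d'_def)
    also have "d' i0 * f i0 + (\<Sum>i\<in>I - {i0}. d i * f i) = (\<Sum>i\<in>I - {i0}. d i * f' i)"
      by (simp add: d'_def f'_def algebra_simps sum_subtractf sum_distrib_left sum_distrib_right)
    finally have "(\<Sum>i\<in>I. d' i * f i) \<in> W" using d(3) by simp
    moreover have "\<forall>i\<in>I. d' i \<in> K"
      using d(1) K by (auto simp: d'_def intro!: ring_closed rK)
    moreover have "\<exists>i\<in>I. d' i \<noteq> 0" using d(2) by (auto simp: d'_def)
    ultimately show ?thesis by blast
  qed
qed

definition independent_mod :: "'a::field set \<Rightarrow> 'a set \<Rightarrow> 'a set \<Rightarrow> bool" where
  "independent_mod K W B \<longleftrightarrow> (\<forall>c. (\<forall>b\<in>B. c b \<in> K) \<and> (\<Sum>b\<in>B. c b * b) \<in> W \<longrightarrow> (\<forall>b\<in>B. c b = 0))"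

text \<open>Relational form of \<open>quotient_dim\<close>: it asserts in addition that the
  dimension is finite, which a value of the description operator cannot express.\<close>

definition has_qdim :: "'a::field set \<Rightarrow> 'a set \<Rightarrow> 'a set \<Rightarrow> nat \<Rightarrow> bool" where
  "has_qdim K V W d \<longleftrightarrow> (\<exists>B. quotient_basis K V W B \<and> card B = d)"

lemma quotient_basis_iff:
  "quotient_basis K V W B \<longleftrightarrow> finite B \<and> B \<subseteq> V \<and> independent_mod K W B \<and>
     (\<forall>v\<in>V. \<exists>c. (\<forall>b\<in>B. c b \<in> K) \<and> v - (\<Sum>b\<in>B. c b * b) \<in> W)"
  by (simp add: quotient_basis_def independent_mod_def)

lemma has_qdim_dependent:
  assumes "is_subfield K" "subspace_over K W" "has_qdim K V W d"
    and "finite I" "d < card I" "\<And>i. i \<in> I \<Longrightarrow> f i \<in> V"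
  shows "\<exists>c. (\<forall>i\<in>I. c i \<in> K) \<and> (\<exists>i\<in>I. c i \<noteq> 0) \<and> (\<Sum>i\<in>I. c i * f i) \<in> W"
proof -
  obtain B where B: "quotient_basis K V W B" "card B = d"
    using assms(3) by (auto simp: has_qdim_def)
  show ?thesis
    by (rule steinitz_mod[OF assms(1,2), of B]) (use B assms in \<open>auto simp: quotient_basis_iff\<close>)
qed

lemma independent_mod_card_le:
  assumes "is_subfield K" "subspace_over K W" "has_qdim K V W d"
    and "finite B" "B \<subseteq> V" "independent_mod K W B"
  shows "card B \<le> d"
proof (rule ccontr)
  assume "\<not> card B \<le> d"
  then have "\<exists>c. (\<forall>i\<in>B. c i \<in> K) \<and> (\<exists>i\<in>B. c i \<noteq> 0) \<and> (\<Sum>i\<in>B. c i * i) \<in> W"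
    using assms by (intro has_qdim_dependent[OF assms(1-3)]) auto
  then show False using assms(6) by (auto simp: independent_mod_def)
qed

lemma has_qdim_unique:
  assumes "is_subfield K" "subspace_over K W" "has_qdim K V W d" "has_qdim K V W e"
  shows "d = e"
proof -
  have "x \<le> y" if "has_qdim K V W x" "has_qdim K V W y" for x y
    using that(1) independent_mod_card_le[OF assms(1,2) that(2)]
    by (auto simp: has_qdim_def quotient_basis_iff)
  with assms show ?thesis by (meson antisym)
qed

lemma quotient_dim_eq:
  assumes "is_subfield K" "subspace_over K W" "has_qdim K V W d"
  shows "quotient_dim K V W = d"
  unfolding quotient_dim_def has_qdim_def[symmetric]
  by (rule the_equality) (use assms has_qdim_unique in blast)+

text \<open>The bound provides an independent set of largest size. It spans, since an element
  outside its span could be added to it.\<close>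

lemma has_qdim_exists:
  assumes K: "is_subfield K" and W: "subspace_over K W"
    and bound: "\<And>B. finite B \<Longrightarrow> B \<subseteq> V \<Longrightarrow> independent_mod K W B \<Longrightarrow> card B \<le> n"
  shows "\<exists>d\<le>n. has_qdim K V W d"
proof -
  define Q where "Q B \<longleftrightarrow> finite B \<and> B \<subseteq> V \<and> independent_mod K W B" for B
  have "Q {}" by (simp add: Q_def independent_mod_def)
  moreover have "\<forall>y. Q y \<longrightarrow> card y < Suc n" using bound by (simp add: Q_def less_Suc_eq_le)
  ultimately have "\<exists>B. Q B \<and> (\<forall>y. Q y \<longrightarrow> card y \<le> card B)"
    by (rule Lattices_Big.ex_has_greatest_nat)
  then obtain B where QB: "Q B" and Qmax: "\<forall>y. Q y \<longrightarrow> card y \<le> card B" by blast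
  then have B: "finite B" "B \<subseteq> V" "independent_mod K W B" by (auto simp: Q_def)
  have max: "card y \<le> card B" if "finite y" "y \<subseteq> V" "independent_mod K W y" for y
    using Qmax that by (auto simp: Q_def)
  have "\<exists>c. (\<forall>b\<in>B. c b \<in> K) \<and> v - (\<Sum>b\<in>B. c b * b) \<in> W" if v: "v \<in> V" for v
  proof (rule ccontr)
    assume "\<not> ?thesis"
    then have contra: "\<And>c. \<forall>b\<in>B. c b \<in> K \<Longrightarrow> v - (\<Sum>b\<in>B. c b * b) \<notin> W"
      by metis
    have vB: "v \<notin> B"
    proof
      assume "v \<in> B"
      then have "v - (\<Sum>b\<in>B. (if b = v then 1 else 0) * b) \<in> W"
        using B subspace_overD(1)[OF W] by (simp add: sum.delta if_distrib[of "\<lambda>x. x * _"] cong: if_cong)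
      moreover have "\<forall>b\<in>B. (if b = v then 1 else 0) \<in> K"
        using K by (auto intro: ring_closed)
      ultimately show False using contra[of "\<lambda>b. if b = v then 1 else 0"] by blast
    qed
    have "independent_mod K W (insert v B)"
      unfolding independent_mod_def
    proof (intro allI impI, elim conjE)
      fix c assume c: "\<forall>b\<in>insert v B. c b \<in> K" and s: "(\<Sum>b\<in>insert v B. c b * b) \<in> W"
      have "c v = 0"
      proof (rule ccontr)
        assume nz: "c v \<noteq> 0"
        have "inverse (c v) * (\<Sum>b\<in>insert v B. c b * b) \<in> W"
          using c s by (intro subspace_overD(3)[OF W] subfield_inverse K) auto
        also have "inverse (c v) * (\<Sum>b\<in>insert v B. c b * b) = v - (\<Sum>b\<in>B. (- c b / c v) * b)"
          using vB B nz by (simp add: field_simps sum_distrib_left sum_negf sum_divide_distrib)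
        finally have "v - (\<Sum>b\<in>B. (- c b / c v) * b) \<in> W" .
        moreover have "\<forall>b\<in>B. - c b / c v \<in> K"
          using c K by (auto intro!: subfield_divide subring_uminus subfield_subring)
        ultimately show False using contra[of "\<lambda>b. - c b / c v"] by blast
      qed
      with s c B vB show "\<forall>b\<in>insert v B. c b = 0"
        by (auto simp: independent_mod_def)
    qed
    from max[OF _ _ this] B v vB show False by simp
  qed
  then have "quotient_basis K V W B" using B by (simp add: quotient_basis_iff)
  then show ?thesis using bound B by (auto simp: has_qdim_def)
qed

lemma has_qdim_0: "subspace_over K V \<Longrightarrow> has_qdim K V V 0"
  unfolding has_qdim_def quotient_basis_def
  by (intro exI[of _ "{}"]) auto

lemma has_qdim_1:
  assumes K: "is_subfield K" and W: "subspace_over K W" and "a \<in> V" "a \<notin> W"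
    and span: "\<And>b. b \<in> V \<Longrightarrow> \<exists>c\<in>K. b - c * a \<in> W"
  shows "has_qdim K V W 1"
proof -
  have zero: "c = 0" if c: "c \<in> K" "c * a \<in> W" for c
  proof (rule ccontr)
    assume "c \<noteq> 0"
    then have "inverse c * (c * a) = a" by simp
    moreover have "inverse c * (c * a) \<in> W"
      by (rule subspace_overD(3)[OF W subfield_inverse[OF K c(1)] c(2)])
    ultimately show False using assms(4) by metis
  qed
  have "quotient_basis K V W {a}"
    unfolding quotient_basis_def
  proof (intro conjI allI impI ballI, goal_cases)
    case (4 b)
    then obtain k where "k \<in> K" "b - k * a \<in> W" using span by blast
    then show ?case by (intro exI[of _ "\<lambda>_. k"]) auto
  next
    case (3 c b)
    then show ?case using zero by auto
  qed (use assms(3) in auto)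
  then show ?thesis by (auto simp: has_qdim_def)
qed

text \<open>Representatives for V/U and for U/W together represent V/W. The two sets are disjoint
  because no member of a set independent modulo \<open>U\<close> lies in \<open>U\<close>.\<close>

lemma has_qdim_tower:
  assumes K: "is_subfield K" and U: "subspace_over K U" and "U \<subseteq> V"
    and "has_qdim K V U a" "has_qdim K U W b" and "W \<subseteq> U"
  shows "has_qdim K V W (a + b)"
proof -
  obtain B where B: "quotient_basis K V U B" "card B = a"
    using assms by (auto simp: has_qdim_def)
  obtain C where C: "quotient_basis K U W C" "card C = b"
    using assms by (auto simp: has_qdim_def)
  have fin: "finite B" "finite C" and sub: "B \<subseteq> V" "C \<subseteq> U"
    using B C by (auto simp: quotient_basis_def)
  have disj: "B \<inter> C = {}"
  proof (rule ccontr)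
    assume "B \<inter> C \<noteq> {}"
    then obtain v where v: "v \<in> B" "v \<in> U" using sub by blast
    define c where "c b = (if b = v then 1 else 0 :: 'a)" for b
    have "(\<Sum>b\<in>B. c b * b) = v"
      using fin v by (simp add: c_def sum.delta if_distrib[of "\<lambda>x. x * _"] cong: if_cong)
    moreover have "\<forall>b\<in>B. c b \<in> K" using K by (auto simp: c_def intro: ring_closed)
    ultimately have "c v = 0"
      using B(1) v unfolding quotient_basis_iff independent_mod_def by metis
    then show False by (simp add: c_def)
  qed
  have "quotient_basis K V W (B \<union> C)"
    unfolding quotient_basis_def
  proof (intro conjI allI impI ballI, goal_cases)
    case 1 then show ?case using fin by simp
  next
    case 2 then show ?case using sub assms by blast
  next
    case (3 c d)
    then have cB: "\<forall>b\<in>B. c b \<in> K" and cC: "\<forall>b\<in>C. c b \<in> K" and s: "(\<Sum>b\<in>B \<union> C. c b * b) \<in> W" by auto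
    have eq: "(\<Sum>b\<in>B \<union> C. c b * b) = (\<Sum>b\<in>B. c b * b) + (\<Sum>b\<in>C. c b * b)"
      using fin disj by (simp add: sum.union_disjoint)
    have U1: "(\<Sum>b\<in>C. c b * b) \<in> U"
      using cC sub by (intro subspace_over_lincomb[OF U]) auto
    have "(\<Sum>b\<in>B. c b * b) \<in> U"
    proof -
      have "(\<Sum>b\<in>B \<union> C. c b * b) \<in> U" using s assms(6) by blast
      then have "(\<Sum>b\<in>B \<union> C. c b * b) - (\<Sum>b\<in>C. c b * b) \<in> U"
        using U1 by (intro subspace_over_diff[OF K U])
      then show ?thesis by (simp add: eq)
    qed
    then have B0: "\<forall>b\<in>B. c b = 0" using B cB by (auto simp: quotient_basis_def)
    then have "(\<Sum>b\<in>C. c b * b) \<in> W" using s eq by simp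
    then have "\<forall>b\<in>C. c b = 0" using C cC by (auto simp: quotient_basis_def)
    with B0 3 show ?case by blast
  next
    case (4 v)
    then obtain c where c: "\<forall>b\<in>B. c b \<in> K" "v - (\<Sum>b\<in>B. c b * b) \<in> U"
      using B by (auto simp: quotient_basis_def)
    then obtain d where d: "\<forall>b\<in>C. d b \<in> K" "v - (\<Sum>b\<in>B. c b * b) - (\<Sum>b\<in>C. d b * b) \<in> W"
      using C by (force simp: quotient_basis_def)
    define e where "e b = (if b \<in> B then c b else d b)" for b
    have "(\<Sum>b\<in>B \<union> C. e b * b) = (\<Sum>b\<in>B. e b * b) + (\<Sum>b\<in>C. e b * b)"
      using fin disj by (simp add: sum.union_disjoint)
    also have "(\<Sum>b\<in>B. e b * b) = (\<Sum>b\<in>B. c b * b)" by (simp add: e_def)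
    also have "(\<Sum>b\<in>C. e b * b) = (\<Sum>b\<in>C. d b * b)"
      using disj by (intro sum.cong) (auto simp: e_def)
    finally have "v - (\<Sum>b\<in>B \<union> C. e b * b) \<in> W" using d by (simp add: algebra_simps)
    with c d show ?case by (intro exI[of _ e]) (auto simp: e_def)
  qed
  moreover have "card (B \<union> C) = a + b" using fin disj B C by (simp add: card_Un_disjoint)
  ultimately show ?thesis by (auto simp: has_qdim_def)
qed

lemma has_qdim_between:
  assumes K: "is_subfield K" and W: "subspace_over K W" and U: "subspace_over K U"
    and "W \<subseteq> U" "U \<subseteq> V" "has_qdim K V W d"
  obtains a b where "has_qdim K U W a" "has_qdim K V U b" "a + b = d"
proof -
  obtain a where a: "has_qdim K U W a"
    using has_qdim_exists[OF K W, of U d] independent_mod_card_le[OF K W assms(6)] assms by blast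
  have "card B \<le> d" if "finite B" "B \<subseteq> V" "independent_mod K U B" for B
    using that assms by (intro independent_mod_card_le[OF K W assms(6)]) (auto simp: independent_mod_def)
  then obtain b where b: "has_qdim K V U b"
    using has_qdim_exists[OF K U, of V d] by blast
  have "b + a = d"
    using has_qdim_tower[OF K U assms(5) b a assms(4)] assms has_qdim_unique[OF K W] by blast
  with a b that show ?thesis by (simp add: add.commute)
qed

text \<open>The hypotheses say that multiplication by \<open>t\<close> induces an injective map from
  V/W to V'/W', so a dependence in the target pulls back.\<close>

lemma has_qdim_embed:
  assumes K: "is_subfield K" and W: "subspace_over K W" and W': "subspace_over K W'"
    and "has_qdim K V' W' d"
    and map: "\<And>a. a \<in> V \<Longrightarrow> t * a \<in> V'" "\<And>a. a \<in> V \<Longrightarrow> t * a \<in> W' \<Longrightarrow> a \<in> W"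
    and V: "subspace_over K V"
  shows "\<exists>e\<le>d. has_qdim K V W e"
proof (rule has_qdim_exists[OF K W])
  fix B assume B: "finite B" "B \<subseteq> V" "independent_mod K W B"
  show "card B \<le> d"
  proof (rule ccontr)
    assume "\<not> card B \<le> d"
    then have "\<exists>c. (\<forall>i\<in>B. c i \<in> K) \<and> (\<exists>i\<in>B. c i \<noteq> 0) \<and> (\<Sum>i\<in>B. c i * (t * i)) \<in> W'"
      using B map by (intro has_qdim_dependent[OF K W' assms(4)]) auto
    then obtain c where c: "\<forall>i\<in>B. c i \<in> K" "\<exists>i\<in>B. c i \<noteq> 0" "t * (\<Sum>i\<in>B. c i * i) \<in> W'"
      by (auto simp: sum_distrib_left mult_ac)
    moreover have "(\<Sum>i\<in>B. c i * i) \<in> V"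
      using c B by (intro subspace_over_lincomb[OF V]) auto
    ultimately show False using map B by (auto simp: independent_mod_def)
  qed
qed

text \<open>Here the induced map is also onto, so the images of representatives of V/W span
  V'/W'.\<close>

lemma has_qdim_iso:
  assumes K: "is_subfield K" and W: "subspace_over K W" and W': "subspace_over K W'"
    and V: "subspace_over K V"
    and "has_qdim K V' W' d"
    and map: "\<And>a. a \<in> V \<Longrightarrow> t * a \<in> V'" "\<And>a. a \<in> V \<Longrightarrow> t * a \<in> W' \<longleftrightarrow> a \<in> W"
    and surj: "\<And>b. b \<in> V' \<Longrightarrow> \<exists>a\<in>V. b - t * a \<in> W'"
  shows "has_qdim K V W d"
proof -
  obtain e where e: "e \<le> d" "has_qdim K V W e"
    using has_qdim_embed[OF K W W' assms(5) map(1) _ V] map(2) by blast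
  obtain B where B: "quotient_basis K V W B" "card B = e" using e by (auto simp: has_qdim_def)
  obtain C where C: "quotient_basis K V' W' C" "card C = d" using assms(5) by (auto simp: has_qdim_def)
  have BV: "B \<subseteq> V" using B by (simp add: quotient_basis_def)
  have "d \<le> e"
  proof (rule ccontr)
    assume "\<not> d \<le> e"
    then have lt: "card (((*) t) ` B) < card C"
      using B C by (metis card_image_le le_less_trans not_le quotient_basis_def)
    have "\<exists>c. (\<forall>i\<in>C. c i \<in> K) \<and> (\<exists>i\<in>C. c i \<noteq> 0) \<and> (\<Sum>i\<in>C. c i * i) \<in> W'"
    proof (rule steinitz_mod[OF K W', of "(*) t ` B"])
      show "finite ((*) t ` B)" "finite C" using B C by (auto simp: quotient_basis_def)
      show "card ((*) t ` B) < card C" by fact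
      fix i assume "i \<in> C"
      then have "i \<in> V'" using C by (auto simp: quotient_basis_def)
      then obtain a where a: "a \<in> V" "i - t * a \<in> W'" using surj by blast
      then obtain c where c: "\<forall>b\<in>B. c b \<in> K" "a - (\<Sum>b\<in>B. c b * b) \<in> W"
        using B by (auto simp: quotient_basis_def)
      have "a - (\<Sum>b\<in>B. c b * b) \<in> V"
        using a c BV by (intro subspace_over_diff[OF K V] subspace_over_lincomb[OF V]) auto
      then have 1: "t * (a - (\<Sum>b\<in>B. c b * b)) \<in> W'" using c map(2) by blast
      have 2: "(i - t * a) + t * (a - (\<Sum>b\<in>B. c b * b)) \<in> W'"
        using a(2) 1 by (rule subspace_overD(2)[OF W'])
      show "\<exists>c. (\<forall>b\<in>(*) t ` B. c b \<in> K) \<and> i - (\<Sum>b\<in>(*) t ` B. c b * b) \<in> W'"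
      proof (cases "t = 0")
        case True
        then show ?thesis using 2 K by (intro exI[of _ "\<lambda>_. 0"]) (auto intro: ring_closed)
      next
        case False
        then have "(\<Sum>b\<in>(*) t ` B. c (b / t) * b) = t * (\<Sum>b\<in>B. c b * b)"
          by (subst sum.reindex) (auto simp: inj_on_def sum_distrib_left mult_ac)
        with False 2 c show ?thesis
          by (intro exI[of _ "\<lambda>b. c (b / t)"]) (auto simp: algebra_simps)
      qed
    qed
    with C show False by (auto simp: quotient_basis_def)
  qed
  with e show ?thesis by simp
qed

subsection \<open>Valuation rings and discrete valuations\<close>

text \<open>The set of nonunits, for a valuation ring its unique maximal ideal.\<close>

definition val_ideal :: "'a::field set \<Rightarrow> 'a set" where
  "val_ideal R = {a\<in>R. a = 0 \<or> inverse a \<notin> R}"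

lemma valuation_ringD:
  assumes "is_valuation_ring K L R"
  shows "is_subring R" "K \<subseteq> R" "R \<subseteq> L" "K \<noteq> R" "R \<noteq> L" "z \<in> L \<Longrightarrow> z \<notin> R \<Longrightarrow> inverse z \<in> R"
  using assms by (auto simp: is_valuation_ring_def)

text \<open>For sums one may assume that a/b lies in \<open>R\<close>. Then a + b is a multiple of
  \<open>b\<close>, so if it were a unit, \<open>b\<close> would be one as well.\<close>

lemma val_ideal_is_ideal:
  assumes L: "is_subfield L" and R: "is_valuation_ring K L R"
  shows "is_ideal R (val_ideal R)"
proof -
  note R' = valuation_ringD[OF R]
  have add: "a + b \<in> val_ideal R"
    if a: "a \<in> val_ideal R" and b: "b \<in> val_ideal R" and nz: "a \<noteq> 0" "b \<noteq> 0" and q: "a / b \<in> R" for a b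
  proof -
    have ab: "a \<in> R" "b \<in> R" "inverse b \<notin> R" using that by (auto simp: val_ideal_def)
    have "inverse (a + b) \<notin> R" if "a + b \<noteq> 0"
    proof
      assume "inverse (a + b) \<in> R"
      then have "(1 + a / b) * inverse (a + b) \<in> R"
        using q by (intro subring_closed R'(1))
      also have "(1 + a / b) * inverse (a + b) = inverse b"
        using nz \<open>a + b \<noteq> 0\<close> by (simp add: field_simps)
      finally show False using ab by simp
    qed
    then show ?thesis using ab R'(1) by (auto simp: val_ideal_def intro: ring_closed)
  qed
  have "a + b \<in> val_ideal R" if a: "a \<in> val_ideal R" and b: "b \<in> val_ideal R" for a b
  proof (cases "a = 0 \<or> b = 0")
    case True then show ?thesis using that by auto
  next
    case False
    have "a \<in> L" "b \<in> L" using a b R' by (auto simp: val_ideal_def)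
    then have "a / b \<in> L" using L by (simp add: subfield_divide)
    then have "a / b \<in> R \<or> b / a \<in> R" using R'(6)[of "a / b"] by (auto simp: field_simps)
    then show ?thesis using add[of a b] add[of b a] a b False by (auto simp: add.commute)
  qed
  moreover have "r * a \<in> val_ideal R" if r: "r \<in> R" and a: "a \<in> val_ideal R" for r a
  proof -
    have "inverse (r * a) \<notin> R" if nz: "r * a \<noteq> 0"
    proof
      assume "inverse (r * a) \<in> R"
      then have "r * inverse (r * a) \<in> R" using r R'(1) by (intro subring_closed)
      also have "r * inverse (r * a) = inverse a" using nz by simp
      finally show False using a nz by (auto simp: val_ideal_def)
    qed
    then show ?thesis using a r R'(1) by (auto simp: val_ideal_def intro: ring_closed)
  qed
  ultimately show ?thesis
    using R'(1) by (auto simp: is_ideal_def val_ideal_def intro: ring_closed)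
qed

lemma ideal_eq_ring:
  assumes "is_subring R" "is_ideal R J" "a \<in> J" "a \<noteq> 0" "inverse a \<in> R"
  shows "J = R"
proof -
  have "inverse a * a \<in> J" using assms unfolding is_ideal_def by blast
  then have "1 \<in> J" using assms by simp
  then have "r * 1 \<in> J" if "r \<in> R" for r using assms that unfolding is_ideal_def by blast
  then show ?thesis using assms by (auto simp: is_ideal_def)
qed

lemma one_notin_val_ideal: "is_subring R \<Longrightarrow> 1 \<notin> val_ideal R"
  by (auto simp: val_ideal_def subring_one)

lemma val_ideal_maximal:
  assumes L: "is_subfield L" and R: "is_valuation_ring K L R"
  shows "is_maximal_ideal R (val_ideal R)"
  unfolding is_maximal_ideal_def
proof (intro conjI allI impI)
  note R' = valuation_ringD[OF R]
  show "is_ideal R (val_ideal R)" using assms by (rule val_ideal_is_ideal)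
  show "val_ideal R \<noteq> R" using one_notin_val_ideal[OF R'(1)] subring_one[OF R'(1)] by auto
  fix J assume J: "is_ideal R J \<and> val_ideal R \<subseteq> J"
  show "J = val_ideal R \<or> J = R"
  proof (cases "J \<subseteq> val_ideal R")
    case False
    then obtain a where "a \<in> J" "a \<notin> val_ideal R" by blast
    then have "a \<noteq> 0" "inverse a \<in> R" using J by (auto simp: val_ideal_def is_ideal_def)
    then have "J = R" using ideal_eq_ring[OF R'(1)] J \<open>a \<in> J\<close> by blast
    then show ?thesis ..
  qed (use J in blast)
qed

lemma maximal_ideal_eq:
  assumes L: "is_subfield L" and R: "is_valuation_ring K L R" and M: "is_maximal_ideal R M"
  shows "M = val_ideal R"
proof -
  note R' = valuation_ringD[OF R]
  have "M \<subseteq> val_ideal R"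
  proof
    fix a assume a: "a \<in> M"
    have "a \<in> R" using a M by (auto simp: is_maximal_ideal_def is_ideal_def)
    moreover have "inverse a \<notin> R" if "a \<noteq> 0"
      using ideal_eq_ring[OF R'(1) _ a that] M by (auto simp: is_maximal_ideal_def)
    ultimately show "a \<in> val_ideal R" by (auto simp: val_ideal_def)
  qed
  then have "val_ideal R = M \<or> val_ideal R = R"
    using M val_ideal_is_ideal[OF L R] unfolding is_maximal_ideal_def by blast
  then show ?thesis using one_notin_val_ideal[OF R'(1)] subring_one[OF R'(1)] by auto
qed

text \<open>The ring is recovered from its nonunits, which is what makes \<open>place_ring\<close>
  well defined.\<close>

lemma valuation_ring_eq:
  assumes R: "is_valuation_ring K L R"
  shows "R = {a\<in>L. a = 0 \<or> inverse a \<notin> val_ideal R}"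
proof (intro equalityI subsetI)
  note R' = valuation_ringD[OF R]
  fix a assume a: "a \<in> R"
  then show "a \<in> {a\<in>L. a = 0 \<or> inverse a \<notin> val_ideal R}"
    using R'(3) by (auto simp: val_ideal_def)
next
  note R' = valuation_ringD[OF R]
  fix a assume "a \<in> {a\<in>L. a = 0 \<or> inverse a \<notin> val_ideal R}"
  then show "a \<in> R" using R'(6)[of a] subring_zero[OF R'(1)] by (auto simp: val_ideal_def)
qed

lemma place_val_ideal:
  assumes L: "is_subfield L" and R: "is_valuation_ring K L R"
  shows "is_place K L (val_ideal R)" "place_ring K L (val_ideal R) = R"
proof -
  show "is_place K L (val_ideal R)"
    unfolding is_place_def using R val_ideal_maximal[OF L R] by blast
  show "place_ring K L (val_ideal R) = R"
    unfolding place_ring_def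
  proof (rule the_equality)
    show "is_valuation_ring K L R \<and> is_maximal_ideal R (val_ideal R)"
      using R val_ideal_maximal[OF L R] by blast
    fix S assume S: "is_valuation_ring K L S \<and> is_maximal_ideal S (val_ideal R)"
    then have "val_ideal R = val_ideal S" using maximal_ideal_eq[OF L] by blast
    then show "S = R" using valuation_ring_eq[of K L S] valuation_ring_eq[OF R] S by simp
  qed
qed

lemma placeD:
  assumes L: "is_subfield L" and P: "is_place K L P"
  shows place_valuation_ring: "is_valuation_ring K L (place_ring K L P)"
    and place_eq: "P = val_ideal (place_ring K L P)"
proof -
  obtain R where R: "is_valuation_ring K L R" "P = val_ideal R"
    using P maximal_ideal_eq[OF L] by (auto simp: is_place_def)
  then show "is_valuation_ring K L (place_ring K L P)" "P = val_ideal (place_ring K L P)"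
    using place_val_ideal[OF L R(1)] by auto
qed

text \<open>\<open>vge v k a\<close> expresses \<open>v a \<ge> k\<close> under the convention \<open>v 0 = \<infinity>\<close>.\<close>

definition vge :: "('a::field \<Rightarrow> int) \<Rightarrow> int \<Rightarrow> 'a \<Rightarrow> bool" where
  "vge v k a \<longleftrightarrow> a = 0 \<or> k \<le> v a"

definition vring :: "'a::field set \<Rightarrow> ('a \<Rightarrow> int) \<Rightarrow> 'a set" where
  "vring L v = {a\<in>L. vge v 0 a}"

definition vplace :: "'a::field set \<Rightarrow> ('a \<Rightarrow> int) \<Rightarrow> 'a set" where
  "vplace L v = {a\<in>L. vge v 1 a}"

text \<open>Discrete valuations of \<open>L\<close> trivial on \<open>K\<close>, normalized by
  \<open>uniformizer\<close> to have all integers as values. The value \<open>v 0\<close> is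
  arbitrary, hence the restriction to nonzero arguments.\<close>

locale dval =
  fixes K L :: "'a::field set" and v :: "'a \<Rightarrow> int"
  assumes subK: "is_subfield K" and subL: "is_subfield L" and KL: "K \<subseteq> L"
    and v_mult: "\<And>a b. a \<in> L \<Longrightarrow> b \<in> L \<Longrightarrow> a \<noteq> 0 \<Longrightarrow> b \<noteq> 0 \<Longrightarrow> v (a * b) = v a + v b"
    and v_add: "\<And>a b. a \<in> L \<Longrightarrow> b \<in> L \<Longrightarrow> a \<noteq> 0 \<Longrightarrow> b \<noteq> 0 \<Longrightarrow> a + b \<noteq> 0 \<Longrightarrow> min (v a) (v b) \<le> v (a + b)"
    and v_const: "\<And>c. c \<in> K \<Longrightarrow> c \<noteq> 0 \<Longrightarrow> v c = 0"
    and uniformizer: "\<exists>t\<in>L. t \<noteq> 0 \<and> v t = 1"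
begin

lemma subringL: "is_subring L" and subringK: "is_subring K"
  using subK subL by (auto intro: subfield_subring)

lemma L_closed [simp, intro]:
  "0 \<in> L" "1 \<in> L"
  "a \<in> L \<Longrightarrow> b \<in> L \<Longrightarrow> a + b \<in> L" "a \<in> L \<Longrightarrow> b \<in> L \<Longrightarrow> a - b \<in> L" "a \<in> L \<Longrightarrow> b \<in> L \<Longrightarrow> a * b \<in> L"
  "a \<in> L \<Longrightarrow> - a \<in> L" "a \<in> L \<Longrightarrow> a ^ n \<in> L" "a \<in> L \<Longrightarrow> inverse a \<in> L"
  "a \<in> L \<Longrightarrow> b \<in> L \<Longrightarrow> a / b \<in> L" "a \<in> L \<Longrightarrow> a powi k \<in> L"
  using subringL subL by (auto intro: ring_closed subfield_power_int)

lemma K_closed [simp, intro]: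
  "0 \<in> K" "1 \<in> K"
  "a \<in> K \<Longrightarrow> b \<in> K \<Longrightarrow> a + b \<in> K" "a \<in> K \<Longrightarrow> b \<in> K \<Longrightarrow> a - b \<in> K" "a \<in> K \<Longrightarrow> b \<in> K \<Longrightarrow> a * b \<in> K"
  "a \<in> K \<Longrightarrow> - a \<in> K" "a \<in> K \<Longrightarrow> a ^ n \<in> K" "a \<in> K \<Longrightarrow> inverse a \<in> K"
  "a \<in> K \<Longrightarrow> b \<in> K \<Longrightarrow> a / b \<in> K"
  using subringK subK by (auto intro: ring_closed)

lemma K_in_L [simp]: "a \<in> K \<Longrightarrow> a \<in> L"
  using KL by blast

lemma v_one [simp]: "v 1 = 0"
  using v_const[of 1] by simp

lemma v_inverse: "a \<in> L \<Longrightarrow> a \<noteq> 0 \<Longrightarrow> v (inverse a) = - v a"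
  using v_mult[of a "inverse a"] by simp

lemma v_divide: "a \<in> L \<Longrightarrow> b \<in> L \<Longrightarrow> a \<noteq> 0 \<Longrightarrow> b \<noteq> 0 \<Longrightarrow> v (a / b) = v a - v b"
  by (simp add: divide_inverse v_mult v_inverse)

lemma v_power: "a \<in> L \<Longrightarrow> a \<noteq> 0 \<Longrightarrow> v (a ^ n) = int n * v a"
  by (induction n) (auto simp: v_mult algebra_simps)

lemma v_power_int: "a \<in> L \<Longrightarrow> a \<noteq> 0 \<Longrightarrow> v (a powi k) = k * v a"
  by (auto simp: power_int_def v_power v_inverse)

lemma v_minus: "a \<in> L \<Longrightarrow> v (- a) = v a"
proof (cases "a = 0")
  case False
  assume "a \<in> L"
  with False have "v ((-1) * a) = v a" using v_mult[of "-1" a] v_const[of "-1"] by simp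
  then show ?thesis by simp
qed simp

lemma vge_zero [simp]: "vge v k 0"
  by (simp add: vge_def)

lemma vge_mono: "vge v k a \<Longrightarrow> j \<le> k \<Longrightarrow> vge v j a"
  by (auto simp: vge_def)

lemma vge_add: "a \<in> L \<Longrightarrow> b \<in> L \<Longrightarrow> vge v k a \<Longrightarrow> vge v k b \<Longrightarrow> vge v k (a + b)"
  using v_add[of a b] by (fastforce simp: vge_def)

lemma vge_minus: "a \<in> L \<Longrightarrow> vge v k a \<Longrightarrow> vge v k (- a)"
  by (auto simp: vge_def v_minus)

lemma vge_diff: "a \<in> L \<Longrightarrow> b \<in> L \<Longrightarrow> vge v k a \<Longrightarrow> vge v k b \<Longrightarrow> vge v k (a - b)"
  using vge_add[of a "- b"] vge_minus[of b] by simp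

lemma vge_mult: "a \<in> L \<Longrightarrow> b \<in> L \<Longrightarrow> vge v k a \<Longrightarrow> vge v j b \<Longrightarrow> vge v (k + j) (a * b)"
  by (cases "a = 0"; cases "b = 0") (auto simp: vge_def v_mult)

lemma vge_const: "c \<in> K \<Longrightarrow> vge v 0 c"
  by (cases "c = 0") (auto simp: vge_def v_const)

lemma vge_const_mult: "c \<in> K \<Longrightarrow> a \<in> L \<Longrightarrow> vge v k a \<Longrightarrow> vge v k (c * a)"
  using vge_mult[of c a 0 k] vge_const by auto

text \<open>Equality in the triangle inequality for distinct values: that the sum has no larger
  value than \<open>a\<close> is seen from a = (a + b) - b.\<close>

lemma v_add_eq:
  assumes "a \<in> L" "b \<in> L" "a \<noteq> 0" "vge v (v a + 1) b"
  shows "a + b \<noteq> 0" "v (a + b) = v a"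
proof -
  show nz: "a + b \<noteq> 0"
  proof
    assume "a + b = 0"
    then have "b = - a" by (simp add: eq_neg_iff_add_eq_0 add.commute)
    with assms show False by (auto simp: vge_def v_minus)
  qed
  show "v (a + b) = v a"
  proof (cases "b = 0")
    case False
    have "v a + 1 \<le> v b" using assms False by (auto simp: vge_def)
    moreover have "min (v (a + b)) (v (- b)) \<le> v (a + b + - b)"
      using nz assms False by (intro v_add) auto
    moreover have "min (v a) (v b) \<le> v (a + b)" using nz assms False by (intro v_add)
    ultimately show ?thesis using assms by (auto simp: v_minus min_def split: if_splits)
  qed simp
qed

lemma subspace_vge: "subspace_over K {a\<in>L. vge v k a}"
  by (auto simp: subspace_over_def intro: vge_add vge_const_mult)

lemma subring_vring: "is_subring (vring L v)"
  using vge_mult[of _ _ 0 0] by (auto simp: is_subring_def vring_def vge_const intro: vge_add vge_diff)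

lemma valuation_ring_vring: "is_valuation_ring K L (vring L v)"
proof -
  obtain t where t: "t \<in> L" "t \<noteq> 0" "v t = 1" using uniformizer by blast
  have "t \<in> vring L v" "t \<notin> K" "inverse t \<notin> vring L v"
    using t v_const[of t] by (auto simp: vring_def vge_def v_inverse)
  moreover have "K \<subseteq> vring L v" "vring L v \<subseteq> L"
    using KL by (auto simp: vring_def vge_const)
  moreover have "inverse t \<in> L" using t by simp
  moreover have "z \<in> vring L v \<or> inverse z \<in> vring L v" if "z \<in> L" for z
    using that by (cases "z = 0") (auto simp: vring_def vge_def v_inverse)
  ultimately show ?thesis using subring_vring unfolding is_valuation_ring_def by blast
qed

lemma val_ideal_vring: "val_ideal (vring L v) = vplace L v"
  by (auto simp: val_ideal_def vring_def vplace_def vge_def v_inverse)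

lemma is_place_vplace: "is_place K L (vplace L v)"
  and place_ring_vplace: "place_ring K L (vplace L v) = vring L v"
  using place_val_ideal[OF subL valuation_ring_vring] by (simp_all add: val_ideal_vring)

text \<open>Every generator of the maximal ideal has value one and every unit value zero, so
  applying \<open>v\<close> to the factorization in \<open>val\<close> determines the
  exponent.\<close>

lemma val_vplace:
  assumes z: "z \<in> L" "z \<noteq> 0"
  shows "val K L (vplace L v) z = v z"
  unfolding val_def place_ring_vplace
proof (rule the_equality)
  obtain t where t: "t \<in> L" "t \<noteq> 0" "v t = 1" using uniformizer by blast
  have "vplace L v = (*) t ` vring L v"
  proof (intro equalityI subsetI)
    fix a assume "a \<in> vplace L v"
    then have "a / t \<in> vring L v"
      using t by (cases "a = 0") (auto simp: vplace_def vring_def vge_def v_divide)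
    then have "t * (a / t) \<in> (*) t ` vring L v" by blast
    then show "a \<in> (*) t ` vring L v" using t by simp
  next
    fix a assume "a \<in> (*) t ` vring L v"
    then obtain r where "r \<in> L" "vge v 0 r" "a = t * r" by (auto simp: vring_def)
    then show "a \<in> vplace L v"
      using t vge_mult[of t r 1 0] by (auto simp: vplace_def vge_def)
  qed
  moreover have "z / t powi v z \<in> vring L v" "z / t powi v z \<noteq> 0" "inverse (z / t powi v z) \<in> vring L v"
    "z = t powi v z * (z / t powi v z)"
    using z t by (auto simp: vring_def vge_def v_divide v_power_int v_inverse)
  ultimately show "\<exists>ta u. vplace L v = (*) ta ` vring L v \<and> u \<in> vring L v \<and> u \<noteq> 0 \<and>
      inverse u \<in> vring L v \<and> z = ta powi v z * u" by blast
next
  fix m assume "\<exists>t u. vplace L v = (*) t ` vring L v \<and> u \<in> vring L v \<and> u \<noteq> 0 \<and>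
      inverse u \<in> vring L v \<and> z = t powi m * u"
  then obtain t u where t: "vplace L v = (*) t ` vring L v" and u: "u \<in> vring L v" "u \<noteq> 0"
      "inverse u \<in> vring L v" and zeq: "z = t powi m * u" by blast
  obtain s where s: "s \<in> L" "s \<noteq> 0" "v s = 1" using uniformizer by blast
  have "t * 1 \<in> vplace L v" using t subring_one[OF subring_vring] by blast
  then have tL: "t \<in> L" "vge v 1 t" by (auto simp: vplace_def)
  have "s \<in> vplace L v" using s by (auto simp: vplace_def vge_def)
  then obtain r where r: "r \<in> vring L v" "s = t * r" using t by blast
  have "t \<noteq> 0" "r \<noteq> 0" using r s by auto
  then have "v t + v r = 1" "v r \<ge> 0" "v t \<ge> 1"
    using s r tL v_mult[of t r] by (auto simp: vring_def vge_def)
  then have "v t = 1" by simp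
  moreover have "v u = 0" "u \<in> L" using u by (auto simp: vring_def vge_def v_inverse)
  ultimately show "m = v z"
    using zeq tL u \<open>t \<noteq> 0\<close> by (simp add: v_mult v_power_int)
qed

text \<open>A larger ring has an element \<open>a\<close> of negative value. Any \<open>b\<close>
  becomes integral after division by a high power of \<open>a\<close>, hence lies in the
  ring.\<close>

lemma vring_maximal:
  assumes R: "is_subring R" "vring L v \<subseteq> R" "R \<subset> L"
  shows "R = vring L v"
proof (rule ccontr)
  assume "R \<noteq> vring L v"
  then obtain a where a: "a \<in> R" "a \<notin> vring L v" using R by blast
  then have aL: "a \<in> L" "a \<noteq> 0" "v a < 0" using R by (auto simp: vring_def vge_def)
  have "b \<in> R" if b: "b \<in> L" "b \<noteq> 0" for b
  proof -
    define k where "k = nat \<bar>v b\<bar>"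
    have "v b - int k * v a \<ge> 0"
    proof -
      have "int k * v a \<le> int k * (-1)" using aL by (intro mult_left_mono) auto
      then show ?thesis by (simp add: k_def)
    qed
    then have "b / a ^ k \<in> vring L v"
      using b aL by (auto simp: vring_def vge_def v_divide v_power)
    then have "b / a ^ k * a ^ k \<in> R" using R a by (intro subring_mult subring_power) auto
    then show ?thesis using aL by simp
  qed
  then show False using R subring_zero[OF R(1)] by blast
qed

end

lemma vplace_eq_imp:
  assumes "dval K L v" "dval K L w" "vring L v \<subseteq> vring L w"
  shows "vplace L v = vplace L w"
proof -
  interpret v: dval K L v by fact
  interpret w: dval K L w by fact
  have "vring L w \<subset> L" using valuation_ringD(3,5)[OF w.valuation_ring_vring] by blast
  then have "vring L w = vring L v"
    using v.vring_maximal w.subring_vring assms(3) by blast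
  then show ?thesis using v.val_ideal_vring w.val_ideal_vring by simp
qed

text \<open>For such a place the description operator in \<open>val\<close> is known to have a value
  for every nonzero argument in \<open>L\<close>.\<close>

definition discrete_place :: "'a::field set \<Rightarrow> 'a set \<Rightarrow> 'a set \<Rightarrow> bool" where
  "discrete_place K L P \<longleftrightarrow> dval K L (val K L P) \<and> P = vplace L (val K L P)"

lemma (in dval) dval_cong:
  assumes "\<And>z. z \<in> L \<Longrightarrow> z \<noteq> 0 \<Longrightarrow> w z = v z"
  shows "dval K L w" "vplace L w = vplace L v" "vring L w = vring L v"
proof -
  show "dval K L w"
    by unfold_locales
      (use subK subL KL v_mult v_add v_const uniformizer in \<open>auto simp: assms\<close>)
  show "vplace L w = vplace L v" "vring L w = vring L v"
    unfolding vplace_def vring_def vge_def using assms by force+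
qed

lemma (in dval) discrete_place_vplace: "discrete_place K L (vplace L v)"
  using dval_cong[of "val K L (vplace L v)"] val_vplace by (auto simp: discrete_place_def)

subsection \<open>Weak approximation\<close>

text \<open>By maximality neither valuation ring contains the other. With \<open>a\<close> in the
  first only and \<open>b\<close> in the second only, a/b has the required signs.\<close>

lemma discrete_place_separate:
  assumes "discrete_place K L P" "discrete_place K L P'" "P \<noteq> P'"
  shows "\<exists>u\<in>L. u \<noteq> 0 \<and> val K L P u > 0 \<and> val K L P' u < 0"
proof -
  let ?v = "val K L P" and ?w = "val K L P'"
  interpret v: dval K L ?v using assms by (simp add: discrete_place_def)
  interpret w: dval K L ?w using assms by (simp add: discrete_place_def)
  have "\<not> vring L ?v \<subseteq> vring L ?w" "\<not> vring L ?w \<subseteq> vring L ?v"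
    using vplace_eq_imp[OF v.dval_axioms w.dval_axioms] vplace_eq_imp[OF w.dval_axioms v.dval_axioms]
      assms by (auto simp: discrete_place_def)
  then obtain a b where "a \<in> vring L ?v" "a \<notin> vring L ?w" "b \<in> vring L ?w" "b \<notin> vring L ?v"
    by blast
  then have "a \<in> L" "a \<noteq> 0" "?v a \<ge> 0" "?w a < 0" "b \<in> L" "b \<noteq> 0" "?w b \<ge> 0" "?v b < 0"
    by (auto simp: vring_def vge_def)
  then show ?thesis by (intro bexI[of _ "a / b"]) (auto simp: v.v_divide w.v_divide)
qed

lemma discrete_place_separate_finite:
  assumes "finite S" "discrete_place K L P" "\<And>P'. P' \<in> S \<Longrightarrow> discrete_place K L P'" "P \<notin> S"
  shows "\<exists>u\<in>L. u \<noteq> 0 \<and> val K L P u > 0 \<and> (\<forall>P'\<in>S. val K L P' u < 0)"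
  using assms(1,3,4)
proof (induction S rule: finite_induct)
  case empty
  interpret v: dval K L "val K L P" using assms by (simp add: discrete_place_def)
  show ?case using v.uniformizer by force
next
  case (insert P2 S)
  then obtain u where u: "u \<in> L" "u \<noteq> 0" "val K L P u > 0" "\<forall>P'\<in>S. val K L P' u < 0" by auto
  interpret v: dval K L "val K L P" using assms by (simp add: discrete_place_def)
  interpret w: dval K L "val K L P2" using insert by (simp add: discrete_place_def)
  show ?case
  proof (cases "val K L P2 u < 0")
    case True
    then show ?thesis using u by (intro bexI[of _ u]) auto
  next
    case False
    obtain z where z: "z \<in> L" "z \<noteq> 0" "val K L P z > 0" "val K L P2 z < 0"
      using discrete_place_separate[of K L P P2] insert assms(2) by auto
    \<comment> \<open>\<open>r\<close> exceeds all values of \<open>u\<close> on \<open>S\<close> in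
      absolute value, so on \<open>S\<close> the summands \<open>z ^ r\<close> and \<open>u\<close>
      never have equal values and the smaller one, which is negative, decides.\<close>
    define r where "r = nat (1 + (\<Sum>P'\<in>S. \<bar>val K L P' u\<bar>))"
    have rbig: "int r > \<bar>val K L P' u\<bar>" if "P' \<in> S" for P'
      using member_le_sum[of P' S "\<lambda>P'. \<bar>val K L P' u\<bar>"] that insert.hyps
      by (simp add: r_def)
    have "(\<Sum>P'\<in>S. \<bar>val K L P' u\<bar>) \<ge> 0" by (rule sum_nonneg) auto
    then have r0: "r \<ge> 1" unfolding r_def by linarith
    have "vge (val K L P2) (val K L P2 (z ^ r) + 1) u"
    proof -
      have "int r * val K L P2 z \<le> 1 * val K L P2 z"
        using r0 z by (intro mult_right_mono_neg) auto
      then have "int r * val K L P2 z < 0" using z by linarith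
      then show ?thesis using False z by (simp add: vge_def w.v_power)
    qed
    then have 2: "z ^ r + u \<noteq> 0" "val K L P2 (z ^ r + u) = val K L P2 (z ^ r)"
      using w.v_add_eq[of "z ^ r" u] z u by auto
    have "val K L P2 (z ^ r + u) < 0"
      using 2 z r0 by (simp add: w.v_power mult_pos_neg)
    moreover have "val K L P (z ^ r + u) > 0"
    proof -
      have "vge (val K L P) 1 (z ^ r + u)"
        using u z r0 by (intro v.vge_add) (auto simp: vge_def v.v_power int_one_le_iff_zero_less)
      then show ?thesis using 2 by (auto simp: vge_def)
    qed
    moreover have "val K L P' (z ^ r + u) < 0" if P': "P' \<in> S" for P'
    proof -
      interpret x: dval K L "val K L P'" using insert P' by (simp add: discrete_place_def)
      have vu: "val K L P' u < 0" using u P' by blast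
      have vz: "val K L P' (z ^ r) = int r * val K L P' z" using z by (simp add: x.v_power)
      show ?thesis
      proof (cases "val K L P' z \<ge> 0")
        case True
        then have "int r * val K L P' z \<ge> 0" by simp
        then have "vge (val K L P') (val K L P' u + 1) (z ^ r)"
          using vu unfolding vge_def vz by linarith
        then show ?thesis using x.v_add_eq[of u "z ^ r"] u z vu by (simp add: add.commute)
      next
        case False
        then have "int r * val K L P' z \<le> int r * (- 1)" by (intro mult_left_mono) auto
        then have "vge (val K L P') (val K L P' (z ^ r) + 1) u"
          using rbig[OF P'] vz vu by (simp add: vge_def)
        then show ?thesis using x.v_add_eq[of "z ^ r" u] u z r0 vz False
          by (simp add: mult_pos_neg)
      qed
    qed
    ultimately show ?thesis using 2 u z by (intro bexI[of _ "z ^ r + u"]) auto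
  qed
qed

text \<open>If \<open>u\<close> has a zero at \<open>P\<close> and poles on \<open>S\<close>, then 1
  / (1 + u^M) is close to 1 at \<open>P\<close> and close to 0 on \<open>S\<close>.\<close>

lemma weak_approximation:
  assumes S: "finite S" "\<And>P'. P' \<in> S \<Longrightarrow> discrete_place K L P'" and P: "discrete_place K L P" "P \<notin> S"
    and M: "M \<ge> 1"
  shows "\<exists>w\<in>L. vge (val K L P) (int M) (w - 1) \<and> (\<forall>P'\<in>S. vge (val K L P') (int M) w)"
proof -
  interpret v: dval K L "val K L P" using P by (simp add: discrete_place_def)
  obtain u where u: "u \<in> L" "u \<noteq> 0" "val K L P u > 0" "\<forall>P'\<in>S. val K L P' u < 0"
    using discrete_place_separate_finite[OF S(1) P(1) S(2) P(2)] by blast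
  have vuM: "val K L P (u ^ M) \<ge> int M"
    using u mult_left_mono[of 1 "val K L P u" "int M"] by (simp add: v.v_power)
  have "vge (val K L P) (val K L P 1 + 1) (u ^ M)"
    using vuM M by (simp add: vge_def)
  then have nz: "1 + u ^ M \<noteq> 0" and v0: "val K L P (1 + u ^ M) = 0"
    using v.v_add_eq[of 1 "u ^ M"] u by auto
  define w where "w = 1 / (1 + u ^ M)"
  have "w - 1 = - (u ^ M) / (1 + u ^ M)" using nz by (simp add: w_def field_simps)
  then have "vge (val K L P) (int M) (w - 1)"
    using u nz v0 vuM by (simp add: vge_def v.v_divide v.v_minus)
  moreover have "vge (val K L P') (int M) w" if P': "P' \<in> S" for P'
  proof -
    interpret x: dval K L "val K L P'" using S P' by (simp add: discrete_place_def)
    have "int M * val K L P' u \<le> int M * (-1)" using u P' by (intro mult_left_mono) auto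
    then have le: "val K L P' (u ^ M) \<le> - int M" using u by (simp add: x.v_power)
    then have "vge (val K L P') (val K L P' (u ^ M) + 1) 1" using M by (simp add: vge_def)
    then have "val K L P' (u ^ M + 1) = val K L P' (u ^ M)"
      using x.v_add_eq[of "u ^ M" 1] u by auto
    then show ?thesis using le nz u by (simp add: w_def vge_def x.v_divide add.commute)
  qed
  ultimately show ?thesis using u by (intro bexI[of _ w]) (auto simp: w_def)
qed

subsection \<open>Function fields with a distinguished rational place\<close>

text \<open>The exponent \<open>m\<close> is unique because no negative power of \<open>t\<close>
  times a unit lies in \<open>R\<close>. It is the valuation sought, and \<open>R\<close> consists
  of zero and the elements with nonnegative exponent.\<close>

lemma discrete_place_val_ideal:
  assumes K: "is_subfield K" and L: "is_subfield L" and R: "is_valuation_ring K L R"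
    and t: "t \<in> R" "t \<noteq> 0" "inverse t \<notin> R"
    and rep: "\<And>f. f \<in> L \<Longrightarrow> f \<noteq> 0 \<Longrightarrow> \<exists>m u. u \<noteq> 0 \<and> u \<in> R \<and> inverse u \<in> R \<and> f = t powi m * u"
  shows "discrete_place K L (val_ideal R)"
proof -
  note R' = valuation_ringD[OF R]
  define U where "U = {u\<in>R. u \<noteq> 0 \<and> inverse u \<in> R}"
  have U_mult: "u * w \<in> U" "u / w \<in> U" if "u \<in> U" "w \<in> U" for u w
    using that subring_mult[OF R'(1)] by (auto simp: U_def divide_inverse)
  have tpow: "t ^ k \<in> R" for k using t R' by (intro subring_power) auto
  have no_neg: "m \<ge> 0" if "t powi m * u \<in> R" "u \<in> U" for m u
  proof (rule ccontr)
    assume "\<not> m \<ge> 0"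
    then obtain k where k: "m = - int (Suc k)" by (metis int_cases of_nat_0_le_iff)
    have "(t powi m * u) * (inverse u * t ^ k) \<in> R"
      using that subring_mult[OF R'(1)] tpow[of k] by (auto simp: U_def)
    also have "t powi m = inverse (t * t ^ k)"
      unfolding k by (simp only: power_int_minus power_int_of_nat power_Suc)
    also have "(inverse (t * t ^ k) * u) * (inverse u * t ^ k) = inverse t"
      using that t by (simp add: U_def field_simps)
    finally show False using t by simp
  qed
  have uniq: "m = k" if "t powi m * u = t powi k * w" "u \<in> U" "w \<in> U" for m k u w
  proof -
    have *: "m \<ge> k" if "t powi m * u = t powi k * w" "u \<in> U" "w \<in> U" for m k u w
    proof -
      have "t powi (m - k) * u = w" using that t by (simp add: power_int_diff field_simps)
      then show ?thesis using no_neg[of "m - k" u] that by (simp add: U_def)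
    qed
    show ?thesis using *[OF that] *[OF that(1)[symmetric] that(3,2)] by simp
  qed
  define w where "w f = (THE m. \<exists>u\<in>U. f = t powi m * u)" for f
  have w_eq: "w (t powi m * u) = m" if "u \<in> U" for m u
    unfolding w_def
  proof (rule the_equality)
    show "\<exists>u'\<in>U. t powi m * u = t powi m * u'" using that by blast
    show "k = m" if "\<exists>u'\<in>U. t powi m * u = t powi k * u'" for k
      using that uniq[of m u k] \<open>u \<in> U\<close> by auto
  qed
  have ex: "\<exists>m. \<exists>u\<in>U. f = t powi m * u" if "f \<in> L" "f \<noteq> 0" for f
    using rep[OF that] by (auto simp: U_def)
  have w_rep: "\<exists>u\<in>U. f = t powi (w f) * u" if f: "f \<in> L" "f \<noteq> 0" for f
  proof -
    obtain m u where "u \<in> U" "f = t powi m * u" using ex[OF f] by blast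
    with w_eq[of u m] show ?thesis by auto
  qed
  have w_mult: "w (a * b) = w a + w b" if ab: "a \<in> L" "b \<in> L" "a \<noteq> 0" "b \<noteq> 0" for a b
  proof -
    obtain u where u: "u \<in> U" "a = t powi w a * u" using w_rep[OF ab(1,3)] by blast
    obtain u' where u': "u' \<in> U" "b = t powi w b * u'" using w_rep[OF ab(2,4)] by blast
    have "a * b = (t powi w a * u) * (t powi w b * u')"
      by (rule arg_cong2[of _ _ _ _ "(*)"]) (fact u(2), fact u'(2))
    also have "\<dots> = t powi (w a + w b) * (u * u')"
      using t by (simp add: power_int_add)
    finally show ?thesis using w_eq[OF U_mult(1)[OF u(1) u'(1)], of "w a + w b"] by simp
  qed
  have w_ring: "a \<in> R \<longleftrightarrow> w a \<ge> 0" if a: "a \<in> L" "a \<noteq> 0" for a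
  proof -
    obtain u where u: "u \<in> U" "a = t powi w a * u" using w_rep[OF a] by blast
    show ?thesis
    proof
      assume "a \<in> R"
      then have "t powi w a * u \<in> R" by (subst u(2)[symmetric])
      then show "w a \<ge> 0" using no_neg u(1) by blast
    next
      assume "w a \<ge> 0"
      then have "t powi w a \<in> R" using tpow by (simp add: power_int_def)
      then have "t powi w a * u \<in> R" using subring_mult[OF R'(1)] u(1) by (auto simp: U_def)
      then show "a \<in> R" by (subst u(2))
    qed
  qed
  have tL: "t \<in> L" using t R' by blast
  have w_add: "w a \<le> w (a + b)"
    if ab: "a \<in> L" "b \<in> L" "a \<noteq> 0" "b \<noteq> 0" "a + b \<noteq> 0" "w a \<le> w b" for a b
  proof -
    have q: "inverse a \<in> L" "b / a \<in> L" "1 + b / a \<in> L"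
      using ab L by (auto intro: ring_closed)
    have "w (a * (b / a)) = w a + w (b / a)" using ab q by (intro w_mult) auto
    then have "w (b / a) \<ge> 0" using ab by simp
    then have "b / a \<in> R" using w_ring[of "b / a"] q ab by simp
    then have "1 + b / a \<in> R" using R'(1) by (auto intro: subring_closed)
    moreover have nz: "1 + b / a \<noteq> 0" using ab by (simp add: field_simps)
    ultimately have "w (1 + b / a) \<ge> 0" using w_ring q by blast
    moreover have "w (a * (1 + b / a)) = w a + w (1 + b / a)" using ab q nz by (intro w_mult) auto
    moreover have "a * (1 + b / a) = a + b" using ab by (simp add: field_simps)
    ultimately show ?thesis by simp
  qed
  have "dval K L w"
  proof
    show "is_subfield K" "is_subfield L" "K \<subseteq> L" using K L R' by auto
    show "w (a * b) = w a + w b" if "a \<in> L" "b \<in> L" "a \<noteq> 0" "b \<noteq> 0" for a b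
      using w_mult that .
    show "min (w a) (w b) \<le> w (a + b)" if "a \<in> L" "b \<in> L" "a \<noteq> 0" "b \<noteq> 0" "a + b \<noteq> 0" for a b
      using w_add[of a b] w_add[of b a] that by (cases "w a \<le> w b") (auto simp: add.commute)
    show "w c = 0" if "c \<in> K" "c \<noteq> 0" for c
    proof -
      have "c \<in> R" "inverse c \<in> R" using that R'(2) subfield_inverse[OF K] by blast+
      then show ?thesis using w_eq[of c 0] that by (simp add: U_def)
    qed
    show "\<exists>t\<in>L. t \<noteq> 0 \<and> w t = 1"
      using w_eq[of 1 1] t tL R'(1) by (intro bexI[of _ t]) (auto simp: U_def subring_one)
  qed
  then interpret dval K L w .
  have "vring L w = R" using R' w_ring subring_zero[OF R'(1)] by (auto simp: vring_def vge_def)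
  then show ?thesis using discrete_place_vplace val_ideal_vring by simp
qed

lemma has_qdim_0_imp: "has_qdim K V W 0 \<Longrightarrow> V \<subseteq> W"
  by (auto simp: has_qdim_def quotient_basis_def)

lemma subspace_zero: "subspace_over K {0}"
  by (auto simp: subspace_over_def)

lemma subspace_mult_subring: "is_subring T \<Longrightarrow> K \<subseteq> T \<Longrightarrow> subspace_over K ((*) z ` T)"
  unfolding subspace_over_def
proof (intro conjI ballI)
  assume T: "is_subring T" "K \<subseteq> T"
  show "0 \<in> (*) z ` T" using subring_zero[OF T(1)] by (auto intro: image_eqI[of _ _ 0])
  show "a + b \<in> (*) z ` T" if "a \<in> (*) z ` T" "b \<in> (*) z ` T" for a b
    using that subring_add[OF T(1)] by (auto simp flip: distrib_left)
  show "c * a \<in> (*) z ` T" if "c \<in> K" "a \<in> (*) z ` T" for a c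
    using that subring_mult[OF T(1)] T(2) by (auto simp: mult.left_commute intro!: image_eqI[of "c * (z * _)"])
qed

text \<open>\<open>R\<close> models functions regular away from one rational place:
  \<open>R_neg\<close> excludes a zero there, \<open>residue\<close> makes its residue field equal
  to \<open>K\<close>, and \<open>frac\<close> makes \<open>L\<close> consist of fractions of
  \<open>R\<close>. The instances are K[u] in K(u) and \<open>RR\<close> in F.\<close>

locale one_place = dval K L v for K L :: "'a::field set" and v +
  fixes R :: "'a set"
  assumes R_ring: "is_subring R" and KR: "K \<subseteq> R" and RL: "R \<subseteq> L"
    and frac: "\<And>a. a \<in> L \<Longrightarrow> \<exists>b\<in>R. b \<noteq> 0 \<and> b * a \<in> R"
    and R_neg: "\<And>a. a \<in> R \<Longrightarrow> a \<noteq> 0 \<Longrightarrow> v a \<le> 0"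
    and residue: "\<And>a. a \<in> L \<Longrightarrow> a \<noteq> 0 \<Longrightarrow> v a = 0 \<Longrightarrow> \<exists>c\<in>K. vge v 1 (a - c)"
    and regular: "\<And>P. is_place K L P \<Longrightarrow> P \<noteq> vplace L v \<Longrightarrow> R \<subseteq> place_ring K L P"
begin

definition orders :: "nat set" where
  "orders = {nat (- v a) | a. a \<in> R \<and> a \<noteq> 0}"

definition Rle :: "int \<Rightarrow> 'a set" where
  "Rle M = {a\<in>R. vge v (- M) a}"

lemma R_in_L [simp]: "a \<in> R \<Longrightarrow> a \<in> L"
  using RL by blast

lemma subspace_Rle: "subspace_over K (Rle M)"
  unfolding subspace_over_def
proof (intro conjI ballI)
  show "0 \<in> Rle M" using subring_zero[OF R_ring] by (simp add: Rle_def)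
  show "a + b \<in> Rle M" if "a \<in> Rle M" "b \<in> Rle M" for a b
    using that subring_add[OF R_ring] vge_add[of a b] by (simp add: Rle_def)
  show "c * a \<in> Rle M" if "c \<in> K" "a \<in> Rle M" for c a
    using that subring_mult[OF R_ring] KR vge_const_mult[of c a] by (auto simp: Rle_def)
qed

text \<open>Two functions of the same pole order differ, up to lower order, by a factor from the
  residue field, which is \<open>K\<close>.\<close>

lemma has_qdim_Rle_step:
  "has_qdim K (Rle (int M)) (Rle (int M - 1)) (if M \<in> orders then 1 else 0)"
proof (cases "M \<in> orders")
  case False
  have "Rle (int M) = Rle (int M - 1)"
  proof (intro equalityI subsetI)
    fix a assume a: "a \<in> Rle (int M)"
    have "v a \<noteq> - int M" if "a \<noteq> 0"
    proof
      assume "v a = - int M"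
      then have "nat (- v a) = M" by simp
      then show False using False a that unfolding orders_def Rle_def by blast
    qed
    then show "a \<in> Rle (int M - 1)" using a by (cases "a = 0") (auto simp: Rle_def vge_def)
  qed (auto simp: Rle_def vge_def)
  then show ?thesis using False has_qdim_0[OF subspace_Rle] by simp
next
  case True
  then obtain a where a: "a \<in> R" "a \<noteq> 0" "M = nat (- v a)" by (auto simp: orders_def)
  then have va: "v a = - int M" using R_neg by simp
  have "has_qdim K (Rle (int M)) (Rle (int M - 1)) 1"
  proof (rule has_qdim_1[OF subK subspace_Rle])
    show "a \<in> Rle (int M)" "a \<notin> Rle (int M - 1)" using a va by (auto simp: Rle_def vge_def)
    fix b assume b: "b \<in> Rle (int M)"
    show "\<exists>c\<in>K. b - c * a \<in> Rle (int M - 1)"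
    proof (cases "b \<in> Rle (int M - 1)")
      case True then show ?thesis by (intro bexI[of _ 0]) auto
    next
      case False
      then have bR: "b \<in> R" "b \<noteq> 0" "v b = - int M" using b by (auto simp: Rle_def vge_def)
      have "v (b / a) = 0" "b / a \<in> L" "b / a \<noteq> 0" using a bR va by (simp_all add: v_divide)
      then obtain c where c: "c \<in> K" "vge v 1 (b / a - c)" using residue by blast
      have "vge v (v a + 1) (a * (b / a - c))"
        using a bR c by (intro vge_mult) (simp_all add: vge_def)
      moreover have "a * (b / a - c) = b - c * a" using a by (simp add: field_simps)
      moreover have "v a + 1 = - (int M - 1)" using va by simp
      ultimately have "vge v (- (int M - 1)) (b - c * a)" by metis
      moreover have "b - c * a \<in> R" using a bR c KR by (auto intro!: subring_closed[OF R_ring])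
      ultimately show ?thesis using c by (auto simp: Rle_def)
    qed
  qed
  with True show ?thesis by simp
qed

lemma Rle_neg: "Rle (-1) = {0}"
proof -
  have "a = 0" if "a \<in> R" "vge v 1 a" for a
    using that R_neg[of a] by (force simp: vge_def)
  then show ?thesis by (auto simp: Rle_def intro: subring_closed[OF R_ring])
qed

text \<open>\<open>Rle (-1)\<close> is zero, and from there the dimension rises by one at each pole
  order.\<close>

lemma has_qdim_Rle: "has_qdim K (Rle (int M)) {0} (card {h\<in>orders. h \<le> M})"
proof (induction M)
  case 0
  have "{h\<in>orders. h \<le> 0} = (if 0 \<in> orders then {0} else {})" by auto
  then show ?case using has_qdim_Rle_step[of 0] by (auto simp: Rle_neg split: if_splits)
next
  case (Suc M)
  have "has_qdim K (Rle (int (Suc M))) {0}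
      ((if Suc M \<in> orders then 1 else 0) + card {h\<in>orders. h \<le> M})"
  proof (rule has_qdim_tower[OF subK subspace_Rle])
    show "has_qdim K (Rle (int (Suc M))) (Rle (int M)) (if Suc M \<in> orders then 1 else 0)"
      using has_qdim_Rle_step[of "Suc M"] by simp
    show "Rle (int M) \<subseteq> Rle (int (Suc M))" by (auto simp: Rle_def vge_def)
    show "{0} \<subseteq> Rle (int M)" using subspace_overD(1)[OF subspace_Rle] by simp
  qed (rule Suc.IH)
  moreover have "{h\<in>orders. h \<le> Suc M} =
      (if Suc M \<in> orders then insert (Suc M) {h\<in>orders. h \<le> M} else {h\<in>orders. h \<le> M})"
    by (auto simp: le_Suc_eq)
  then have "card {h\<in>orders. h \<le> Suc M} =
      (if Suc M \<in> orders then 1 else 0) + card {h\<in>orders. h \<le> M}"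
    by simp
  ultimately show ?case by (simp only:)
qed

text \<open>Any \<open>r > - v z\<close> elements are linearly dependent over \<open>K(z)\<close>: otherwise their products with
  powers of \<open>z\<close> would span too large a subspace of some \<open>Rle M\<close>.\<close>

lemma relation_over_powers:
  assumes z: "z \<in> R" "z \<noteq> 0" and I: "finite I" "nat (- v z) < card I"
    and f: "\<And>i. i \<in> I \<Longrightarrow> f i \<in> L"
  obtains c r where "\<forall>i\<in>I. c i \<in> K" "\<exists>i\<in>I. c i \<noteq> 0"
    "\<forall>i\<in>I. \<forall>T. is_subring T \<longrightarrow> K \<subseteq> T \<longrightarrow> z \<in> T \<longrightarrow> r i \<in> T"
    "(\<Sum>i\<in>I. (c i + z * r i) * f i) = 0"
proof -
  define s where "s = nat (- v z)"
  have vz: "v z = - int s" using R_neg[OF z] by (simp add: s_def)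
  obtain d where d: "\<And>i. i \<in> I \<Longrightarrow> d i \<in> R \<and> d i \<noteq> 0 \<and> d i * f i \<in> R"
  proof -
    have "\<forall>i\<in>I. \<exists>d. d \<in> R \<and> d \<noteq> 0 \<and> d * f i \<in> R" using frac f by blast
    from bchoice[OF this] that show thesis by blast
  qed
  \<comment> \<open>A common denominator: it moves all \<open>f i\<close> into \<open>R\<close>,
    where dimensions can be counted, and cancels at the end.\<close>
  define b where "b = (\<Prod>i\<in>I. d i)"
  have b: "b \<in> R" "b \<noteq> 0" using d I by (auto simp: b_def intro: subring_closed[OF R_ring])
  have bf: "b * f i \<in> R" if "i \<in> I" for i
  proof -
    have "(\<Prod>i\<in>I - {i}. d i) * (d i * f i) \<in> R"
      using d that by (intro subring_mult[OF R_ring subring_prod[OF R_ring]]) auto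
    also have "(\<Prod>i\<in>I - {i}. d i) * (d i * f i) = b * f i"
      using that I by (simp add: b_def prod.remove[of I i] mult_ac)
    finally show ?thesis .
  qed
  define C where "C = nat (\<Sum>i\<in>I. \<bar>v (b * f i)\<bar>)"
  have C: "vge v (- int C) (b * f i)" if "i \<in> I" for i
    using member_le_sum[of i I "\<lambda>i. \<bar>v (b * f i)\<bar>"] that I by (auto simp: vge_def C_def)
  \<comment> \<open>The products \<open>z ^ j * (b * f i)\<close> with j <= C + 1 lie in
    \<open>Rle M\<close> for M = C + (C + 1) s, of dimension at most M + 1. There are at least (s +
    1) (C + 2) = M + 1 + (s + 1) of them, so they are dependent.\<close>
  define J where "J = C + 2"
  define F where "F = (\<lambda>(i, j). z ^ j * (b * f i))"
  define M where "M = C + (C + 1) * s"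
  have F: "F p \<in> Rle (int M)" if p: "p \<in> I \<times> {..<J}" for p
  proof -
    obtain i j where ij: "p = (i, j)" "i \<in> I" "j < J" using p by auto
    have "vge v (- int (j * s)) (z ^ j)" using z by (simp add: vge_def v_power vz)
    then have "vge v (- int (j * s) + - int C) (z ^ j * (b * f i))"
      using bf C ij z by (intro vge_mult) auto
    moreover have "j * s \<le> (C + 1) * s" using ij by (intro mult_right_mono) (auto simp: J_def)
    then have "- int M \<le> - int (j * s) + - int C"
      unfolding M_def of_nat_add by linarith
    ultimately have "vge v (- int M) (z ^ j * (b * f i))" using vge_mono by blast
    moreover have "z ^ j * (b * f i) \<in> R"
      using z bf ij by (intro subring_mult[OF R_ring subring_power[OF R_ring]]) auto
    ultimately show ?thesis using ij by (simp add: F_def Rle_def)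
  qed
  have "card {h\<in>orders. h \<le> M} \<le> card {..M}" by (intro card_mono) auto
  then have "card {h\<in>orders. h \<le> M} \<le> M + 1" by simp
  also have "M + 1 < (s + 1) * J" by (simp add: M_def J_def algebra_simps)
  also have "(s + 1) * J \<le> card I * J" using I by (intro mult_right_mono) (auto simp: s_def)
  also have "card I * J = card (I \<times> {..<J})" by (simp add: card_cartesian_product)
  finally have "\<exists>c. (\<forall>p\<in>I \<times> {..<J}. c p \<in> K) \<and> (\<exists>p\<in>I \<times> {..<J}. c p \<noteq> 0) \<and>
      (\<Sum>p\<in>I \<times> {..<J}. c p * F p) \<in> {0}"
    using I F by (intro has_qdim_dependent[OF subK subspace_zero has_qdim_Rle[of M]]) auto
  then obtain c where cK: "\<forall>p\<in>I \<times> {..<J}. c p \<in> K"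
    and c0: "(\<exists>p\<in>I \<times> {..<J}. c p \<noteq> 0) \<and> (\<Sum>p\<in>I \<times> {..<J}. c p * F p) \<in> {0}"
    by (elim exE conjE) (rule that, assumption, rule conjI)
  have c: "\<And>p. p \<in> I \<times> {..<J} \<Longrightarrow> c p \<in> K" "\<exists>p\<in>I \<times> {..<J}. c p \<noteq> 0"
      "(\<Sum>p\<in>I \<times> {..<J}. c p * F p) = 0"
    using cK c0 by auto
  \<comment> \<open>Dividing by the lowest power of \<open>z\<close> that occurs for any index
    leaves some coefficient with nonzero constant term \<open>c (i, j0)\<close>, so the relation
    stays nontrivial modulo \<open>z\<close>.\<close>
  define N where "N j \<longleftrightarrow> j < J \<and> (\<exists>i\<in>I. c (i, j) \<noteq> 0)" for j
  define j0 where "j0 = (LEAST j. N j)"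
  have "\<exists>j. N j" using c(2) by (auto simp: N_def)
  then have j0: "N j0" unfolding j0_def by (rule LeastI_ex)
  have less: "c (i, j) = 0" if "i \<in> I" "j < j0" for i j
  proof -
    have "\<not> N j" using that(2) unfolding j0_def by (rule not_less_Least)
    then show ?thesis using that j0 by (auto simp: N_def)
  qed
  \<comment> \<open>\<open>r i\<close> is a polynomial in \<open>z\<close> over \<open>K\<close>;
    the conclusion expresses this as membership in every subring that contains \<open>K\<close> and
    \<open>z\<close>.\<close>
  define r where "r i = (\<Sum>j\<in>{j0<..<J}. c (i, j) * z ^ (j - j0 - 1))" for i
  have inner: "(\<Sum>j<J. c (i, j) * z ^ j) = z ^ j0 * (c (i, j0) + z * r i)" if i: "i \<in> I" for i
  proof -
    have "j0 < J" using j0 by (simp add: N_def)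
    then show ?thesis unfolding r_def by (rule sum_power_split_least) (rule less[OF i])
  qed
  have "0 = (\<Sum>i\<in>I. \<Sum>j<J. c (i, j) * F (i, j))"
    using c(3) I by (simp add: sum.cartesian_product)
  also have "\<dots> = (\<Sum>i\<in>I. (\<Sum>j<J. c (i, j) * z ^ j) * (b * f i))"
    by (intro sum.cong refl) (simp add: F_def sum_distrib_right sum_distrib_left mult_ac)
  also have "\<dots> = (\<Sum>i\<in>I. b * z ^ j0 * ((c (i, j0) + z * r i) * f i))"
    using inner by (intro sum.cong) (auto simp: mult_ac)
  also have "\<dots> = b * z ^ j0 * (\<Sum>i\<in>I. (c (i, j0) + z * r i) * f i)"
    by (simp add: sum_distrib_left)
  finally have "(\<Sum>i\<in>I. (c (i, j0) + z * r i) * f i) = 0" using b z by simp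
  moreover have "r i \<in> T" if "i \<in> I" "is_subring T" "K \<subseteq> T" "z \<in> T" for i T
    unfolding r_def using that c(1) by (auto intro!: subring_closed[OF that(2)])
  moreover have "\<forall>i\<in>I. c (i, j0) \<in> K" "\<exists>i\<in>I. c (i, j0) \<noteq> 0" using c(1) j0 by (auto simp: N_def)
  ultimately show thesis by (intro that[of "\<lambda>i. c (i, j0)" r]) blast+
qed

text \<open>Modulo z T the relation from \<open>relation_over_powers\<close> keeps only its constant
  coefficients, which are not all zero.\<close>

lemma independent_mod_multiple_card_le:
  assumes T: "is_subring T" "K \<subseteq> T" "T \<subseteq> L" and z: "z \<in> R" "z \<noteq> 0" "z \<in> T"
    and B: "finite B" "B \<subseteq> T" "independent_mod K ((*) z ` T) B"
  shows "card B \<le> nat (- v z)"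
proof (rule ccontr)
  assume "\<not> card B \<le> nat (- v z)"
  then have "nat (- v z) < card B" by simp
  moreover have "i \<in> L" if "i \<in> B" for i using that B(2) T(3) by blast
  ultimately obtain c r where c: "\<forall>i\<in>B. c i \<in> K" "\<exists>i\<in>B. c i \<noteq> 0"
      "\<forall>i\<in>B. \<forall>T. is_subring T \<longrightarrow> K \<subseteq> T \<longrightarrow> z \<in> T \<longrightarrow> r i \<in> T"
      "(\<Sum>i\<in>B. (c i + z * r i) * i) = 0"
    by (rule relation_over_powers[where f = "\<lambda>i. i", OF z(1,2) B(1)])
  have "(\<Sum>i\<in>B. (c i + z * r i) * i) = (\<Sum>i\<in>B. c i * i) + z * (\<Sum>i\<in>B. r i * i)"
    unfolding sum_distrib_left sum.distrib[symmetric]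
      by (intro sum.cong refl) (simp add: algebra_simps)
  then have "(\<Sum>i\<in>B. c i * i) = z * (- (\<Sum>i\<in>B. r i * i))"
    using c(4) by (simp add: eq_neg_iff_add_eq_0)
  moreover have "- (\<Sum>i\<in>B. r i * i) \<in> T"
    using T z B(2) by (intro subring_uminus[OF T(1)] subring_sum[OF T(1)] subring_mult[OF T(1)]) (use c(3) in auto)
  ultimately have "(\<Sum>i\<in>B. c i * i) \<in> (*) z ` T" by blast
  then show False using c B(3) unfolding independent_mod_def by blast
qed

lemma has_qdim_mod_multiple:
  assumes T: "is_subring T" "K \<subseteq> T" "T \<subseteq> L" and z: "z \<in> R" "z \<noteq> 0" "z \<in> T"
  shows "\<exists>d\<le>nat (- v z). has_qdim K T ((*) z ` T) d"
  by (rule has_qdim_exists[OF subK subspace_mult_subring[OF T(1,2)]])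
    (rule independent_mod_multiple_card_le[OF assms])

text \<open>Otherwise all nonzero elements of \<open>R\<close> would be units of the place ring,
  which would then contain every fraction of \<open>R\<close>, that is, all of
  \<open>L\<close>.\<close>

lemma place_meets_R:
  assumes P: "is_place K L P" "P \<noteq> vplace L v"
  shows "\<exists>z\<in>R. z \<noteq> 0 \<and> z \<in> P"
proof (rule ccontr)
  assume contra: "\<not> ?thesis"
  let ?O = "place_ring K L P"
  note O = valuation_ringD[OF place_valuation_ring[OF subL P(1)]]
  have "a \<in> ?O" if a: "a \<in> L" for a
  proof -
    obtain b where b: "b \<in> R" "b \<noteq> 0" "b * a \<in> R" using frac a by blast
    have bO: "b \<in> ?O" "b * a \<in> ?O" using regular[OF P] b by auto
    have "b \<notin> P" using contra b by blast
    then have "inverse b \<in> ?O" using bO place_eq[OF subL P(1)] by (auto simp: val_ideal_def)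
    then have "inverse b * (b * a) \<in> ?O" by (rule subring_mult[OF O(1) _ bO(2)])
    moreover have "inverse b * (b * a) = a" using b by (simp add: mult.assoc[symmetric])
    ultimately show ?thesis by simp
  qed
  then show False using O by blast
qed

text \<open>Let T be the ring of \<open>P\<close> and take a nonzero \<open>z\<close> in both
  \<open>R\<close> and \<open>P\<close>, so that T/zT has finite dimension. Among the nonzero
  \<open>t\<close> in \<open>P\<close> dividing \<open>z\<close>, one with the smallest dimension of
  T/tT generates \<open>P\<close>. That no nonzero element is divisible by all powers of
  \<open>t\<close> comes from a relation over powers.\<close>

lemma discrete_place:
  assumes P: "is_place K L P"
  shows "discrete_place K L P"
proof (cases "P = vplace L v")
  case True
  then show ?thesis using discrete_place_vplace by simp
next
  case False
  define T where "T = place_ring K L P"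
  have VT: "is_valuation_ring K L T" and PT: "P = val_ideal T"
    using placeD[OF subL P] by (auto simp: T_def)
  note T = valuation_ringD[OF VT]
  have RT: "R \<subseteq> T" using regular[OF P False] by (simp add: T_def)
  have ideal: "is_ideal T P" using val_ideal_is_ideal[OF subL VT] PT by simp
  have P_mult: "a * r \<in> P" if "a \<in> P" "r \<in> T" for a r
    using ideal that unfolding is_ideal_def by (metis mult.commute)
  have unitP: "inverse a \<in> T" if "a \<in> T" "a \<notin> P" for a
    using that PT by (auto simp: val_ideal_def)
  have KP: "c = 0" if "c \<in> K" "c \<in> P" for c
  proof (rule ccontr)
    assume "c \<noteq> 0"
    moreover have "inverse c \<in> T" using that T by auto
    ultimately show False using that PT by (auto simp: val_ideal_def)
  qed
  obtain z where z: "z \<in> R" "z \<noteq> 0" "z \<in> P" using place_meets_R[OF P False] by blast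
  have subsp: "subspace_over K ((*) t ` T)" for t by (rule subspace_mult_subring[OF T(1,2)])
  define good where "good t d \<longleftrightarrow> t \<in> P \<and> t \<noteq> 0 \<and> z \<in> (*) t ` T \<and> has_qdim K T ((*) t ` T) d" for t d
  obtain d0 where d0: "has_qdim K T ((*) z ` T) d0"
    using has_qdim_mod_multiple[OF T(1,2,3) z(1,2)] z RT by blast
  have "good z d0" using z d0 subring_one[OF T(1)] by (auto simp: good_def intro!: image_eqI[of _ _ 1])
  define D where "D = (LEAST d. \<exists>t. good t d)"
  have "\<exists>t. good t D" unfolding D_def by (rule LeastI_ex) (use \<open>good z d0\<close> in blast)
  then obtain t where t: "good t D" by blast
  have least: "D \<le> d" if "good w d" for w d
    unfolding D_def by (rule Least_le) (use that in blast)
  have tP: "t \<in> P" "t \<noteq> 0" and tT: "t \<in> T" using t PT by (auto simp: good_def val_ideal_def)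
  have P_eq: "P = (*) t ` T"
  proof (intro equalityI subsetI)
    fix w assume w: "w \<in> P"
    show "w \<in> (*) t ` T"
    proof (rule ccontr)
      assume nin: "w \<notin> (*) t ` T"
      have w0: "w \<noteq> 0" using nin subring_zero[OF T(1)] by (auto intro: image_eqI[of _ _ 0])
      have wT: "w \<in> T" using w PT by (auto simp: val_ideal_def)
      have "w / t \<notin> T"
      proof
        assume "w / t \<in> T"
        then have "t * (w / t) \<in> (*) t ` T" by blast
        then show False using nin tP by simp
      qed
      moreover have "w / t \<in> L" using wT tT T(3) by auto
      ultimately have tw: "t / w \<in> T" using T(6)[of "w / t"] by simp
      have sub: "(*) t ` T \<subseteq> (*) w ` T"
      proof
        fix x assume "x \<in> (*) t ` T"
        then obtain r where r: "r \<in> T" "x = t * r" by blast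
        then have "x = w * (t / w * r)" using w0 by simp
        then show "x \<in> (*) w ` T" using subring_mult[OF T(1) tw r(1)] by blast
      qed
      have "(*) w ` T \<subseteq> T" using subring_mult[OF T(1)] wT by auto
      then obtain a b where ab: "has_qdim K ((*) w ` T) ((*) t ` T) a" "has_qdim K T ((*) w ` T) b" "a + b = D"
        using has_qdim_between[OF subK subsp subsp sub, of T D] t unfolding good_def by metis
      \<comment> \<open>\<open>t\<close> is a multiple of \<open>w\<close>, so minimality of
        \<open>D\<close> forces the dimension of wT/tT to vanish.\<close>
      have "good w b" using ab w w0 t sub by (auto simp: good_def)
      then have "a = 0" using least ab by fastforce
      then have "(*) w ` T \<subseteq> (*) t ` T" using ab has_qdim_0_imp by blast
      moreover have "w * 1 \<in> (*) w ` T" using subring_one[OF T(1)] by blast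
      ultimately show False using nin by auto
    qed
  qed (use P_mult tP in auto)
  have t_inv: "inverse t \<notin> T" using tP PT by (auto simp: val_ideal_def)
  have tpow: "t ^ k \<in> T" for k using tT T(1) by (intro subring_power)
  \<comment> \<open>If all powers of \<open>t\<close> divide \<open>f\<close>, they divide a
    multiple \<open>y\<close> of it in \<open>R\<close>. With \<open>s\<close> the pole order of
    \<open>y\<close>, the powers of \<open>t\<close> up to \<open>s\<close> satisfy a relation over
    K[y]. Since \<open>t ^ Suc s\<close> divides \<open>y\<close>, its lowest nonzero constant
    coefficient \<open>c i0\<close> would be a multiple of \<open>t\<close>, but \<open>P\<close>
    contains no nonzero constant.\<close>
  have finite_order: "\<exists>k. f \<notin> (*) (t ^ k) ` T" if f: "f \<in> T" "f \<noteq> 0" for f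
  proof (rule ccontr)
    assume "\<not> ?thesis"
    then have fk: "f \<in> (*) (t ^ k) ` T" for k by blast
    obtain b where b: "b \<in> R" "b \<noteq> 0" "b * f \<in> R" using frac f T(3) by blast
    define y where "y = b * f"
    have y: "y \<in> R" "y \<noteq> 0" using b f by (auto simp: y_def)
    have yk: "y \<in> (*) (t ^ k) ` T" for k
    proof -
      obtain g where "g \<in> T" "f = t ^ k * g" using fk[of k] by blast
      then have "y = t ^ k * (b * g)" "b * g \<in> T"
        using b RT T(1) by (auto simp: y_def mult_ac intro: subring_mult)
      then show ?thesis by blast
    qed
    define s where "s = nat (- v y)"
    have "nat (- v y) < card {..s}" by (simp add: s_def)
    moreover have "t ^ i \<in> L" for i using tpow T(3) by blast
    ultimately obtain c r where c: "\<forall>i\<in>{..s}. c i \<in> K" "\<exists>i\<in>{..s}. c i \<noteq> 0"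
        "\<forall>i\<in>{..s}. \<forall>T. is_subring T \<longrightarrow> K \<subseteq> T \<longrightarrow> y \<in> T \<longrightarrow> r i \<in> T"
        "(\<Sum>i\<in>{..s}. (c i + y * r i) * t ^ i) = 0"
      by (rule relation_over_powers[where f = "\<lambda>i. t ^ i", OF y finite_atMost])
    have rT: "r i \<in> T" if "i \<le> s" for i using c(3) that T RT y by auto
    define i0 where "i0 = (LEAST i. c i \<noteq> 0)"
    have "\<exists>i. c i \<noteq> 0" using c(2) by blast
    then have ci0: "c i0 \<noteq> 0" unfolding i0_def by (rule LeastI_ex)
    have i0_less: "c i = 0" if "i < i0" for i using not_less_Least[of i "\<lambda>i. c i \<noteq> 0"] that by (auto simp: i0_def)
    have "i0 \<le> s" using c(2) i0_less by (meson atMost_iff le_trans not_le)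
    obtain w where w: "w \<in> T" "y = t ^ Suc s * w" using yk[of "Suc s"] by blast
    have "i0 < Suc s" using \<open>i0 \<le> s\<close> by simp
    then have 1: "(\<Sum>i\<le>s. c i * t ^ i) =
        t ^ i0 * (c i0 + t * (\<Sum>i\<in>{i0<..<Suc s}. c i * t ^ (i - i0 - 1)))"
      unfolding lessThan_Suc_atMost[symmetric] by (rule sum_power_split_least) (rule i0_less)
    have "(\<Sum>i\<le>s. (c i + y * r i) * t ^ i) = (\<Sum>i\<le>s. c i * t ^ i) + y * (\<Sum>i\<le>s. r i * t ^ i)"
      unfolding sum_distrib_left sum.distrib[symmetric]
      by (intro sum.cong refl) (simp add: algebra_simps)
    then have "(\<Sum>i\<le>s. c i * t ^ i) + y * (\<Sum>i\<le>s. r i * t ^ i) = 0" using c(4) by simp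
    moreover have "y = t ^ i0 * (t * (t ^ (s - i0) * w))"
    proof -
      have "t ^ Suc s = t ^ (i0 + (1 + (s - i0)))" using \<open>i0 \<le> s\<close> by simp
      also have "\<dots> = t ^ i0 * t * t ^ (s - i0)" by (simp only: power_add) simp
      finally have e: "t ^ Suc s = t ^ i0 * t * t ^ (s - i0)" .
      show ?thesis unfolding w(2) e by (simp only: mult_ac)
    qed
    moreover define g where "g = (\<Sum>i\<in>{i0<..<Suc s}. c i * t ^ (i - i0 - 1)) + t ^ (s - i0) * w * (\<Sum>i\<le>s. r i * t ^ i)"
    ultimately have "t ^ i0 * (c i0 + t * g) = 0"
      unfolding 1 by (simp add: algebra_simps)
    then have "c i0 = t * (- g)"
      using tP(2) by (simp add: eq_neg_iff_add_eq_0)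
    moreover have "(\<Sum>i\<in>{i0<..<Suc s}. c i * t ^ (i - i0 - 1)) \<in> T"
      by (rule subring_sum[OF T(1)], rule subring_mult[OF T(1) _ tpow]) (use c(1) T(2) in auto)
    moreover have "(\<Sum>i\<le>s. r i * t ^ i) \<in> T"
      by (rule subring_sum[OF T(1)], rule subring_mult[OF T(1) _ tpow]) (use rT in auto)
    ultimately have "c i0 = t * (- g)" "- g \<in> T"
      unfolding g_def by (blast intro: subring_add[OF T(1)] subring_uminus[OF T(1)] subring_mult[OF T(1)] tpow w(1))+
    then have "c i0 \<in> P" using P_eq by blast
    then show False using KP ci0 c(1) \<open>i0 \<le> s\<close> by auto
  qed
  have rep: "\<exists>k u. u \<noteq> 0 \<and> u \<in> T \<and> inverse u \<in> T \<and> f = t ^ k * u" if f: "f \<in> T" "f \<noteq> 0" for f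
  proof -
    \<comment> \<open>\<open>k\<close> is the first exponent for which \<open>t ^ k\<close> fails to
      divide \<open>f\<close>, so the cofactor of the preceding power is a unit.\<close>
    define k where "k = (LEAST k. f \<notin> (*) (t ^ k) ` T)"
    have k: "f \<notin> (*) (t ^ k) ` T" unfolding k_def by (rule LeastI_ex) (rule finite_order[OF f])
    have k_less: "f \<in> (*) (t ^ j) ` T" if "j < k" for j
      using not_less_Least[of j "\<lambda>k. f \<notin> (*) (t ^ k) ` T"] that by (auto simp: k_def)
    have "k \<noteq> 0" using k f by (auto intro: image_eqI[of _ _ f])
    then obtain j where j: "k = Suc j" by (cases k) auto
    then obtain u where u: "u \<in> T" "f = t ^ j * u" using k_less[of j] by auto
    have "u \<notin> P"
    proof
      assume "u \<in> P"
      then obtain g where "g \<in> T" "u = t * g" using P_eq by blast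
      then have "f = t ^ k * g" using u j by (simp add: mult_ac)
      then show False using k \<open>g \<in> T\<close> by blast
    qed
    then show ?thesis using u f unitP[OF u(1)] by (intro exI[of _ j] exI[of _ u]) auto
  qed
  have "discrete_place K L (val_ideal T)"
  proof (rule discrete_place_val_ideal[OF subK subL VT tT tP(2) t_inv])
    fix f assume f: "f \<in> L" "f \<noteq> 0"
    show "\<exists>m u. u \<noteq> 0 \<and> u \<in> T \<and> inverse u \<in> T \<and> f = t powi m * u"
    proof (cases "f \<in> T")
      case True
      then show ?thesis using rep[OF True f(2)] by (metis power_int_of_nat)
    next
      case False
      then have "inverse f \<in> T" using T(6) f by blast
      then obtain k u where u: "u \<noteq> 0" "u \<in> T" "inverse u \<in> T" "inverse f = t ^ k * u"
        using rep[of "inverse f"] f by auto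
      then have "f = inverse (t ^ k * u)" by (metis inverse_inverse_eq)
      then have "f = t powi (- int k) * inverse u" by (simp add: power_int_minus)
      then show ?thesis using u by (intro exI[of _ "- int k"] exI[of _ "inverse u"]) auto
    qed
  qed
  then show ?thesis using PT by simp
qed

end

subsection \<open>Riemann's inequality and the number of gaps\<close>

context one_place
begin

lemma place_facts:
  assumes P: "is_place K L P"
  shows dval_place: "dval K L (val K L P)" and place_eq_vplace: "P = vplace L (val K L P)"
    and place_ring_eq_vring: "place_ring K L P = vring L (val K L P)"
proof -
  show d: "dval K L (val K L P)" and e: "P = vplace L (val K L P)"
    using discrete_place[OF P] by (auto simp: discrete_place_def)
  show "place_ring K L P = vring L (val K L P)"
    using dval.place_ring_vplace[OF d] e by simp
qed

lemma val_R_nonneg: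
  assumes P: "is_place K L P" "P \<noteq> vplace L v" and z: "z \<in> R"
  shows "vge (val K L P) 0 z"
  using regular[OF P] z place_ring_eq_vring[OF P(1)] by (auto simp: vring_def)

lemma K_inter_place: "is_place K L P \<Longrightarrow> c \<in> K \<Longrightarrow> c \<in> P \<Longrightarrow> c = 0"
proof (rule ccontr)
  assume P: "is_place K L P" and c: "c \<in> K" "c \<in> P" "c \<noteq> 0"
  interpret w: dval K L "val K L P" by (rule dval_place[OF P])
  have "c \<in> vplace L (val K L P)" using c place_eq_vplace[OF P] by simp
  then show False using c w.v_const by (auto simp: vplace_def vge_def)
qed

lemma has_qdim_residue_field_vplace: "has_qdim K (vring L v) (vplace L v) 1"
proof (rule has_qdim_1[OF subK])
  show "subspace_over K (vplace L v)" using subspace_vge[of 1] by (simp add: vplace_def)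
  show "1 \<in> vring L v" "1 \<notin> vplace L v"
    by (auto simp: vring_def vplace_def vge_def)
  fix b assume "b \<in> vring L v"
  then have b: "b \<in> L" "vge v 0 b" by (auto simp: vring_def)
  show "\<exists>c\<in>K. b - c * 1 \<in> vplace L v"
  proof (cases "vge v 1 b")
    case True
    then show ?thesis using b by (intro bexI[of _ 0]) (auto simp: vplace_def)
  next
    case False
    then have "b \<noteq> 0" "v b = 0" using b by (auto simp: vge_def)
    then obtain c where c: "c \<in> K" "vge v 1 (b - c)" using residue b by blast
    then show ?thesis using b by (intro bexI[of _ c]) (simp_all add: vplace_def)
  qed
qed

text \<open>This gives \<open>place_degree\<close> its meaning. Away from the distinguished place
  take a nonzero \<open>z\<close> in both \<open>R\<close> and \<open>P\<close>: the residue field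
  is a quotient of O/zO for the place ring O, whose dimension is at most the pole order of
  \<open>z\<close>.\<close>

lemma has_qdim_residue_field:
  assumes P: "is_place K L P"
  shows "has_qdim K (place_ring K L P) P (place_degree K L P)"
proof -
  interpret w: dval K L "val K L P" by (rule dval_place[OF P])
  have sP: "subspace_over K P" using w.subspace_vge[of 1] place_eq_vplace[OF P] by (simp add: vplace_def)
  have "\<exists>d. has_qdim K (place_ring K L P) P d"
  proof (cases "P = vplace L v")
    case True
    then show ?thesis using has_qdim_residue_field_vplace place_ring_vplace by auto
  next
    case False
    obtain z where z: "z \<in> R" "z \<noteq> 0" "z \<in> P" using place_meets_R[OF P False] by blast
    have O: "is_subring (place_ring K L P)" "K \<subseteq> place_ring K L P" "place_ring K L P \<subseteq> L"
      using valuation_ringD[OF place_valuation_ring[OF subL P]] by auto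
    have "(*) z ` place_ring K L P \<subseteq> P"
    proof
      fix x assume "x \<in> (*) z ` place_ring K L P"
      then obtain r where "r \<in> L" "vge (val K L P) 0 r" "x = z * r"
        using place_ring_eq_vring[OF P] by (auto simp: vring_def)
      moreover have "vge (val K L P) 1 z" using z place_eq_vplace[OF P] by (auto simp: vplace_def)
      ultimately have "x \<in> vplace L (val K L P)"
        using z w.vge_mult[of z r 1 0] by (auto simp: vplace_def)
      then show "x \<in> P" using place_eq_vplace[OF P] by simp
    qed
    then have ind: "independent_mod K ((*) z ` place_ring K L P) B" if "independent_mod K P B" for B
      using that unfolding independent_mod_def by blast
    have zO: "z \<in> place_ring K L P" using regular[OF P False] z by blast
    have "\<exists>d\<le>nat (- v z). has_qdim K (place_ring K L P) P d"
      by (rule has_qdim_exists[OF subK sP])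
        (rule independent_mod_multiple_card_le[OF O z(1,2) zO _ _ ind])
    then show ?thesis by blast
  qed
  then show ?thesis unfolding place_degree_def using quotient_dim_eq[OF subK sP] by auto
qed

lemma place_degree_pos:
  assumes P: "is_place K L P"
  shows "place_degree K L P \<ge> 1"
proof (rule ccontr)
  assume "\<not> ?thesis"
  then have "place_degree K L P = 0" by simp
  then have "has_qdim K (place_ring K L P) P 0" using has_qdim_residue_field[OF P] by (simp only:)
  then have "place_ring K L P \<subseteq> P" by (rule has_qdim_0_imp)
  then have "1 \<in> P" using subring_one[OF valuation_ringD(1)[OF place_valuation_ring[OF subL P]]] by blast
  then show False using K_inter_place[OF P, of 1] by simp
qed

lemma place_degree_vplace: "place_degree K L (vplace L v) = 1"
proof -
  have "subspace_over K (vplace L v)" using subspace_vge[of 1] by (simp add: vplace_def)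
  then show ?thesis
    unfolding place_degree_def place_ring_vplace
    using quotient_dim_eq[OF subK _ has_qdim_residue_field_vplace] by blast
qed

section \<open>Counting zeros at finitely many places\<close>

definition vspace :: "'a set set \<Rightarrow> ('a set \<Rightarrow> int) \<Rightarrow> 'a set" where
  "vspace S e = {a\<in>L. \<forall>P\<in>S. vge (val K L P) (e P) a}"

lemma subspace_vspace:
  assumes "\<And>P. P \<in> S \<Longrightarrow> is_place K L P"
  shows "subspace_over K (vspace S e)"
  unfolding subspace_over_def
proof (intro conjI ballI)
  have d: "dval K L (val K L P)" if "P \<in> S" for P using dval_place assms that by blast
  show "0 \<in> vspace S e" using dval.vge_zero[OF d] by (simp add: vspace_def)
  show "a + b \<in> vspace S e" if "a \<in> vspace S e" "b \<in> vspace S e" for a b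
    using that dval.vge_add[OF d] by (simp add: vspace_def)
  show "c * a \<in> vspace S e" if "c \<in> K" "a \<in> vspace S e" for c a
    using that dval.vge_const_mult[OF d] by (simp add: vspace_def)
qed

text \<open>Multiplication by an element of value \<open>- e P\<close> maps the quotient into the
  residue field of \<open>P\<close>. It is onto by weak approximation: the preimage b/t is
  multiplied by some \<open>x\<close> that is close to 1 at \<open>P\<close> and small on the rest
  of \<open>S\<close>.\<close>

lemma has_qdim_vspace_step:
  assumes S: "finite S" "\<And>P. P \<in> S \<Longrightarrow> is_place K L P" and P: "P \<in> S"
  shows "has_qdim K (vspace S e) (vspace S (e(P := e P + 1))) (place_degree K L P)"
proof -
  have PP: "is_place K L P" using S P by blast
  interpret w: dval K L "val K L P" by (rule dval_place[OF PP])
  obtain u where u: "u \<in> L" "u \<noteq> 0" "val K L P u = 1" using w.uniformizer by blast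
  define t where "t = u powi (- e P)"
  have t: "t \<in> L" "t \<noteq> 0" "val K L P t = - e P" using u by (auto simp: t_def w.v_power_int)
  have sP: "subspace_over K P" using w.subspace_vge[of 1] place_eq_vplace[OF PP] by (simp add: vplace_def)
  have tv: "vge (val K L P) k (t * a) \<longleftrightarrow> vge (val K L P) (k + e P) a" if "a \<in> L" for a k
    using t that by (cases "a = 0") (auto simp: vge_def w.v_mult)
  have inP: "b \<in> P \<longleftrightarrow> b \<in> L \<and> vge (val K L P) 1 b" for b
    by (subst place_eq_vplace[OF PP]) (simp add: vplace_def)
  have inO: "b \<in> place_ring K L P \<longleftrightarrow> b \<in> L \<and> vge (val K L P) 0 b" for b
    by (subst place_ring_eq_vring[OF PP]) (simp add: vring_def)
  show ?thesis
  proof (rule has_qdim_iso[OF subK subspace_vspace sP subspace_vspace has_qdim_residue_field[OF PP]])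
    show "is_place K L P'" if "P' \<in> S" for P' using S that by blast
    then show "is_place K L P'" if "P' \<in> S" for P' using that .
    fix a assume a: "a \<in> vspace S e"
    then have aL: "a \<in> L" "vge (val K L P) (e P) a" using P by (auto simp: vspace_def)
    show "t * a \<in> place_ring K L P" using aL t tv[of a 0] by (simp add: inO)
    show "t * a \<in> P \<longleftrightarrow> a \<in> vspace S (e(P := e P + 1))"
      using aL t tv[of a 1] a P by (auto simp: inP vspace_def add.commute)
  next
    fix b assume b: "b \<in> place_ring K L P"
    then have bL: "b \<in> L" "vge (val K L P) 0 b" by (auto simp: inO)
    define a0 where "a0 = b / t"
    have a0: "a0 \<in> L" "t * a0 = b" using bL t by (auto simp: a0_def)
    have a0P: "vge (val K L P) (e P) a0" using tv[of a0 0] a0 bL by simp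
    \<comment> \<open>Large enough to outweigh the poles of \<open>a0\<close> and to reach the
      prescribed values at all places of \<open>S\<close>.\<close>
    define M where "M = nat (1 + (\<Sum>P'\<in>S. \<bar>e P'\<bar> + \<bar>val K L P' a0\<bar>))"
    have nn: "(\<Sum>P'\<in>S. \<bar>e P'\<bar> + \<bar>val K L P' a0\<bar>) \<ge> 0" by (rule sum_nonneg) auto
    have M1: "M \<ge> 1" using nn by (simp add: M_def)
    have M: "int M \<ge> e P' - val K L P' a0" if "P' \<in> S" for P'
      using member_le_sum[of P' S "\<lambda>P'. \<bar>e P'\<bar> + \<bar>val K L P' a0\<bar>"] that S(1) nn by (simp add: M_def)
    have "finite (S - {P})" "P \<notin> S - {P}" using S by auto
    moreover have "discrete_place K L P'" if "P' \<in> S - {P}" for P' using discrete_place S that by blast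
    ultimately obtain x where x: "x \<in> L" "vge (val K L P) (int M) (x - 1)"
        "\<forall>P'\<in>S - {P}. vge (val K L P') (int M) x"
      using weak_approximation[of "S - {P}" K L P M] discrete_place[OF PP] M1 by blast
    have xP: "vge (val K L P) 1 (x - 1)" using x(2) M1 w.vge_mono by auto
    have "vge (val K L P) 0 ((x - 1) + 1)"
      using x xP by (intro w.vge_add) (auto simp: vge_def)
    then have x0: "vge (val K L P) 0 x" by simp
    have "a0 * x \<in> vspace S e"
      unfolding vspace_def
    proof (intro CollectI conjI ballI)
      show "a0 * x \<in> L" using a0 x by simp
      fix P' assume P': "P' \<in> S"
      interpret x: dval K L "val K L P'" using dval_place S P' by blast
      show "vge (val K L P') (e P') (a0 * x)"
      proof (cases "P' = P")
        case True
        then show ?thesis using w.vge_mult[OF a0(1) x(1) a0P x0] by simp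
      next
        case False
        have "vge (val K L P') (val K L P' a0) a0" by (simp add: vge_def)
        moreover have "vge (val K L P') (int M) x" using x(3) False P' by simp
        ultimately have "vge (val K L P') (val K L P' a0 + int M) (a0 * x)"
          using a0 x by (intro x.vge_mult)
        then show ?thesis using x.vge_mono M[OF P'] by auto
      qed
    qed
    moreover have "b - t * (a0 * x) \<in> P"
    proof -
      have "vge (val K L P) (0 + 1) (b * (x - 1))" using bL x xP by (intro w.vge_mult) auto
      then have "vge (val K L P) 1 (- (b * (x - 1)))" using bL x by (intro w.vge_minus) auto
      moreover have "- (b * (x - 1)) = b - t * (a0 * x)"
        using a0(2) by (simp add: mult.assoc[symmetric] algebra_simps)
      ultimately show ?thesis using bL t a0 x by (simp add: inP)
    qed
    ultimately show "\<exists>a\<in>vspace S e. b - t * a \<in> P" by blast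
  qed
qed

lemma has_qdim_vspace:
  assumes S: "finite S" "\<And>P. P \<in> S \<Longrightarrow> is_place K L P"
  shows "has_qdim K (vspace S (\<lambda>_. 0)) (vspace S (\<lambda>P. int (n P))) (\<Sum>P\<in>S. n P * place_degree K L P)"
proof (induction "\<Sum>P\<in>S. n P" arbitrary: n)
  case 0
  then have "vspace S (\<lambda>P. int (n P)) = vspace S (\<lambda>_. 0)" "(\<Sum>P\<in>S. n P * place_degree K L P) = 0"
    using S(1) by (auto simp: vspace_def)
  then show ?case using has_qdim_0[OF subspace_vspace] S(2) by simp
next
  case (Suc k)
  then obtain P where P: "P \<in> S" "n P \<noteq> 0" by (metis sum.neutral nat.simps(3))
  define n' where "n' = n(P := n P - 1)"
  have sumn: "(\<Sum>P\<in>S. n P * f P) = f P + (\<Sum>P\<in>S. n' P * f P)" for f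
  proof -
    have "(\<Sum>P\<in>S. n P * f P) = n P * f P + (\<Sum>P\<in>S - {P}. n P * f P)"
      using S P by (simp add: sum.remove)
    also have "(\<Sum>P\<in>S - {P}. n P * f P) = (\<Sum>P\<in>S - {P}. n' P * f P)"
      by (intro sum.cong) (auto simp: n'_def)
    also have "n P * f P = f P + n' P * f P" using P by (cases "n P") (auto simp: n'_def)
    finally show ?thesis using S P by (simp add: sum.remove[of S P])
  qed
  have "k = (\<Sum>P\<in>S. n' P)" using sumn[of "\<lambda>_. 1"] Suc(2) by simp
  from Suc(1)[OF this]
  have IH: "has_qdim K (vspace S (\<lambda>_. 0)) (vspace S (\<lambda>P. int (n' P))) (\<Sum>P\<in>S. n' P * place_degree K L P)" .
  have eq: "(\<lambda>P. int (n P)) = (\<lambda>P. int (n' P))(P := int (n' P) + 1)"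
    using P by (auto simp: n'_def)
  have step: "has_qdim K (vspace S (\<lambda>P. int (n' P))) (vspace S (\<lambda>P. int (n P))) (place_degree K L P)"
    unfolding eq using S P(1) by (rule has_qdim_vspace_step)
  have "has_qdim K (vspace S (\<lambda>_. 0)) (vspace S (\<lambda>P. int (n P)))
      ((\<Sum>P\<in>S. n' P * place_degree K L P) + place_degree K L P)"
  proof (rule has_qdim_tower[OF subK subspace_vspace _ IH step])
    show "is_place K L P" if "P \<in> S" for P using S that by blast
    show "vspace S (\<lambda>P. int (n' P)) \<subseteq> vspace S (\<lambda>_. 0)"
      "vspace S (\<lambda>P. int (n P)) \<subseteq> vspace S (\<lambda>P. int (n' P))"
      by (force simp: vspace_def vge_def n'_def split: if_splits)+
  qed
  then show ?case using sumn[of "place_degree K L"] by (simp add: add.commute)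
qed

text \<open>Let W be the semilocal ring of functions regular on \<open>S\<close>. The dimension of
  W/zW is the number of zeros of \<open>z\<close> on \<open>S\<close>, counted with multiplicity and
  degree, and \<open>independent_mod_multiple_card_le\<close> bounds it by the pole order.\<close>

lemma sum_zeros_le:
  assumes S: "finite S" "\<And>P. P \<in> S \<Longrightarrow> is_place K L P \<and> P \<noteq> vplace L v" and z: "z \<in> R" "z \<noteq> 0"
  shows "(\<Sum>P\<in>S. val K L P z * int (place_degree K L P)) \<le> - v z"
proof -
  have pl: "is_place K L P" if "P \<in> S" for P using S that by blast
  have d: "dval K L (val K L P)" if "P \<in> S" for P using dval_place S that by blast
  define n where "n P = nat (val K L P z)" for P
  have n: "int (n P) = val K L P z" if "P \<in> S" for P
    using val_R_nonneg[of P z] S(2)[OF that] z by (simp add: n_def vge_def)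
  let ?W = "vspace S (\<lambda>_. 0)"
  have W: "is_subring ?W" "K \<subseteq> ?W" "?W \<subseteq> L"
  proof -
    show "is_subring ?W" unfolding is_subring_def vspace_def
      using dval.vge_add[OF d] dval.vge_diff[OF d] dval.vge_mult[OF d, of _ _ _ 0 0] dval.vge_const[OF d, of _ 1]
      by (auto simp: dval.vge_zero[OF d])
    show "K \<subseteq> ?W" using dval.vge_const[OF d] by (auto simp: vspace_def)
    show "?W \<subseteq> L" by (auto simp: vspace_def)
  qed
  have "0 \<le> val K L P z" if "P \<in> S" for P using n[OF that] by (metis of_nat_0_le_iff)
  then have zW: "z \<in> ?W" using z by (auto simp: vspace_def vge_def)
  have eq: "vspace S (\<lambda>P. int (n P)) = (*) z ` ?W"
  proof (intro equalityI subsetI)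
    fix a assume a: "a \<in> vspace S (\<lambda>P. int (n P))"
    have "a / z \<in> ?W"
      unfolding vspace_def
    proof (intro CollectI conjI ballI)
      show "a / z \<in> L" using a z by (simp add: vspace_def)
      fix P assume P: "P \<in> S"
      interpret x: dval K L "val K L P" by (rule d[OF P])
      show "vge (val K L P) 0 (a / z)"
        using a n[OF P] P z by (cases "a = 0") (auto simp: vspace_def vge_def x.v_divide)
    qed
    moreover have "a = z * (a / z)" using z by simp
    ultimately show "a \<in> (*) z ` ?W" by blast
  next
    fix a assume "a \<in> (*) z ` ?W"
    then obtain b where b: "b \<in> ?W" "a = z * b" by blast
    show "a \<in> vspace S (\<lambda>P. int (n P))"
      unfolding vspace_def
    proof (intro CollectI conjI ballI)
      show "a \<in> L" using b z by (simp add: vspace_def)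
      fix P assume P: "P \<in> S"
      have "vge (val K L P) (int (n P) + 0) (z * b)"
        using n[OF P] b P z by (intro dval.vge_mult[OF d]) (auto simp: vspace_def vge_def)
      then show "vge (val K L P) (int (n P)) a" using b by simp
    qed
  qed
  have q: "has_qdim K ?W ((*) z ` ?W) (\<Sum>P\<in>S. n P * place_degree K L P)"
    using has_qdim_vspace[OF S(1) pl, of n] eq by simp
  then obtain B where B: "quotient_basis K ?W ((*) z ` ?W) B" "card B = (\<Sum>P\<in>S. n P * place_degree K L P)"
    by (auto simp: has_qdim_def)
  have "card B \<le> nat (- v z)"
    using B(1) unfolding quotient_basis_iff
    by (intro independent_mod_multiple_card_le[OF W z zW]) simp_all
  then have "int (\<Sum>P\<in>S. n P * place_degree K L P) \<le> - v z"
    using B(2) R_neg[OF z] by linarith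
  moreover have "int (\<Sum>P\<in>S. n P * place_degree K L P) = (\<Sum>P\<in>S. val K L P z * int (place_degree K L P))"
    using n by (simp add: of_nat_sum)
  ultimately show ?thesis by simp
qed

text \<open>Each zero contributes at least one to the sum bounded in
  \<open>sum_zeros_le\<close>.\<close>

lemma finite_zeros:
  assumes z: "z \<in> R" "z \<noteq> 0"
  shows "finite {P. is_place K L P \<and> P \<noteq> vplace L v \<and> val K L P z \<noteq> 0}" (is "finite ?Z")
proof (rule ccontr)
  assume "infinite ?Z"
  from infinite_arbitrarily_large[OF this, of "Suc (nat (- v z))"]
  obtain S where S: "finite S" "card S = Suc (nat (- v z))" "S \<subseteq> ?Z"
    by (elim exE conjE)
  have "int (card S) = (\<Sum>P\<in>S. 1)" by simp
  also have "\<dots> \<le> (\<Sum>P\<in>S. val K L P z * int (place_degree K L P))"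
  proof (rule sum_mono)
    fix P assume "P \<in> S"
    then have P: "is_place K L P" "P \<noteq> vplace L v" "val K L P z \<noteq> 0" using S(3) by auto
    then have "val K L P z \<ge> 1" using val_R_nonneg[of P z] z by (simp add: vge_def)
    moreover have "int (place_degree K L P) \<ge> 1" using place_degree_pos P by simp
    ultimately have "1 * 1 \<le> val K L P z * int (place_degree K L P)" by (intro mult_mono) auto
    then show "1 \<le> val K L P z * int (place_degree K L P)" by simp
  qed
  also have "\<dots> \<le> - v z" using S(3) by (intro sum_zeros_le S(1) z) blast
  finally show False using S(2) R_neg[OF z] by simp
qed

end

text \<open>Now \<open>R\<close> consists of all functions without poles elsewhere. Hence its pole
  orders are the pole numbers, and \<open>Rle M\<close> is the Riemann-Roch space of
  \<open>M\<close> times the distinguished place.\<close>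

locale one_place_complete = one_place +
  assumes complete: "\<And>a. a \<in> L \<Longrightarrow> (\<And>P. is_place K L P \<Longrightarrow> P \<noteq> vplace L v \<Longrightarrow> a \<in> place_ring K L P) \<Longrightarrow> a \<in> R"
begin

lemma R_iff:
  assumes "a \<in> L"
  shows "a \<in> R \<longleftrightarrow> (\<forall>P. is_place K L P \<longrightarrow> P \<noteq> vplace L v \<longrightarrow> vge (val K L P) 0 a)"
proof
  assume "\<forall>P. is_place K L P \<longrightarrow> P \<noteq> vplace L v \<longrightarrow> vge (val K L P) 0 a"
  then show "a \<in> R" using assms by (intro complete) (auto simp: place_ring_eq_vring vring_def)
qed (use val_R_nonneg in blast)

lemma pole_numbers_eq_orders: "pole_numbers K L (vplace L v) = orders"
proof (intro equalityI subsetI)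
  fix s assume "s \<in> pole_numbers K L (vplace L v)"
  then obtain z where z: "z \<in> L" "z \<noteq> 0"
    and pd: "\<And>P. pole_divisor K L z P = (if P = vplace L v then int s else 0)"
    unfolding pole_numbers_def by (auto simp: fun_eq_iff)
  have "val K L P z \<ge> 0" if "is_place K L P" "P \<noteq> vplace L v" for P
    using pd[of P] that by (auto simp: pole_divisor_def split: if_splits)
  then have zR: "z \<in> R" using R_iff[OF z(1)] by (auto simp: vge_def)
  have "pole_divisor K L z (vplace L v) = (if v z < 0 then - v z else 0)"
    by (simp add: pole_divisor_def is_place_vplace val_vplace[OF z])
  then have "(if v z < 0 then - v z else 0) = int s" using pd[of "vplace L v"] by simp
  \<comment> \<open>The pole number 0 comes from functions with no pole at all, for which
    \<open>v z\<close> is 0.\<close>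
  then have "s = nat (- v z)" using R_neg[OF zR z(2)] by (auto split: if_splits)
  then show "s \<in> orders" using zR z by (auto simp: orders_def)
next
  fix s assume "s \<in> orders"
  then obtain z where z: "z \<in> R" "z \<noteq> 0" "s = nat (- v z)" by (auto simp: orders_def)
  have "pole_divisor K L z P = (if P = vplace L v then int s else 0)" for P
  proof (cases "P = vplace L v")
    case True
    then show ?thesis using z R_neg[OF z(1,2)] is_place_vplace
      by (simp add: pole_divisor_def val_vplace)
  next
    case False
    then show ?thesis using val_R_nonneg[of P z] z by (auto simp: pole_divisor_def vge_def)
  qed
  then have "pole_divisor K L z = (\<lambda>P. if P = vplace L v then int s else 0)" by (rule ext)
  then show "s \<in> pole_numbers K L (vplace L v)"
    unfolding pole_numbers_def using z R_in_L by blast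
qed

section \<open>Riemann-Roch spaces and the genus\<close>

lemma riemann_roch_space_iff:
  "z \<in> riemann_roch_space K L A \<longleftrightarrow> z \<in> L \<and> (\<forall>P. is_place K L P \<longrightarrow> vge (val K L P) (- A P) z)"
  by (auto simp: riemann_roch_space_def vge_def)

lemma subspace_riemann_roch: "subspace_over K (riemann_roch_space K L A)"
  unfolding subspace_over_def
proof (intro conjI ballI)
  show "0 \<in> riemann_roch_space K L A" by (simp add: riemann_roch_space_def)
  show "a + b \<in> riemann_roch_space K L A"
    if "a \<in> riemann_roch_space K L A" "b \<in> riemann_roch_space K L A" for a b
    using that dval.vge_add[OF dval_place] by (simp add: riemann_roch_space_iff)
  show "c * a \<in> riemann_roch_space K L A" if "c \<in> K" "a \<in> riemann_roch_space K L A" for c a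
    using that dval.vge_const_mult[OF dval_place] by (simp add: riemann_roch_space_iff)
qed

text \<open>The divisor \<open>s Q + (z)\<close>, whose Riemann-Roch space is \<open>z\<inverse> L(s Q)\<close>.\<close>

definition shifted :: "int \<Rightarrow> 'a \<Rightarrow> 'a set \<Rightarrow> int" where
  "shifted s z P = (if P = vplace L v then s + v z else if is_place K L P then val K L P z else 0)"

lemma has_qdim_shifted:
  assumes z: "z \<in> R" "z \<noteq> 0"
  shows "has_qdim K (riemann_roch_space K L (shifted (int s) z)) {0} (card {h\<in>orders. h \<le> s})"
proof (rule has_qdim_iso[OF subK subspace_zero subspace_zero subspace_riemann_roch has_qdim_Rle])
  have key: "a \<in> riemann_roch_space K L (shifted (int s) z) \<longleftrightarrow> z * a \<in> Rle (int s)" if a: "a \<in> L" for a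
  proof -
    have 1: "vge (val K L P) (- shifted (int s) z P) a \<longleftrightarrow> vge (val K L P) 0 (z * a)"
      if P: "is_place K L P" "P \<noteq> vplace L v" for P
    proof -
      interpret x: dval K L "val K L P" by (rule dval_place[OF P(1)])
      show ?thesis using P a z by (cases "a = 0") (auto simp: shifted_def vge_def x.v_mult)
    qed
    have 2: "vge (val K L (vplace L v)) (- shifted (int s) z (vplace L v)) a \<longleftrightarrow> vge v (- int s) (z * a)"
      using a z by (cases "a = 0") (auto simp: shifted_def vge_def v_mult val_vplace)
    have "a \<in> riemann_roch_space K L (shifted (int s) z) \<longleftrightarrow>
        (\<forall>P. is_place K L P \<longrightarrow> P \<noteq> vplace L v \<longrightarrow> vge (val K L P) 0 (z * a)) \<and> vge v (- int s) (z * a)"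
      unfolding riemann_roch_space_iff using 1 2 a is_place_vplace by metis
    then show ?thesis using R_iff[of "z * a"] a z by (simp add: Rle_def)
  qed
  show "z * a \<in> Rle (int s)" if "a \<in> riemann_roch_space K L (shifted (int s) z)" for a
    using key[of a] that by (simp add: riemann_roch_space_iff)
  show "\<exists>a\<in>riemann_roch_space K L (shifted (int s) z). b - z * a \<in> {0}" if "b \<in> Rle (int s)" for b
  proof -
    have "b / z \<in> L" "z * (b / z) = b" using that z by (auto simp: Rle_def)
    then show ?thesis using key[of "b / z"] that by (intro bexI[of _ "b / z"]) simp_all
  qed
  show "z * a \<in> {0} \<longleftrightarrow> a \<in> {0}" for a using z by simp
qed

lemma riemann_roch_mono: "(\<And>P. A P \<le> B P) \<Longrightarrow> riemann_roch_space K L A \<subseteq> riemann_roch_space K L B"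
  unfolding riemann_roch_space_def by (auto intro: order_trans[OF le_imp_neg_le])

text \<open>Multiplication by an element of value \<open>A P\<close> embeds the quotient into the
  residue field of \<open>P\<close>. As conditions are imposed at every place, this map need not be
  onto and only an inequality results.\<close>

lemma has_qdim_riemann_roch_step:
  assumes P: "is_place K L P"
  shows "\<exists>e\<le>place_degree K L P. has_qdim K (riemann_roch_space K L A)
    (riemann_roch_space K L (A(P := A P - 1))) e"
proof -
  interpret w: dval K L "val K L P" by (rule dval_place[OF P])
  obtain u where u: "u \<in> L" "u \<noteq> 0" "val K L P u = 1" using w.uniformizer by blast
  define t where "t = u powi (A P)"
  have t: "t \<in> L" "t \<noteq> 0" "val K L P t = A P" using u by (auto simp: t_def w.v_power_int)
  have sP: "subspace_over K P" using w.subspace_vge[of 1] place_eq_vplace[OF P] by (simp add: vplace_def)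
  have tv: "vge (val K L P) k (t * a) \<longleftrightarrow> vge (val K L P) (k - A P) a" if "a \<in> L" for a k
    using t that by (cases "a = 0") (auto simp: vge_def w.v_mult)
  have inP: "b \<in> P \<longleftrightarrow> b \<in> L \<and> vge (val K L P) 1 b" for b
    by (subst place_eq_vplace[OF P]) (simp add: vplace_def)
  have inO: "b \<in> place_ring K L P \<longleftrightarrow> b \<in> L \<and> vge (val K L P) 0 b" for b
    by (subst place_ring_eq_vring[OF P]) (simp add: vring_def)
  show ?thesis
  proof (rule has_qdim_embed[OF subK subspace_riemann_roch sP has_qdim_residue_field[OF P] _ _ subspace_riemann_roch])
    fix a assume a: "a \<in> riemann_roch_space K L A"
    then have aL: "a \<in> L" "vge (val K L P) (- A P) a" using P by (auto simp: riemann_roch_space_iff)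
    show "t * a \<in> place_ring K L P" using aL t tv[of a 0] by (simp add: inO)
    show "a \<in> riemann_roch_space K L (A(P := A P - 1))" if "t * a \<in> P"
      using aL tv[of a 1] a that by (auto simp: inP riemann_roch_space_iff)
  qed
qed

text \<open>Going down from \<open>B\<close> to \<open>A\<close> one place at a time, each step
  lowers the dimension by at most the degree of the place. Equivalently, deg A - dim A <= deg B -
  dim B.\<close>

lemma has_qdim_riemann_roch_le:
  assumes S: "finite S" "\<And>P. P \<in> S \<Longrightarrow> is_place K L P" and AB: "\<And>P. P \<notin> S \<Longrightarrow> A P = B P" "\<And>P. A P \<le> B P"
    and B: "has_qdim K (riemann_roch_space K L B) {0} l"
  shows "\<exists>k. has_qdim K (riemann_roch_space K L A) {0} k \<and>
    int l \<le> int k + (\<Sum>P\<in>S. (B P - A P) * int (place_degree K L P))"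
  using AB B
proof (induction "\<Sum>P\<in>S. nat (B P - A P)" arbitrary: B l)
  case 0
  have "nat (B P - A P) = 0" if "P \<in> S" for P
    using 0(1) S(1) that by (metis sum_eq_0_iff)
  then have "A P = B P" for P using 0(2)[of P] 0(3)[of P] by (cases "P \<in> S") fastforce+
  then have "A = B" by blast
  then show ?case using 0 by auto
next
  case (Suc m)
  have "(\<Sum>P\<in>S. nat (B P - A P)) \<noteq> 0" using Suc(2) by simp
  then obtain P where P: "P \<in> S" "nat (B P - A P) \<noteq> 0"
    by (rule sum.not_neutral_contains_not_neutral)
  define B' where "B' = B(P := B P - 1)"
  have sumB: "(\<Sum>P\<in>S. f P (B P)) = f P (B P) - f P (B P - 1) + (\<Sum>P\<in>S. f P (B' P))" for f :: "'a set \<Rightarrow> int \<Rightarrow> int"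
  proof -
    have "(\<Sum>P\<in>S - {P}. f P (B P)) = (\<Sum>P\<in>S - {P}. f P (B' P))"
      by (intro sum.cong) (auto simp: B'_def)
    moreover have "f P (B' P) = f P (B P - 1)" by (simp add: B'_def)
    ultimately show ?thesis using S P by (simp add: sum.remove[of S P])
  qed
  have "int (Suc m) = 1 + int (\<Sum>P\<in>S. nat (B' P - A P))"
    using Suc(2) sumB[of "\<lambda>P b. int (nat (b - A P))"] P by (simp add: of_nat_sum)
  then have m: "m = (\<Sum>P\<in>S. nat (B' P - A P))" by linarith
  have B'B: "B' P \<le> B P" for P by (simp add: B'_def)
  have AB': "A P' = B' P'" if "P' \<notin> S" for P' using Suc(3)[OF that] that P by (auto simp: B'_def)
  have AB'': "A P' \<le> B' P'" for P' using Suc(4)[of P'] P by (auto simp: B'_def)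
  obtain e where e: "e \<le> place_degree K L P"
      "has_qdim K (riemann_roch_space K L B) (riemann_roch_space K L B') e"
    using has_qdim_riemann_roch_step[of P B] S P unfolding B'_def by blast
  have sub0: "{0} \<subseteq> riemann_roch_space K L B'" by (simp add: riemann_roch_space_def)
  obtain a b where ab: "has_qdim K (riemann_roch_space K L B') {0} a"
      "has_qdim K (riemann_roch_space K L B) (riemann_roch_space K L B') b" "a + b = l"
    by (rule has_qdim_between[OF subK subspace_zero subspace_riemann_roch sub0 riemann_roch_mono[OF B'B] Suc(5)])
  have "b = e" using has_qdim_unique[OF subK subspace_riemann_roch ab(2) e(2)] .
  obtain k where k: "has_qdim K (riemann_roch_space K L A) {0} k"
      "int a \<le> int k + (\<Sum>P\<in>S. (B' P - A P) * int (place_degree K L P))"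
    using Suc(1)[OF m AB' AB'' ab(1)] by blast
  have "int l \<le> int k + (\<Sum>P\<in>S. (B' P - A P) * int (place_degree K L P)) + int (place_degree K L P)"
    using k e ab(3) \<open>b = e\<close> by linarith
  also have "\<dots> = int k + (\<Sum>P\<in>S. (B P - A P) * int (place_degree K L P))"
    using sumB[of "\<lambda>P b. (b - A P) * int (place_degree K L P)"] by (simp add: algebra_simps)
  finally show ?case using k(1) by blast
qed

text \<open>A product of powers of the functions from \<open>place_meets_R\<close> works: its
  factors lie in \<open>R\<close>, so none of them has a pole at another place of
  \<open>S\<close>.\<close>

lemma exists_common_zero:
  assumes "finite S" "\<And>P. P \<in> S \<Longrightarrow> is_place K L P \<and> P \<noteq> vplace L v"
  shows "\<exists>z\<in>R. z \<noteq> 0 \<and> (\<forall>P\<in>S. vge (val K L P) (int (n P)) z)"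
  using assms
proof (induction S rule: finite_induct)
  case empty
  show ?case by (intro bexI[of _ 1]) (auto intro: subring_one[OF R_ring])
next
  case (insert P S)
  then obtain z where z: "z \<in> R" "z \<noteq> 0" "\<forall>P\<in>S. vge (val K L P) (int (n P)) z" by blast
  obtain y where y: "y \<in> R" "y \<noteq> 0" "y \<in> P" using place_meets_R[of P] insert.prems by blast
  have P: "is_place K L P" using insert.prems by blast
  interpret w: dval K L "val K L P" by (rule dval_place[OF P])
  have "y \<in> vplace L (val K L P)" using y place_eq_vplace[OF P] by simp
  then have "val K L P y \<ge> 1" using y by (simp add: vplace_def vge_def)
  then have yn: "vge (val K L P) (int (n P)) (y ^ n P)"
    using y mult_left_mono[of 1 "val K L P y" "int (n P)"] by (simp add: vge_def w.v_power)
  have yR: "y ^ n P \<in> R" using y by (intro subring_power[OF R_ring])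
  have "vge (val K L P') (int (n P')) (y ^ n P * z)" if P': "P' \<in> insert P S" for P'
  proof -
    have pl: "is_place K L P'" "P' \<noteq> vplace L v" using insert.prems P' by auto
    interpret x: dval K L "val K L P'" by (rule dval_place[OF pl(1)])
    have 0: "vge (val K L P') 0 (y ^ n P)" "vge (val K L P') 0 z"
      using val_R_nonneg[OF pl] yR z by auto
    show ?thesis
    proof (cases "P' \<in> S")
      case True
      then have "vge (val K L P') (0 + int (n P')) (y ^ n P * z)"
        using 0 z yR by (intro x.vge_mult) auto
      then show ?thesis by simp
    next
      case False
      then have "vge (val K L P') (int (n P') + 0) (y ^ n P * z)"
        using 0 z yR yn P' by (intro x.vge_mult) auto
      then show ?thesis by simp
    qed
  qed
  moreover have "y ^ n P * z \<in> R" using yR z by (intro subring_mult[OF R_ring])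
  ultimately show ?case using y z by (intro bexI[of _ "y ^ n P * z"]) auto
qed

lemma card_orders_le:
  assumes fin: "finite (UNIV - orders)" and s: "\<And>h. h \<notin> orders \<Longrightarrow> h \<le> s"
  shows "card {h\<in>orders. h \<le> s} + card (UNIV - orders) = s + 1"
proof -
  have "{h\<in>orders. h \<le> s} \<union> (UNIV - orders) = {..s}" using s by auto
  moreover have "card ({h\<in>orders. h \<le> s} \<union> (UNIV - orders)) = card {h\<in>orders. h \<le> s} + card (UNIV - orders)"
    using fin by (intro card_Un_disjoint) auto
  ultimately show ?thesis by simp
qed

text \<open>Enlarge \<open>A\<close> to B = s Q + (z), where \<open>z\<close> in \<open>R\<close>
  vanishes on the positive part of \<open>A\<close> away from Q. Then dim B = dim L(s Q) is s + 1
  minus the number of gaps, and deg B <= s as \<open>z\<close> has at most \<open>- v z\<close>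
  zeros. Passing from \<open>A\<close> to B does not decrease deg - dim.\<close>

lemma dim_bound:
  assumes A: "is_divisor K L A" and fin: "finite (UNIV - orders)"
  shows "divisor_degree K L A - int (divisor_dim K L A) + 1 \<le> int (card (UNIV - orders))"
proof -
  let ?Q = "vplace L v"
  define SA where "SA = {P. A P \<noteq> 0}"
  have SA: "finite SA" "\<And>P. P \<in> SA \<Longrightarrow> is_place K L P" using A by (auto simp: is_divisor_def SA_def)
  obtain z where z: "z \<in> R" "z \<noteq> 0" "\<forall>P\<in>SA - {?Q}. vge (val K L P) (int (nat (A P))) z"
    using exists_common_zero[of "SA - {?Q}" "\<lambda>P. nat (A P)"] SA by blast
  obtain s0 where s0: "\<And>h. h \<notin> orders \<Longrightarrow> h \<le> s0"
    using finite_nat_set_iff_bounded_le[of "UNIV - orders"] fin by blast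
  \<comment> \<open>\<open>s\<close> lies beyond all gaps, and the second summand lets B dominate
    \<open>A\<close> at the distinguished place, where its coefficient is s + v z.\<close>
  define s where "s = s0 + nat \<bar>A ?Q - v z\<bar>"
  define B where "B = shifted (int s) z"
  have AB: "A P \<le> B P" for P
  proof (cases "P = ?Q")
    case True
    then show ?thesis by (simp add: B_def shifted_def s_def)
  next
    case False
    show ?thesis
    proof (cases "is_place K L P")
      case True
      have "val K L P z \<ge> 0" using val_R_nonneg[OF True False z(1)] z(2) by (simp add: vge_def)
      moreover have "A P \<le> val K L P z" if "P \<in> SA"
        using z(3)[rule_format, of P] z(2) False that by (auto simp: vge_def split: if_splits)
      ultimately show ?thesis using False True by (cases "P \<in> SA") (auto simp: B_def shifted_def SA_def)
    next
      case False': False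
      then show ?thesis using False SA(2)[of P] by (auto simp: B_def shifted_def SA_def)
    qed
  qed
  define Z where "Z = {P. is_place K L P \<and> P \<noteq> ?Q \<and> val K L P z \<noteq> 0}"
  define S where "S = insert ?Q (SA \<union> Z)"
  have finS: "finite S" using SA finite_zeros[OF z(1,2)] by (simp add: S_def Z_def)
  have plS: "is_place K L P" if "P \<in> S" for P using that SA is_place_vplace by (auto simp: S_def Z_def)
  have AB0: "A P = B P" if "P \<notin> S" for P using that by (auto simp: S_def SA_def Z_def B_def shifted_def)
  have dimB: "has_qdim K (riemann_roch_space K L B) {0} (card {h\<in>orders. h \<le> s})"
    unfolding B_def using z by (intro has_qdim_shifted)
  obtain k where k: "has_qdim K (riemann_roch_space K L A) {0} k"
      "int (card {h\<in>orders. h \<le> s}) \<le> int k + (\<Sum>P\<in>S. (B P - A P) * int (place_degree K L P))"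
    using has_qdim_riemann_roch_le[OF finS plS AB0 AB dimB] by blast
  have dimA: "divisor_dim K L A = k"
    unfolding divisor_dim_def by (rule quotient_dim_eq[OF subK subspace_zero k(1)])
  have degA: "divisor_degree K L A = (\<Sum>P\<in>S. A P * int (place_degree K L P))"
    unfolding divisor_degree_def by (rule sum.mono_neutral_left) (use finS in \<open>auto simp: S_def SA_def\<close>)
  have "(\<Sum>P\<in>S. B P * int (place_degree K L P)) =
      B ?Q * int (place_degree K L ?Q) + (\<Sum>P\<in>S - {?Q}. B P * int (place_degree K L P))"
    using finS by (intro sum.remove) (auto simp: S_def)
  also have "B ?Q * int (place_degree K L ?Q) = int s + v z"
    by (simp add: place_degree_vplace B_def shifted_def)
  also have "(\<Sum>P\<in>S - {?Q}. B P * int (place_degree K L P)) = (\<Sum>P\<in>S - {?Q}. val K L P z * int (place_degree K L P))"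
    using plS by (intro sum.cong) (auto simp: B_def shifted_def)
  also have "\<dots> \<le> - v z"
    using finS plS z by (intro sum_zeros_le) auto
  finally have degB: "(\<Sum>P\<in>S. B P * int (place_degree K L P)) \<le> int s" by simp
  have "card {h\<in>orders. h \<le> s} + card (UNIV - orders) = s + 1"
    using s0 by (intro card_orders_le fin) (auto simp: s_def intro: trans_le_add1)
  moreover have "(\<Sum>P\<in>S. (B P - A P) * int (place_degree K L P)) =
      (\<Sum>P\<in>S. B P * int (place_degree K L P)) - divisor_degree K L A"
    by (simp add: degA left_diff_distrib sum_subtractf)
  ultimately show ?thesis using k(2) degB dimA by linarith
qed

text \<open>The bound is attained by s Q for any \<open>s\<close> that no gap exceeds.\<close>

theorem genus_eq_card_gaps:
  assumes fin: "finite (UNIV - orders)"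
  shows "genus K L = int (card (UNIV - orders))"
  unfolding genus_def
proof (rule Greatest_equality)
  let ?Q = "vplace L v"
  obtain s where s: "\<And>h. h \<notin> orders \<Longrightarrow> h \<le> s"
    using finite_nat_set_iff_bounded_le[of "UNIV - orders"] fin by blast
  have one: "1 \<in> R" by (rule subring_one[OF R_ring])
  define A where "A = shifted (int s) 1"
  have A: "A P = (if P = ?Q then int s else 0)" for P
    using dval.v_one[OF dval_place] by (auto simp: A_def shifted_def)
  have "is_divisor K L A" using is_place_vplace by (auto simp: is_divisor_def A)
  moreover have "divisor_degree K L A = int s"
  proof -
    have "divisor_degree K L A = (\<Sum>P\<in>{?Q}. A P * int (place_degree K L P))"
      unfolding divisor_degree_def by (rule sum.mono_neutral_left) (auto simp: A)
    then show ?thesis by (simp add: A place_degree_vplace)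
  qed
  moreover have "divisor_dim K L A = card {h\<in>orders. h \<le> s}"
    unfolding divisor_dim_def A_def
    by (rule quotient_dim_eq[OF subK subspace_zero has_qdim_shifted]) (use one in auto)
  moreover have "card {h\<in>orders. h \<le> s} + card (UNIV - orders) = s + 1"
    using s by (intro card_orders_le fin)
  ultimately show "\<exists>A. is_divisor K L A \<and>
      int (card (UNIV - orders)) = divisor_degree K L A - int (divisor_dim K L A) + 1"
    by (intro exI[of _ A]) auto
qed (use dim_bound[OF _ fin] in blast)

end

subsection \<open>Polynomials over a subring\<close>

definition polys_over :: "'a::field set \<Rightarrow> 'a poly set" where
  "polys_over B = {p. \<forall>i. coeff p i \<in> B}"

lemma polys_over_coeff: "p \<in> polys_over B \<Longrightarrow> coeff p i \<in> B"
  by (simp add: polys_over_def)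

context
  fixes B :: "'a::field set"
  assumes B: "is_subring B"
begin

lemma polys_over_zero: "0 \<in> polys_over B"
  using B by (simp add: polys_over_def subring_zero)

lemma polys_over_one: "1 \<in> polys_over B"
  using B by (auto simp: polys_over_def coeff_1 subring_zero subring_one)

lemma polys_over_add: "p \<in> polys_over B \<Longrightarrow> r \<in> polys_over B \<Longrightarrow> p + r \<in> polys_over B"
  using B by (auto simp: polys_over_def intro: subring_add)

lemma polys_over_diff: "p \<in> polys_over B \<Longrightarrow> r \<in> polys_over B \<Longrightarrow> p - r \<in> polys_over B"
  using B by (auto simp: polys_over_def intro: subring_diff)

lemma polys_over_mult: "p \<in> polys_over B \<Longrightarrow> r \<in> polys_over B \<Longrightarrow> p * r \<in> polys_over B"
  by (auto simp: polys_over_def coeff_mult intro!: subring_sum[OF B] subring_mult[OF B])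

lemma polys_over_monom: "c \<in> B \<Longrightarrow> monom c n \<in> polys_over B"
  using B by (auto simp: polys_over_def subring_zero)

lemma polys_over_smult: "c \<in> B \<Longrightarrow> p \<in> polys_over B \<Longrightarrow> smult c p \<in> polys_over B"
  using B by (auto simp: polys_over_def intro: subring_mult)

lemma polys_over_pCons: "pCons c p \<in> polys_over B \<longleftrightarrow> c \<in> B \<and> p \<in> polys_over B"
proof
  assume h: "pCons c p \<in> polys_over B"
  have "c \<in> B" using polys_over_coeff[OF h, of 0] by simp
  moreover have "coeff p i \<in> B" for i using polys_over_coeff[OF h, of "Suc i"] by simp
  ultimately show "c \<in> B \<and> p \<in> polys_over B" by (simp add: polys_over_def)
qed (auto simp: polys_over_def coeff_pCons split: nat.splits)

lemma polys_over_sum: "(\<And>i. i \<in> I \<Longrightarrow> f i \<in> polys_over B) \<Longrightarrow> sum f I \<in> polys_over B"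
  by (induction I rule: infinite_finite_induct) (auto intro: polys_over_zero polys_over_add)

lemma polys_over_power: "p \<in> polys_over B \<Longrightarrow> p ^ n \<in> polys_over B"
  by (induction n) (auto intro: polys_over_one polys_over_mult)

lemma polys_over_reflect: "p \<in> polys_over B \<Longrightarrow> reflect_poly p \<in> polys_over B"
  using B by (auto simp: polys_over_def coeff_reflect_poly subring_zero)

lemmas polys_over_closed = polys_over_zero polys_over_one polys_over_add polys_over_diff
  polys_over_mult polys_over_monom polys_over_smult polys_over_power

lemma poly_in_subring:
  assumes "p \<in> polys_over B" "B \<subseteq> R" "is_subring R" "w \<in> R"
  shows "poly p w \<in> R"
  using assms(1)
proof (induction p)
  case 0
  then show ?case using assms by (simp add: subring_zero)
next
  case (pCons a p)
  then have "a \<in> R" "poly p w \<in> R" using polys_over_pCons assms(2) by auto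
  then show ?case using assms by (auto intro: subring_add subring_mult)
qed

definition ring_adjoin :: "'a \<Rightarrow> 'a set" where
  "ring_adjoin w = (\<lambda>p. poly p w) ` polys_over B"

lemma subring_ring_adjoin: "is_subring (ring_adjoin w)"
  unfolding is_subring_def
proof (intro conjI ballI)
  have 1: "poly p w \<in> ring_adjoin w" if "p \<in> polys_over B" for p
    using that by (simp add: ring_adjoin_def)
  show "0 \<in> ring_adjoin w" "1 \<in> ring_adjoin w"
    using 1[OF polys_over_zero] 1[OF polys_over_one] by simp_all
  fix a b assume "a \<in> ring_adjoin w" "b \<in> ring_adjoin w"
  then obtain p r where pr: "p \<in> polys_over B" "r \<in> polys_over B" "a = poly p w" "b = poly r w"
    by (auto simp: ring_adjoin_def)
  show "a + b \<in> ring_adjoin w" "a - b \<in> ring_adjoin w" "a * b \<in> ring_adjoin w"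
    using 1[OF polys_over_add[OF pr(1,2)]] 1[OF polys_over_diff[OF pr(1,2)]]
      1[OF polys_over_mult[OF pr(1,2)]] pr(3,4) by simp_all
qed

lemma ring_adjoin_base: "B \<subseteq> ring_adjoin w"
proof
  fix b assume "b \<in> B"
  then have "monom b 0 \<in> polys_over B" by (rule polys_over_monom)
  then have "poly (monom b 0) w \<in> ring_adjoin w" unfolding ring_adjoin_def by (rule imageI)
  then show "b \<in> ring_adjoin w" by (simp add: poly_monom)
qed

lemma ring_adjoin_elem: "w \<in> ring_adjoin w"
proof -
  have "monom 1 1 \<in> polys_over B" by (rule polys_over_monom[OF subring_one[OF B]])
  then have "poly (monom 1 1) w \<in> ring_adjoin w" unfolding ring_adjoin_def by (rule imageI)
  then show ?thesis by (simp add: poly_monom)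
qed

end

subsection \<open>Extension of places\<close>

text \<open>The powers of c = 1 - a b have the form 1 - a e, so inverting c does not bring in 1/a,
  and by maximality it adds nothing. Thus \<open>a\<close> lies in the Jacobson radical of
  \<open>B\<close>.\<close>

lemma jacobson_unit:
  assumes B: "is_subring B" and L: "is_subfield L" "B \<subseteq> L" and a: "a \<in> B" "a \<noteq> 0" "inverse a \<notin> B"
    and max: "\<And>C. is_subring C \<Longrightarrow> B \<subseteq> C \<Longrightarrow> C \<subseteq> L \<Longrightarrow> inverse a \<notin> C \<Longrightarrow> C = B"
    and b: "b \<in> B"
  shows "1 - a * b \<noteq> 0" "inverse (1 - a * b) \<in> B"
proof -
  define c where "c = 1 - a * b"
  have no_unit: "a * e \<noteq> 1" if "e \<in> B" for e
  proof
    assume "a * e = 1"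
    then have "inverse a = e" by (rule inverse_unique)
    then show False using that a by simp
  qed
  have cB: "c \<in> B" unfolding c_def using B a b by (auto intro: subring_closed)
  show c0: "1 - a * b \<noteq> 0" using no_unit[OF b] by auto
  then have c0': "c \<noteq> 0" by (simp add: c_def)
  have cpow: "\<exists>e\<in>B. c ^ k = 1 - a * e" for k
  proof (induction k)
    case 0
    show ?case using subring_zero[OF B] by (intro bexI[of _ 0]) auto
  next
    case (Suc k)
    then obtain e where e: "e \<in> B" "c ^ k = 1 - a * e" by blast
    have "c ^ Suc k = 1 - a * (b + e - a * b * e)"
      by (simp add: e(2)) (simp add: c_def algebra_simps)
    moreover have "b + e - a * b * e \<in> B"
      using e b a by (intro subring_diff[OF B] subring_add[OF B] subring_mult[OF B])
    ultimately show ?case by blast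
  qed
  define C where "C = {x / c ^ k | x k. x \<in> B}"
  have C: "x / c ^ k \<in> C" if "x \<in> B" for x k using that by (auto simp: C_def)
  have ck: "c ^ k \<in> B" for k using cB by (rule subring_power[OF B])
  have "is_subring C"
    unfolding is_subring_def
  proof (intro conjI ballI)
    show "0 \<in> C" "1 \<in> C" using C[of 0 0] C[of 1 0] subring_zero[OF B] subring_one[OF B] by auto
    fix x y assume "x \<in> C" "y \<in> C"
    then obtain x' y' k l where xy: "x = x' / c ^ k" "y = y' / c ^ l" "x' \<in> B" "y' \<in> B"
      by (auto simp: C_def)
    have "x + y = (x' * c ^ l + y' * c ^ k) / c ^ (k + l)"
      "x - y = (x' * c ^ l - y' * c ^ k) / c ^ (k + l)" "x * y = (x' * y') / c ^ (k + l)"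
      using c0' by (simp_all add: xy field_simps power_add)
    moreover have "x' * c ^ l + y' * c ^ k \<in> B" "x' * c ^ l - y' * c ^ k \<in> B" "x' * y' \<in> B"
      using xy by (intro subring_add[OF B] subring_diff[OF B] subring_mult[OF B] ck; simp)+
    ultimately show "x + y \<in> C" "x - y \<in> C" "x * y \<in> C" using C by simp_all
  qed
  moreover have "B \<subseteq> C" using C[of _ 0] by auto
  moreover have "C \<subseteq> L"
  proof
    fix x assume "x \<in> C"
    then obtain x' k where "x = x' / c ^ k" "x' \<in> B" by (auto simp: C_def)
    then show "x \<in> L" using L(2) ck[of k] by (auto intro!: subfield_divide[OF L(1)])
  qed
  moreover have "inverse a \<notin> C"
  proof
    assume "inverse a \<in> C"
    then obtain x k where x: "inverse a = x / c ^ k" "x \<in> B" by (auto simp: C_def)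
    obtain e where e: "e \<in> B" "c ^ k = 1 - a * e" using cpow by blast
    have "c ^ k = a * x" using x(1) c0' a(2) by (simp add: field_simps)
    then have "a * (x + e) = 1" using e by (simp add: algebra_simps)
    then show False using no_unit subring_add[OF B x(2) e(1)] by blast
  qed
  ultimately have "C = B" by (rule max)
  then have "1 / c ^ 1 \<in> B" using C[of 1 1] subring_one[OF B] by blast
  then show "inverse (1 - a * b) \<in> B" by (simp add: c_def divide_inverse)
qed

text \<open>The relation for 1/w multiplied by w^n, with n the degree of \<open>p\<close>, expresses
  c w^n through lower powers of \<open>w\<close>, where c = 1 - a r(0). As c is a unit, the leading
  term of \<open>p\<close> can be replaced.\<close>

lemma reduce_relation:
  assumes B: "is_subring B" and a: "a \<in> B" "inverse a \<notin> B"
    and unit: "\<And>b. b \<in> B \<Longrightarrow> 1 - a * b \<noteq> 0 \<and> inverse (1 - a * b) \<in> B"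
    and w: "w \<noteq> 0"
    and p: "p \<in> polys_over B" "a * poly p w = 1" and r: "r \<in> polys_over B" "a * poly r (inverse w) = 1"
    and deg: "degree r \<le> degree p"
  shows "\<exists>p'\<in>polys_over B. a * poly p' w = 1 \<and> degree p' < degree p"
proof -
  define n m where "n = degree p" and "m = degree r"
  have n0: "n > 0"
  proof (rule ccontr)
    assume "\<not> n > 0"
    then obtain c where "p = [:c:]" by (metis degree_eq_zeroE n_def neq0_conv)
    then have "a * c = 1" "c \<in> B" using p polys_over_coeff[OF p(1), of 0] by auto
    then have "inverse a = c" by (intro inverse_unique)
    then show False using \<open>c \<in> B\<close> a by simp
  qed
  define c where "c = 1 - a * coeff r 0"
  have c: "c \<noteq> 0" "inverse c \<in> B" using unit[OF polys_over_coeff[OF r(1)]] by (auto simp: c_def)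
  \<comment> \<open>Chosen such that q(w) = w^n (r(1/w) - r(0)).\<close>
  define q where "q = (\<Sum>i\<in>{1..m}. monom (coeff r i) (n - i))"
  define p' where "p' = p - monom (coeff p n) n + smult (coeff p n * inverse c * a) q"
  have "p' \<in> polys_over B"
    unfolding p'_def q_def
    using a c by (intro polys_over_closed[OF B] polys_over_sum[OF B] subring_mult[OF B] polys_over_coeff p(1) r(1))
  moreover have "degree p' < n"
  proof (rule degree_lessI)
    show "p' \<noteq> 0 \<or> 0 < n" using n0 by simp
    show "\<forall>k\<ge>n. coeff p' k = 0"
    proof (intro allI impI)
      fix k assume k: "n \<le> k"
      have "coeff q k = 0" unfolding q_def coeff_sum
        using k deg n0 by (intro sum.neutral) (auto simp: m_def n_def)
      moreover have "coeff p k = 0" if "k \<noteq> n"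
        using k that by (intro coeff_eq_0) (simp add: n_def)
      ultimately show "coeff p' k = 0" by (cases "k = n") (simp_all add: p'_def)
    qed
  qed
  moreover have "a * poly p' w = 1"
  proof -
    have "poly r (inverse w) = (\<Sum>i\<le>m. coeff r i * inverse w ^ i)" by (simp add: poly_altdef m_def)
    also have "{..m} = insert 0 {1..m}" by auto
    also have "(\<Sum>i\<in>insert 0 {1..m}. coeff r i * inverse w ^ i) = coeff r 0 + (\<Sum>i\<in>{1..m}. coeff r i * inverse w ^ i)"
      by simp
    finally have "a * (\<Sum>i\<in>{1..m}. coeff r i * inverse w ^ i) = c"
      using r(2) by (simp add: c_def algebra_simps)
    moreover have "poly q w = w ^ n * (\<Sum>i\<in>{1..m}. coeff r i * inverse w ^ i)"
      unfolding q_def poly_sum sum_distrib_left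
    proof (intro sum.cong refl)
      fix i assume "i \<in> {1..m}"
      then have "i \<le> n" using deg by (simp add: m_def n_def)
      then have "w ^ (n - i) = w ^ n * inverse w ^ i" using w
        by (simp add: power_diff field_simps)
      then show "poly (monom (coeff r i) (n - i)) w = w ^ n * (coeff r i * inverse w ^ i)"
        by (simp add: poly_monom)
    qed
    ultimately have q: "a * poly q w = w ^ n * c" by (metis mult.left_commute)
    have "a * poly p' w = a * poly p w - a * coeff p n * w ^ n + a * coeff p n * inverse c * (a * poly q w)"
      by (simp add: p'_def poly_monom algebra_simps)
    also have "\<dots> = 1" using c by (simp add: p q)
    finally show ?thesis .
  qed
  ultimately show ?thesis by (auto simp: n_def)
qed

text \<open>If neither \<open>w\<close> nor \<open>1/w\<close> were in \<open>B\<close>, maximality would give relations \<open>a p(w) = 1\<close> and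
  \<open>a r(1/w) = 1\<close>; the one of larger degree can be reduced by the other.\<close>

lemma maximal_subring_valuation:
  assumes B: "is_subring B" and L: "is_subfield L" "B \<subseteq> L" and a: "a \<in> B" "a \<noteq> 0" "inverse a \<notin> B"
    and max: "\<And>C. is_subring C \<Longrightarrow> B \<subseteq> C \<Longrightarrow> C \<subseteq> L \<Longrightarrow> inverse a \<notin> C \<Longrightarrow> C = B"
    and w: "w \<in> L"
  shows "w \<in> B \<or> inverse w \<in> B"
proof (rule ccontr)
  assume contra: "\<not> ?thesis"
  then have w0: "w \<noteq> 0" using subring_zero[OF B] by auto
  have ex: "\<exists>p\<in>polys_over B. a * poly p x = 1" if x: "x \<in> L" "x \<notin> B" for x
  proof -
    have "ring_adjoin B x \<noteq> B" using ring_adjoin_elem[OF B, of x] x by auto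
    moreover have "ring_adjoin B x \<subseteq> L"
      using poly_in_subring[OF B _ L(2) subfield_subring[OF L(1)] x(1)] by (auto simp: ring_adjoin_def[OF B])
    ultimately have "inverse a \<in> ring_adjoin B x"
      using max[OF subring_ring_adjoin[OF B] ring_adjoin_base[OF B]] by blast
    then obtain p where "p \<in> polys_over B" "inverse a = poly p x" by (auto simp: ring_adjoin_def[OF B])
    then show ?thesis using a by (metis right_inverse)
  qed
  define good where "good pr \<longleftrightarrow> fst pr \<in> polys_over B \<and> snd pr \<in> polys_over B \<and>
    a * poly (fst pr) w = 1 \<and> a * poly (snd pr) (inverse w) = 1" for pr
  have "\<exists>pr. good pr"
    using ex[OF w] ex[OF subfield_inverse[OF L(1) w]] contra by (auto simp: good_def)
  then obtain pr where pr: "good pr"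
      and least: "\<And>pr'. good pr' \<Longrightarrow> degree (fst pr) + degree (snd pr) \<le> degree (fst pr') + degree (snd pr')"
    using ex_has_least_nat[of good _ "\<lambda>pr. degree (fst pr) + degree (snd pr)"] by blast
  obtain p r where prp: "pr = (p, r)" by (cases pr)
  have p: "p \<in> polys_over B" "a * poly p w = 1" and r: "r \<in> polys_over B" "a * poly r (inverse w) = 1"
    using pr by (auto simp: good_def prp)
  have unit: "1 - a * b \<noteq> 0 \<and> inverse (1 - a * b) \<in> B" if "b \<in> B" for b
    using jacobson_unit[OF B L a max that] by blast
  show False
  proof (cases "degree r \<le> degree p")
    case True
    then obtain p' where "p' \<in> polys_over B" "a * poly p' w = 1" "degree p' < degree p"
      using reduce_relation[OF B a(1,3) unit w0 p r] by blast
    then show False using least[of "(p', r)"] r by (simp add: good_def prp)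
  next
    case False
    have r': "a * poly p (inverse (inverse w)) = 1" using p by simp
    obtain r' where "r' \<in> polys_over B" "a * poly r' (inverse w) = 1" "degree r' < degree r"
      using reduce_relation[OF B a(1,3) unit _ r p(1) r'] False w0 by auto
    then show False using least[of "(p, r')"] p by (simp add: good_def prp)
  qed
qed

text \<open>By Zorn's lemma some subring of \<open>L\<close> is maximal among those containing
  \<open>A\<close> and omitting 1/a. It is a valuation ring in which \<open>a\<close> is a
  nonunit.\<close>

theorem exists_place_containing:
  assumes K: "is_subfield K" and L: "is_subfield L" and A: "is_subring A" "K \<subseteq> A" "A \<subseteq> L"
    and a: "a \<in> A" "a \<noteq> 0" "inverse a \<notin> A"
  shows "\<exists>P. is_place K L P \<and> A \<subseteq> place_ring K L P \<and> a \<in> P"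
proof -
  define F where "F = {B. is_subring B \<and> A \<subseteq> B \<and> B \<subseteq> L \<and> inverse a \<notin> B}"
  have "A \<in> F" using A a by (simp add: F_def)
  moreover have "\<Union>C \<in> F" if C: "C \<noteq> {}" "subset.chain F C" for C
  proof -
    have CF: "C \<subseteq> F" and lin: "\<And>X Y. X \<in> C \<Longrightarrow> Y \<in> C \<Longrightarrow> X \<subseteq> Y \<or> Y \<subseteq> X"
      using C by (auto simp: subset.chain_def)
    obtain X where X: "X \<in> C" using C by blast
    have sub: "is_subring Y" if "Y \<in> C" for Y using CF that by (auto simp: F_def)
    have "is_subring (\<Union>C)"
      unfolding is_subring_def
    proof (intro conjI ballI)
      show "0 \<in> \<Union>C" "1 \<in> \<Union>C" using X sub[OF X] subring_zero subring_one by blast+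
      fix x y assume "x \<in> \<Union>C" "y \<in> \<Union>C"
      then obtain Z where Z: "Z \<in> C" "x \<in> Z" "y \<in> Z" using lin by blast
      have "x + y \<in> Z" "x - y \<in> Z" "x * y \<in> Z"
        using Z sub[OF Z(1)] by (auto intro: subring_add subring_diff subring_mult)
      then show "x + y \<in> \<Union>C" "x - y \<in> \<Union>C" "x * y \<in> \<Union>C" using Z(1) by blast+
    qed
    then show ?thesis using CF X by (auto simp: F_def)
  qed
  ultimately obtain B where BF: "B \<in> F" and Bmax: "\<forall>X\<in>F. B \<subseteq> X \<longrightarrow> X = B"
    using subset_Zorn_nonempty[of F] by blast
  have B: "is_subring B" "A \<subseteq> B" "B \<subseteq> L" "inverse a \<notin> B" using BF by (auto simp: F_def)
  have max: "C = B" if "is_subring C" "B \<subseteq> C" "C \<subseteq> L" "inverse a \<notin> C" for C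
    using Bmax that B by (auto simp: F_def)
  have aB: "a \<in> B" using a B by blast
  have "a \<notin> K" using a A subfield_inverse[OF K] by blast
  moreover have "inverse a \<in> L" using a A by (auto intro: subfield_inverse[OF L])
  moreover have "w \<in> B \<or> inverse w \<in> B" if "w \<in> L" for w
    by (rule maximal_subring_valuation[OF B(1) L B(3) aB a(2) B(4) max that])
  ultimately have V: "is_valuation_ring K L B"
    using A B aB unfolding is_valuation_ring_def by blast
  have "a \<in> val_ideal B" using aB B(4) by (simp add: val_ideal_def)
  then show ?thesis using place_val_ideal[OF L V] B(2) by auto
qed

subsection \<open>Rational function fields\<close>

lemma polys_over_divmod:
  assumes K: "is_subfield K" and p: "p \<in> polys_over K" and s: "s \<in> polys_over K" "s \<noteq> 0"
  shows "\<exists>k\<in>polys_over K. \<exists>r\<in>polys_over K. p = k * s + r \<and> (r = 0 \<or> degree r < degree s)"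
  using p
proof (induction "degree p" arbitrary: p rule: less_induct)
  case less
  note R = subfield_subring[OF K]
  show ?case
  proof (cases "p = 0 \<or> degree p < degree s")
    case True
    then show ?thesis using less(2) polys_over_zero[OF R] by (intro bexI[of _ 0] bexI[of _ p]) auto
  next
    case False
    define c where "c = lead_coeff p / lead_coeff s"
    define t where "t = monom c (degree p - degree s)"
    have c: "c \<in> K" "c \<noteq> 0" unfolding c_def using less(2) s False K
      by (auto intro: subfield_divide polys_over_coeff)
    have t: "t \<in> polys_over K" using c polys_over_monom[OF R] by (simp add: t_def)
    define p1 where "p1 = p - t * s"
    have p1: "p1 \<in> polys_over K" unfolding p1_def
      using t s less(2) by (intro polys_over_diff[OF R] polys_over_mult[OF R])
    have dt: "degree (t * s) = degree p" using c s False by (simp add: t_def degree_mult_eq degree_monom_eq)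
    have "lead_coeff t = c" using c by (simp add: t_def degree_monom_eq)
    then have "lead_coeff (t * s) = lead_coeff p"
      using s by (simp add: lead_coeff_mult c_def)
    then have "coeff p1 (degree p) = 0" using dt by (simp add: p1_def)
    moreover have "degree p1 \<le> degree p" unfolding p1_def using degree_diff_le_max[of p "t * s"] dt by simp
    ultimately have "p1 = 0 \<or> degree p1 < degree p"
      by (metis le_neq_implies_less leading_coeff_0_iff)
    then have "\<exists>k\<in>polys_over K. \<exists>r\<in>polys_over K. p1 = k * s + r \<and> (r = 0 \<or> degree r < degree s)"
    proof
      assume "p1 = 0"
      then show ?thesis using polys_over_zero[OF R] by (intro bexI[of _ 0]) auto
    qed (use less(1) p1 in blast)
    then obtain k r where kr: "k \<in> polys_over K" "r \<in> polys_over K" "p1 = k * s + r" "r = 0 \<or> degree r < degree s"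
      by blast
    have "p = (k + t) * s + r" using kr(3) by (simp add: p1_def algebra_simps)
    moreover have "k + t \<in> polys_over K" using kr t by (intro polys_over_add[OF R])
    ultimately show ?thesis using kr by blast
  qed
qed

text \<open>Euclid's algorithm with coefficients kept in \<open>K\<close>. It also returns the
  coprime cofactors, so that fractions can be reduced.\<close>

lemma polys_over_bezout:
  assumes K: "is_subfield K" and "p \<in> polys_over K" "s \<in> polys_over K"
  shows "\<exists>d\<in>polys_over K. \<exists>p'\<in>polys_over K. \<exists>s'\<in>polys_over K. \<exists>a\<in>polys_over K. \<exists>b\<in>polys_over K.
    p = d * p' \<and> s = d * s' \<and> a * p' + b * s' = 1"
  using assms(2,3)
proof (induction "if s = 0 then 0 else Suc (degree s)" arbitrary: p s rule: less_induct)
  case less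
  note R = subfield_subring[OF K]
  note X = polys_over_closed[OF R]
  show ?case
  proof (cases "s = 0")
    case True
    then show ?thesis using less(2) X(1,2)
      by (intro bexI[of _ p] bexI[of _ 1] bexI[of _ 0] bexI[of _ 1] bexI[of _ 0]) auto
  next
    case False
    obtain k r where kr: "k \<in> polys_over K" "r \<in> polys_over K" "p = k * s + r" "r = 0 \<or> degree r < degree s"
      using polys_over_divmod[OF K less(2,3) False] by blast
    have "(if r = 0 then 0 else Suc (degree r)) < (if s = 0 then 0 else Suc (degree s))"
      using kr(4) False by auto
    from less(1)[OF this less(3) kr(2)] obtain d s1 r1 a b where
      h: "d \<in> polys_over K" "s1 \<in> polys_over K" "r1 \<in> polys_over K" "a \<in> polys_over K" "b \<in> polys_over K"
        "s = d * s1" "r = d * r1" "a * s1 + b * r1 = 1" by blast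
    have "p = d * (k * s1 + r1)" using kr(3) h by (simp add: algebra_simps)
    moreover have "b * (k * s1 + r1) + (a - b * k) * s1 = 1" using h(8) by (simp add: algebra_simps)
    moreover have "k * s1 + r1 \<in> polys_over K" "a - b * k \<in> polys_over K"
      using h kr by (auto intro!: X(3,4,5))
    ultimately show ?thesis using h by blast
  qed
qed

text \<open>A nonunit divisor of least degree is prime: its common divisor with \<open>f\<close> is
  either a unit, and then the Bezout identity shows that it divides \<open>g\<close>, or associated
  to it, and then it divides \<open>f\<close>.\<close>

lemma poly_prime_divisor:
  fixes s :: "'a::field poly"
  assumes s: "s \<noteq> 0" "\<not> is_unit s"
  shows "\<exists>\<pi>. prime_elem \<pi> \<and> \<pi> dvd s"
proof -
  define Q where "Q \<pi> \<longleftrightarrow> \<pi> dvd s \<and> \<not> is_unit \<pi>" for \<pi>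
  have "Q s" using s by (simp add: Q_def)
  then obtain \<pi> where pi: "Q \<pi>" and least: "\<And>d. Q d \<Longrightarrow> degree \<pi> \<le> degree d"
    using ex_has_least_nat[of Q s degree] by blast
  have pi0: "\<pi> \<noteq> 0" using pi s by (auto simp: Q_def)
  have "\<pi> dvd f \<or> \<pi> dvd g" if fg: "\<pi> dvd f * g" for f g
  proof -
    have "p \<in> polys_over UNIV" for p :: "'a poly" by (simp add: polys_over_def)
    then obtain d p' f' a b where d: "\<pi> = d * p'" "f = d * f'" "a * p' + b * f' = 1"
      using polys_over_bezout[OF is_subfield_UNIV, of \<pi> f] by blast
    show ?thesis
    proof (cases "is_unit d")
      case True
      then obtain e where e: "d * e = 1" by (metis dvdE)
      have "g = a * p' * g + b * f' * g" using d(3) by (metis distrib_right mult_1)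
      also have "\<dots> = d * e * (a * p' * g) + d * e * (b * f' * g)" using e by simp
      also have "\<dots> = \<pi> * (e * a * g) + (e * b) * (f * g)" by (simp add: d(1,2) mult_ac)
      finally have "g = \<pi> * (e * a * g) + (e * b) * (f * g)" .
      moreover have "\<pi> dvd \<pi> * (e * a * g) + (e * b) * (f * g)" using fg by simp
      ultimately show ?thesis by metis
    next
      case False
      moreover have "d dvd s" using d(1) pi dvd_trans[of d \<pi> s] by (auto simp: Q_def)
      ultimately have "degree \<pi> \<le> degree d" using least[of d] by (simp add: Q_def)
      moreover have nz: "d \<noteq> 0" "p' \<noteq> 0" using pi0 d(1) by auto
      ultimately have "degree p' = 0" using d(1) by (simp add: degree_mult_eq)
      then have "is_unit p'" using nz is_unit_iff_degree by blast
      then have "\<pi> dvd d" using d(1) mult_unit_dvd_iff[of p' d d] by simp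
      then show ?thesis using d(2) by simp
    qed
  qed
  then have "prime_elem \<pi>" using pi pi0 by (auto simp: prime_elem_def Q_def)
  then show ?thesis using pi by (auto simp: Q_def)
qed

lemma prime_elem_power_dvd_cancel:
  fixes \<pi> :: "'a::idom"
  assumes "prime_elem \<pi>" "\<not> \<pi> dvd c"
  shows "\<pi> ^ k dvd E * c \<Longrightarrow> \<pi> ^ k dvd E"
proof (induction k arbitrary: E)
  case (Suc k)
  have "\<pi> dvd E * c" using Suc(2) by (metis dvd_mult_left power_Suc)
  then have "\<pi> dvd E" using assms by (auto simp: prime_elem_def)
  then obtain E' where E': "E = \<pi> * E'" by (elim dvdE)
  have "\<pi> * \<pi> ^ k dvd \<pi> * (E' * c)" using Suc(2) by (simp add: E' mult.assoc)
  then have "\<pi> ^ k dvd E' * c" using assms(1) by (simp add: prime_elem_def)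
  then have "\<pi> ^ k dvd E'" by (rule Suc.IH)
  then show ?case by (simp add: E')
qed simp

section \<open>The field K(u), its ring of polynomials in \<open>u\<close> and the pole of
  \<open>u\<close>\<close>

locale ratfun =
  fixes K :: "'a::field set" and u :: 'a
  assumes subfieldK: "is_subfield K" and trans: "transcendental_over K u"
begin

definition L1 :: "'a set" where
  "L1 = {poly p u / poly s u | p s. p \<in> polys_over K \<and> s \<in> polys_over K \<and> s \<noteq> 0}"

definition R1 :: "'a set" where
  "R1 = (\<lambda>p. poly p u) ` polys_over K"

text \<open>The order at infinity, that is, at the pole of \<open>u\<close>; on polynomials it is
  minus the degree.\<close>

definition v1 :: "'a \<Rightarrow> int" where
  "v1 w = (THE k. \<exists>p\<in>polys_over K. \<exists>s\<in>polys_over K. p \<noteq> 0 \<and> s \<noteq> 0 \<and>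
     w = poly p u / poly s u \<and> k = int (degree s) - int (degree p))"

lemmas ringK = subfield_subring[OF subfieldK]
lemmas X_closed = polys_over_closed[OF ringK]

lemma poly_u_eq_0: "p \<in> polys_over K \<Longrightarrow> poly p u = 0 \<longleftrightarrow> p = 0"
  using trans by (auto simp: transcendental_over_def polys_over_def)

lemma poly_u_inj: "p \<in> polys_over K \<Longrightarrow> r \<in> polys_over K \<Longrightarrow> poly p u = poly r u \<Longrightarrow> p = r"
  using poly_u_eq_0[of "p - r"] X_closed(4) by simp

lemma L1_I: "p \<in> polys_over K \<Longrightarrow> s \<in> polys_over K \<Longrightarrow> s \<noteq> 0 \<Longrightarrow> poly p u / poly s u \<in> L1"
  by (auto simp: L1_def)

lemma L1_E:
  assumes "w \<in> L1"
  obtains p s where "p \<in> polys_over K" "s \<in> polys_over K" "s \<noteq> 0" "w = poly p u / poly s u" "poly s u \<noteq> 0"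
  using assms poly_u_eq_0 by (auto simp: L1_def)

lemma subring_R1: "is_subring R1"
  using subring_ring_adjoin[OF ringK, of u] by (simp add: R1_def ring_adjoin_def[OF ringK])

lemma R1_I: "p \<in> polys_over K \<Longrightarrow> poly p u \<in> R1"
  by (auto simp: R1_def)

lemma K_R1: "K \<subseteq> R1" and u_R1: "u \<in> R1"
  using ring_adjoin_base[OF ringK, of u] ring_adjoin_elem[OF ringK, of u]
  by (simp_all add: R1_def ring_adjoin_def[OF ringK])

lemma u_nonzero: "u \<noteq> 0"
  using poly_u_eq_0[OF X_closed(6)[OF subring_one[OF ringK], of 1]] by (auto simp: poly_monom)

lemma R1_L1: "R1 \<subseteq> L1"
  using L1_I[OF _ X_closed(2)] by (auto simp: R1_def)

lemma subfield_L1: "is_subfield L1"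
  unfolding is_subfield_def is_subring_def
proof (intro conjI ballI)
  show "0 \<in> L1" "1 \<in> L1" using R1_L1 subring_R1 by (auto intro: subring_closed)
  fix a b assume "a \<in> L1" "b \<in> L1"
  then obtain p s p' s' where h: "p \<in> polys_over K" "s \<in> polys_over K" "s \<noteq> 0" "a = poly p u / poly s u" "poly s u \<noteq> 0"
      "p' \<in> polys_over K" "s' \<in> polys_over K" "s' \<noteq> 0" "b = poly p' u / poly s' u" "poly s' u \<noteq> 0"
    by (elim L1_E)
  have "a + b = poly (p * s' + p' * s) u / poly (s * s') u" "a - b = poly (p * s' - p' * s) u / poly (s * s') u"
    "a * b = poly (p * p') u / poly (s * s') u"
    using h(5,10) by (simp_all add: h(4,9) field_simps)
  then show "a + b \<in> L1" "a - b \<in> L1" "a * b \<in> L1"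
    using h X_closed(3)[OF X_closed(5)[of p s'] X_closed(5)[of p' s]]
      X_closed(4)[OF X_closed(5)[of p s'] X_closed(5)[of p' s]] X_closed(5)[of p p'] X_closed(5)[of s s']
    by (auto intro: L1_I simp del: poly_add poly_diff poly_mult)
next
  fix a assume "a \<in> L1"
  then obtain p s where h: "p \<in> polys_over K" "s \<in> polys_over K" "s \<noteq> 0" "a = poly p u / poly s u" "poly s u \<noteq> 0"
    by (elim L1_E)
  show "inverse a \<in> L1"
  proof (cases "p = 0")
    case True
    then show ?thesis using h R1_L1 subring_zero[OF subring_R1] by auto
  next
    case False
    then show ?thesis using L1_I[OF h(2,1)] h by simp
  qed
qed

lemma L1_eq: "L1 = adjoin K {u}"
proof
  show "adjoin K {u} \<subseteq> L1"
    using K_R1 u_R1 R1_L1 by (intro adjoin_least subfield_L1) auto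
  have F: "is_subfield (adjoin K {u})" by (rule is_subfield_adjoin)
  have "poly p u \<in> adjoin K {u}" if "p \<in> polys_over K" for p
    using poly_in_subring[OF ringK that] adjoin_superset[of K "{u}"] subfield_subring[OF F] by auto
  then show "L1 \<subseteq> adjoin K {u}" using F by (auto elim!: L1_E intro: subfield_divide)
qed

lemma v1_eq:
  assumes "p \<in> polys_over K" "s \<in> polys_over K" "p \<noteq> 0" "s \<noteq> 0"
  shows "v1 (poly p u / poly s u) = int (degree s) - int (degree p)"
  unfolding v1_def
proof (rule the_equality)
  fix k assume "\<exists>p'\<in>polys_over K. \<exists>s'\<in>polys_over K. p' \<noteq> 0 \<and> s' \<noteq> 0 \<and>
    poly p u / poly s u = poly p' u / poly s' u \<and> k = int (degree s') - int (degree p')"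
  then obtain p' s' where h: "p' \<in> polys_over K" "s' \<in> polys_over K" "p' \<noteq> 0" "s' \<noteq> 0"
    "poly p u / poly s u = poly p' u / poly s' u" and k: "k = int (degree s') - int (degree p')" by blast
  have "poly (p * s') u = poly (p' * s) u"
    using h assms poly_u_eq_0 by (simp add: field_simps)
  then have "p * s' = p' * s" using h assms by (intro poly_u_inj X_closed(5))
  then have "degree p + degree s' = degree p' + degree s"
    using h assms by (metis degree_mult_eq)
  then show "k = int (degree s) - int (degree p)" using k by linarith
qed (use assms in blast)

lemma v1_poly: "p \<in> polys_over K \<Longrightarrow> p \<noteq> 0 \<Longrightarrow> v1 (poly p u) = - int (degree p)"
  using v1_eq[of p 1] X_closed(2) by simp

lemma v1_E:
  assumes "w \<in> L1" "w \<noteq> 0"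
  obtains p s where "p \<in> polys_over K" "s \<in> polys_over K" "p \<noteq> 0" "s \<noteq> 0" "w = poly p u / poly s u"
    "poly p u \<noteq> 0" "poly s u \<noteq> 0" "v1 w = int (degree s) - int (degree p)"
proof -
  obtain p s where h: "p \<in> polys_over K" "s \<in> polys_over K" "s \<noteq> 0" "w = poly p u / poly s u" "poly s u \<noteq> 0"
    using assms(1) by (elim L1_E)
  then have "p \<noteq> 0" using assms(2) by auto
  with h v1_eq[of p s] poly_u_eq_0 show thesis by (intro that[of p s]) auto
qed

sublocale dval K L1 v1
proof
  show "is_subfield K" "is_subfield L1" by (fact subfieldK, fact subfield_L1)
  show "K \<subseteq> L1" using K_R1 R1_L1 by blast
  show "v1 (a * b) = v1 a + v1 b" if ab: "a \<in> L1" "b \<in> L1" "a \<noteq> 0" "b \<noteq> 0" for a b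
  proof -
    obtain p s where 1: "p \<in> polys_over K" "s \<in> polys_over K" "p \<noteq> 0" "s \<noteq> 0" "a = poly p u / poly s u"
      "poly p u \<noteq> 0" "poly s u \<noteq> 0" "v1 a = int (degree s) - int (degree p)" using ab(1,3) by (rule v1_E)
    obtain p' s' where 2: "p' \<in> polys_over K" "s' \<in> polys_over K" "p' \<noteq> 0" "s' \<noteq> 0" "b = poly p' u / poly s' u"
      "poly p' u \<noteq> 0" "poly s' u \<noteq> 0" "v1 b = int (degree s') - int (degree p')" using ab(2,4) by (rule v1_E)
    have "a * b = poly (p * p') u / poly (s * s') u" by (simp add: 1(5) 2(5))
    also have "v1 \<dots> = int (degree (s * s')) - int (degree (p * p'))"
      using 1 2 by (intro v1_eq X_closed(5)) auto
    finally show ?thesis using 1 2 by (simp add: degree_mult_eq)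
  qed
  show "min (v1 a) (v1 b) \<le> v1 (a + b)" if ab: "a \<in> L1" "b \<in> L1" "a \<noteq> 0" "b \<noteq> 0" "a + b \<noteq> 0" for a b
  proof -
    obtain p s where 1: "p \<in> polys_over K" "s \<in> polys_over K" "p \<noteq> 0" "s \<noteq> 0" "a = poly p u / poly s u"
      "poly p u \<noteq> 0" "poly s u \<noteq> 0" "v1 a = int (degree s) - int (degree p)" using ab(1,3) by (rule v1_E)
    obtain p' s' where 2: "p' \<in> polys_over K" "s' \<in> polys_over K" "p' \<noteq> 0" "s' \<noteq> 0" "b = poly p' u / poly s' u"
      "poly p' u \<noteq> 0" "poly s' u \<noteq> 0" "v1 b = int (degree s') - int (degree p')" using ab(2,4) by (rule v1_E)
    have e: "a + b = poly (p * s' + p' * s) u / poly (s * s') u"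
      using 1(7) 2(7) by (simp add: 1(5) 2(5) field_simps)
    then have "poly (p * s' + p' * s) u \<noteq> 0" using ab(5) by (auto simp del: poly_add poly_mult)
    then have nz: "p * s' + p' * s \<noteq> 0" by (metis poly_0)
    then have "v1 (a + b) = int (degree (s * s')) - int (degree (p * s' + p' * s))"
      unfolding e using 1 2 nz by (intro v1_eq X_closed(3,5)) auto
    moreover have "degree (p * s' + p' * s) \<le> max (degree (p * s')) (degree (p' * s))" by (rule degree_add_le_max)
    ultimately show ?thesis using 1 2 by (auto simp: degree_mult_eq)
  qed
  show "v1 c = 0" if "c \<in> K" "c \<noteq> 0" for c
    using v1_poly[OF X_closed(6)[OF that(1), of 0]] that(2) by (simp add: poly_monom degree_monom_eq)
  have "v1 (poly 1 u / poly (monom 1 1) u) = 1"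
    using X_closed(2) X_closed(6)[OF subring_one[OF ringK], of 1] by (subst v1_eq) (auto simp: degree_monom_eq)
  moreover have "inverse u \<in> L1" using R1_L1 u_R1 subfield_L1 by (auto intro: subfield_inverse)
  ultimately show "\<exists>t\<in>L1. t \<noteq> 0 \<and> v1 t = 1"
    using u_nonzero by (intro bexI[of _ "inverse u"]) (auto simp: poly_monom divide_inverse)
qed

lemma v1_inverse_u: "v1 (inverse u) = 1"
proof -
  have "v1 (poly 1 u / poly (monom 1 1) u) = 1"
    using X_closed(2) X_closed(6)[OF subring_one[OF ringK], of 1] by (subst v1_eq) (auto simp: degree_monom_eq)
  then show ?thesis by (auto simp: poly_monom divide_inverse)
qed

lemma v1_u: "v1 u = - 1"
  using v1_inverse_u v_inverse[of u] R1_L1 u_R1 u_nonzero by auto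

text \<open>The constant is the quotient of the leading coefficients.\<close>

lemma v1_residue:
  assumes "a \<in> L1" "a \<noteq> 0" "v1 a = 0"
  shows "\<exists>c\<in>K. c \<noteq> 0 \<and> vge v1 1 (a - c)"
proof -
  obtain p s where h: "p \<in> polys_over K" "s \<in> polys_over K" "p \<noteq> 0" "s \<noteq> 0" "a = poly p u / poly s u"
    "poly p u \<noteq> 0" "poly s u \<noteq> 0" "v1 a = int (degree s) - int (degree p)" using assms(1,2) by (rule v1_E)
  have deg: "degree p = degree s" using h assms(3) by simp
  define c where "c = lead_coeff p / lead_coeff s"
  have c: "c \<in> K" "c \<noteq> 0" unfolding c_def using h
    by (auto intro!: subfield_divide[OF subfieldK] polys_over_coeff)
  define r where "r = p - smult c s"
  have r: "r \<in> polys_over K" unfolding r_def using h c by (intro X_closed(4,7))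
  have e: "a - c = poly r u / poly s u" using h by (simp add: r_def field_simps)
  have "vge v1 1 (a - c)"
  proof (cases "r = 0")
    case False
    have "degree r \<le> degree s" using deg c unfolding r_def by (metis degree_diff_le_max degree_smult_eq max.idem)
    moreover have "coeff r (degree s) = 0" using h deg by (simp add: r_def c_def)
    ultimately have "degree r < degree s" using False by (metis le_neq_implies_less leading_coeff_0_iff)
    then show ?thesis using v1_eq[OF r h(2) False h(4)] by (simp add: e vge_def)
  qed (simp add: e)
  with c show ?thesis by blast
qed

text \<open>A polynomial of degree d in \<open>u\<close> is u^d times the reversed polynomial in
  1/u. The latter has the leading coefficient as its constant term, so it is a unit wherever 1/u
  vanishes. The field \<open>L\<close> is general because the result is applied to K(u) and to
  F.\<close>

lemma place_containing_inverse_u: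
  assumes L: "is_subfield L" "L1 \<subseteq> L" and P: "is_place K L P" "inverse u \<in> P"
  shows "vring L1 v1 \<subseteq> place_ring K L P" "vplace L1 v1 \<subseteq> P"
proof -
  let ?T = "inverse u"
  define V where "V = place_ring K L P"
  have VR: "is_valuation_ring K L V" and PO: "P = val_ideal V" using placeD[OF L(1) P(1)] by (auto simp: V_def)
  note O = valuation_ringD[OF VR]
  have id: "is_ideal V P" using val_ideal_is_ideal[OF L(1) VR] PO by simp
  have TO: "?T \<in> V" using P PO by (auto simp: val_ideal_def)
  have P_mult: "r * a \<in> P" "a * r \<in> P" if "a \<in> P" "r \<in> V" for a r
    using id that unfolding is_ideal_def by (auto simp: mult.commute)
  have P_add: "a + b \<in> P" if "a \<in> P" "b \<in> P" for a b using id that unfolding is_ideal_def by auto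
  have rev: "\<exists>x\<in>V. inverse x \<in> V \<and> x \<noteq> 0 \<and> poly p u = u ^ degree p * x"
    if p: "p \<in> polys_over K" "p \<noteq> 0" for p
  proof -
    define x where "x = poly (reflect_poly p) ?T"
    have e: "x = ?T ^ degree p * poly p u" unfolding x_def using u_nonzero by (subst poly_reflect_poly_nz) auto
    then have eq: "poly p u = u ^ degree p * x" using u_nonzero by (simp add: field_simps)
    have x0: "x \<noteq> 0" using e u_nonzero poly_u_eq_0[OF p(1)] p(2) by auto
    obtain c r where cr: "reflect_poly p = pCons c r" by (cases "reflect_poly p")
    have "pCons c r \<in> polys_over K" using polys_over_reflect[OF ringK p(1)] cr by simp
    then have crK: "c \<in> K" "r \<in> polys_over K" using polys_over_pCons[OF ringK] by auto
    have c: "c = lead_coeff p" using cr by (metis coeff_0_reflect_poly coeff_pCons_0)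
    have xe: "x = c + ?T * poly r ?T" by (simp add: x_def cr)
    have rO: "poly r ?T \<in> V" by (rule poly_in_subring[OF ringK crK(2) O(2,1) TO])
    have TrP: "?T * poly r ?T \<in> P" using P_mult(2)[OF P(2) rO] .
    have TrO: "?T * poly r ?T \<in> V" using TO rO by (intro subring_mult[OF O(1)])
    have xO: "x \<in> V" unfolding xe using crK O(2) TrO by (intro subring_add[OF O(1)]) auto
    have "inverse x \<in> V"
    proof (rule ccontr)
      assume "inverse x \<notin> V"
      then have "x \<in> P" using xO PO by (simp add: val_ideal_def)
      moreover have "- 1 \<in> V" using subring_uminus[OF O(1) subring_one[OF O(1)]] .
      then have "(- 1) * (?T * poly r ?T) \<in> P" using P_mult(1)[OF TrP] by blast
      ultimately have "x + (- 1) * (?T * poly r ?T) \<in> P" by (rule P_add)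
      then have "c \<in> P" by (simp add: xe)
      moreover have "c \<noteq> 0" using c p by simp
      moreover have "inverse c \<in> V" using crK O(2) subfield_inverse[OF subfieldK] by blast
      ultimately show False using PO by (simp add: val_ideal_def)
    qed
    then show ?thesis using xO x0 eq by blast
  qed
  have main: "\<exists>x\<in>V. a = ?T ^ nat (v1 a) * x" if a: "a \<in> L1" "a \<noteq> 0" "v1 a \<ge> 0" for a
  proof -
    obtain p s where h: "p \<in> polys_over K" "s \<in> polys_over K" "p \<noteq> 0" "s \<noteq> 0" "a = poly p u / poly s u"
      "poly p u \<noteq> 0" "poly s u \<noteq> 0" "v1 a = int (degree s) - int (degree p)" using a(1,2) by (rule v1_E)
    obtain x where x: "x \<in> V" "poly p u = u ^ degree p * x" using rev[OF h(1,3)] by blast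
    obtain y where y: "y \<noteq> 0" "inverse y \<in> V" "poly s u = u ^ degree s * y" using rev[OF h(2,4)] by blast
    have d: "degree s = degree p + nat (v1 a)" using h(8) a(3) by linarith
    have "a = (u ^ degree p * x) / (u ^ degree s * y)"
      unfolding x(2)[symmetric] y(3)[symmetric] by (rule h(5))
    also have "\<dots> = (u ^ degree p / u ^ degree s) * (x * inverse y)"
      by (simp add: divide_inverse mult_ac)
    also have "u ^ degree p / u ^ degree s = ?T ^ nat (v1 a)"
      unfolding d power_add using u_nonzero by (simp add: power_inverse divide_inverse)
    finally have "a = ?T ^ nat (v1 a) * (x * inverse y)" .
    moreover have "x * inverse y \<in> V" using x y by (intro subring_mult[OF O(1)])
    ultimately show ?thesis by blast
  qed
  have Tp: "?T ^ k \<in> V" for k using TO by (rule subring_power[OF O(1)])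
  show "vring L1 v1 \<subseteq> place_ring K L P"
  proof
    fix a assume a: "a \<in> vring L1 v1"
    show "a \<in> place_ring K L P"
    proof (cases "a = 0")
      case True then show ?thesis using subring_zero[OF O(1)] by (simp add: V_def)
    next
      case False
      then obtain x where "x \<in> V" "a = ?T ^ nat (v1 a) * x" using main[of a] a by (auto simp: vring_def vge_def)
      then show ?thesis using subring_mult[OF O(1) Tp] V_def by metis
    qed
  qed
  show "vplace L1 v1 \<subseteq> P"
  proof
    fix a assume a: "a \<in> vplace L1 v1"
    show "a \<in> P"
    proof (cases "a = 0")
      case True then show ?thesis using id by (simp add: is_ideal_def)
    next
      case False
      then have va: "v1 a \<ge> 1" using a by (auto simp: vplace_def vge_def)
      then obtain x where x: "x \<in> V" "a = ?T ^ nat (v1 a) * x" using main[of a] a False by (auto simp: vplace_def)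
      obtain k where k: "nat (v1 a) = Suc k" using va by (cases "nat (v1 a)") auto
      have "a = ?T * (?T ^ k * x)" using x(2) by (simp add: k mult_ac)
      moreover have "?T ^ k * x \<in> V" using subring_mult[OF O(1) Tp x(1)] .
      ultimately show ?thesis using P_mult(2)[OF P(2)] by metis
    qed
  qed
qed

sublocale one_place K L1 v1 R1
proof
  show "is_subring R1" "K \<subseteq> R1" "R1 \<subseteq> L1" by (fact subring_R1, fact K_R1, fact R1_L1)
  show "\<exists>b\<in>R1. b \<noteq> 0 \<and> b * a \<in> R1" if a: "a \<in> L1" for a
  proof -
    obtain p s where h: "p \<in> polys_over K" "s \<in> polys_over K" "s \<noteq> 0" "a = poly p u / poly s u" "poly s u \<noteq> 0"
      using a by (elim L1_E)
    then show ?thesis using R1_I by (intro bexI[of _ "poly s u"]) auto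
  qed
  show "v1 a \<le> 0" if a: "a \<in> R1" "a \<noteq> 0" for a
  proof -
    obtain p where p: "p \<in> polys_over K" "a = poly p u" using a(1) by (auto simp: R1_def)
    then have "p \<noteq> 0" using a(2) by auto
    then show ?thesis using v1_poly p by simp
  qed
  show "\<exists>c\<in>K. vge v1 1 (a - c)" if "a \<in> L1" "a \<noteq> 0" "v1 a = 0" for a
    using v1_residue[OF that] by blast
  show "R1 \<subseteq> place_ring K L1 P" if P: "is_place K L1 P" "P \<noteq> vplace L1 v1" for P
  proof -
    note O = valuation_ringD[OF place_valuation_ring[OF subL P(1)]]
    \<comment> \<open>At a pole of \<open>u\<close> the place ring would contain the valuation ring
      of \<open>v1\<close>, hence equal it by maximality.\<close>
    have "u \<in> place_ring K L1 P"
    proof (rule ccontr)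
      assume "u \<notin> place_ring K L1 P"
      moreover have "u \<in> L1" using u_R1 R1_L1 by blast
      ultimately have "inverse u \<in> val_ideal (place_ring K L1 P)"
        using O(6)[of u] by (simp add: val_ideal_def)
      then have "inverse u \<in> P" by (subst place_eq[OF subL P(1)])
      then have "vring L1 v1 \<subseteq> place_ring K L1 P"
        using place_containing_inverse_u(1)[OF subL order_refl P(1)] by blast
      then have "place_ring K L1 P = vring L1 v1"
        using vring_maximal[OF O(1)] O(3,5) by blast
      then have "val_ideal (place_ring K L1 P) = vplace L1 v1" using val_ideal_vring by simp
      then show False using P(2) place_eq[OF subL P(1)] by (metis (no_types))
    qed
    then show ?thesis using poly_in_subring[OF ringK _ O(2,1)] by (auto simp: R1_def)
  qed
qed

lemma the_zero_of_inverse_u: "the_zero_of K L1 (inverse u) = vplace L1 v1"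
  unfolding the_zero_of_def
proof (rule the_equality)
  have T: "inverse u \<in> L1" "inverse u \<noteq> 0" using u_R1 u_nonzero by auto
  show "is_place K L1 (vplace L1 v1) \<and> 0 < val K L1 (vplace L1 v1) (inverse u)"
    using is_place_vplace val_vplace[OF T] v1_inverse_u by simp
  fix P assume P: "is_place K L1 P \<and> 0 < val K L1 P (inverse u)"
  show "P = vplace L1 v1"
  proof (rule ccontr)
    assume "P \<noteq> vplace L1 v1"
    then have "vge (val K L1 P) 0 u" using val_R_nonneg[of P u] P u_R1 by blast
    moreover have "val K L1 P (inverse u) = - val K L1 P u"
      using P u_R1 u_nonzero by (intro dval.v_inverse[OF dval_place]) auto
    ultimately show False using P u_nonzero by (auto simp: vge_def)
  qed
qed

lemma reduced_fraction:
  assumes "w \<in> L1"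
  obtains p s a b where "p \<in> polys_over K" "s \<in> polys_over K" "a \<in> polys_over K" "b \<in> polys_over K"
    "s \<noteq> 0" "poly s u \<noteq> 0" "w = poly p u / poly s u" "a * p + b * s = 1"
proof -
  obtain p s where h: "p \<in> polys_over K" "s \<in> polys_over K" "s \<noteq> 0" "w = poly p u / poly s u" "poly s u \<noteq> 0"
    using assms by (elim L1_E)
  obtain d p' s' a b where e: "d \<in> polys_over K" "p' \<in> polys_over K" "s' \<in> polys_over K" "a \<in> polys_over K" "b \<in> polys_over K"
    "p = d * p'" "s = d * s'" "a * p' + b * s' = 1"
    using polys_over_bezout[OF subfieldK h(1,2)] by blast
  have "s' \<noteq> 0" "poly s' u \<noteq> 0" "poly d u \<noteq> 0" using h e by auto
  then show thesis using e h by (intro that[of p' s' a b]) auto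
qed

lemma R1_degree_0: "s \<in> polys_over K \<Longrightarrow> s \<noteq> 0 \<Longrightarrow> degree s = 0 \<Longrightarrow> p \<in> polys_over K \<Longrightarrow> poly p u / poly s u \<in> R1"
proof -
  assume h: "s \<in> polys_over K" "s \<noteq> 0" "degree s = 0" "p \<in> polys_over K"
  then obtain c where c: "s = [:c:]" by (metis degree_eq_zeroE)
  then have "c \<in> K" using h(1) polys_over_coeff[of s K 0] by simp
  then have "poly (smult (inverse c) p) u \<in> R1"
    using h(4) by (intro R1_I X_closed(7)) auto
  then show ?thesis by (simp add: c divide_inverse mult.commute)
qed

text \<open>If \<open>w = p(u)/s(u)\<close> with \<open>a p + b s = 1\<close>, then \<open>1/s(u) = a(u) w + b(u)\<close> is regular wherever
  \<open>w\<close> is, so \<open>s(u)\<close> has no zeros.\<close>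

lemma in_R1_if_regular:
  assumes L: "is_subfield L" "L1 \<subseteq> L" and w: "w \<in> L1"
    and reg: "\<And>P. is_place K L P \<Longrightarrow> R1 \<subseteq> place_ring K L P \<Longrightarrow> w \<in> place_ring K L P"
  shows "w \<in> R1"
proof -
  obtain p s a b where h: "p \<in> polys_over K" "s \<in> polys_over K" "a \<in> polys_over K" "b \<in> polys_over K"
    "s \<noteq> 0" "poly s u \<noteq> 0" "w = poly p u / poly s u" "a * p + b * s = 1"
    using w by (rule reduced_fraction)
  have inv: "inverse (poly s u) = poly a u * w + poly b u"
  proof -
    have "poly (a * p + b * s) u = 1" by (simp add: h(8))
    then show ?thesis using h(6) by (simp add: h(7) field_simps)
  qed
  have "degree s = 0"
  proof (rule ccontr)
    assume d: "degree s \<noteq> 0"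
    have "inverse (poly s u) \<notin> R1"
    proof
      assume "inverse (poly s u) \<in> R1"
      then obtain r where r: "r \<in> polys_over K" "inverse (poly s u) = poly r u" by (auto simp: R1_def)
      then have "poly (s * r) u = poly 1 u" using h(6) by (simp flip: r(2))
      then have "s * r = 1" using h r X_closed by (intro poly_u_inj) auto
      then show False using d by (metis degree_1 degree_mult_eq_0 mult_not_zero zero_neq_one)
    qed
    then obtain P where P: "is_place K L P" "R1 \<subseteq> place_ring K L P" "poly s u \<in> P"
      using exists_place_containing[OF subfieldK L(1) subring_R1 K_R1 _ R1_I[OF h(2)] h(6)] R1_L1 L(2) by blast
    note O = valuation_ringD[OF place_valuation_ring[OF L(1) P(1)]]
    have "poly a u \<in> place_ring K L P" "poly b u \<in> place_ring K L P" using P(2) R1_I h by auto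
    then have "inverse (poly s u) \<in> place_ring K L P"
      unfolding inv using reg[OF P(1,2)] by (intro subring_add[OF O(1)] subring_mult[OF O(1)])
    moreover have "poly s u \<in> val_ideal (place_ring K L P)" using P(3) by (subst (asm) place_eq[OF L(1) P(1)])
    ultimately show False using h(6) by (simp add: val_ideal_def)
  qed
  then show ?thesis using R1_degree_0 h by simp
qed

text \<open>Unique factorization enters only through the following statement. A polynomial with
  derivative \<open>1\<close> is squarefree, so a prime factor of the denominator of \<open>w\<close> would divide
  \<open>G ^ (N - 1)\<close> to a power of at least \<open>N\<close>.\<close>

lemma in_R1_if_power:
  assumes w: "w \<in> L1" and G: "pderiv G = 1" and E: "E \<in> polys_over K" "E dvd G ^ (N - 1)" and N: "N \<ge> 1"
    and wN: "poly E u * w ^ N \<in> R1"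
  shows "w \<in> R1"
proof -
  obtain p s a b where h: "p \<in> polys_over K" "s \<in> polys_over K" "a \<in> polys_over K" "b \<in> polys_over K"
    "s \<noteq> 0" "poly s u \<noteq> 0" "w = poly p u / poly s u" "a * p + b * s = 1"
    using w by (rule reduced_fraction)
  obtain D where D: "D \<in> polys_over K" "poly E u * w ^ N = poly D u" using wN by (auto simp: R1_def)
  have "poly (E * p ^ N) u = poly (D * s ^ N) u"
    using D(2) h(6) by (simp add: h(7) power_divide field_simps)
  then have "E * p ^ N = D * s ^ N" using E D h by (intro poly_u_inj X_closed(5,8))
  have "is_unit s"
  proof (rule ccontr)
    assume "\<not> is_unit s"
    then obtain \<pi> where pi: "prime_elem \<pi>" "\<pi> dvd s" using poly_prime_divisor h(5) by blast
    have "\<not> \<pi> dvd p"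
    proof
      assume "\<pi> dvd p"
      then have "\<pi> dvd a * p + b * s" using pi(2) by (intro dvd_add dvd_mult)
      then show False using h(8) pi(1) by (simp add: prime_elem_def)
    qed
    then have "\<not> \<pi> dvd p ^ N" using prime_elem_dvd_power[OF pi(1)] by blast
    moreover have "\<pi> ^ N dvd E * p ^ N"
      unfolding \<open>E * p ^ N = D * s ^ N\<close> using pi(2) by (intro dvd_mult dvd_power_same)
    ultimately have "\<pi> ^ N dvd E" using prime_elem_power_dvd_cancel[OF pi(1)] by blast
    then have "\<pi> ^ N dvd G ^ (N - 1)" using E(2) by (rule dvd_trans)
    moreover have "\<pi> dvd \<pi> ^ N" using N by (simp add: dvd_power)
    ultimately have "\<pi> dvd G" using prime_elem_dvd_power[OF pi(1)] dvd_trans by blast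
    then obtain H where H: "G = \<pi> * H" by (elim dvdE)
    \<comment> \<open>Cancelling \<open>\<pi> ^ (N - 1)\<close> leads to a second factor of the
      prime in \<open>G\<close>, so that it divides the derivative 1.\<close>
    have "\<pi> * \<pi> ^ (N - 1) dvd H ^ (N - 1) * \<pi> ^ (N - 1)"
      using \<open>\<pi> ^ N dvd G ^ (N - 1)\<close> N by (simp add: H power_mult_distrib mult.commute flip: power_Suc)
    moreover have "\<pi> ^ (N - 1) \<noteq> 0" using pi(1) by (simp add: prime_elem_def)
    ultimately have "\<pi> dvd H ^ (N - 1)" using dvd_mult_cancel_right by blast
    then have "\<pi> dvd H" using prime_elem_dvd_power[OF pi(1)] by blast
    then have "\<pi> dvd \<pi> * pderiv H + H * pderiv \<pi>" by simp
    then have "\<pi> dvd 1" using G by (simp add: H pderiv_mult)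
    then show False using pi(1) by (simp add: prime_elem_def)
  qed
  then have "degree s = 0" by (simp add: is_unit_iff_degree[OF h(5)])
  then show ?thesis using R1_degree_0 h by simp
qed

end

subsection \<open>Kummer extensions totally ramified at the distinguished place\<close>

lemma card_roots_of_unity_le:
  assumes "d > 0"
  shows "finite {x::'a::field. x ^ d = 1}" "card {x::'a::field. x ^ d = 1} \<le> d"
proof -
  define p where "p = monom (1::'a) d - 1"
  have "coeff p d = 1" using assms by (simp add: p_def coeff_1)
  then have p0: "p \<noteq> 0" by auto
  have "degree p \<le> d" unfolding p_def using degree_diff_le_max[of "monom (1::'a) d" 1] degree_monom_le[of "1::'a" d] by simp
  moreover have "{x. x ^ d = 1} = {x. poly p x = 0}" by (auto simp: p_def poly_monom)
  ultimately show "finite {x::'a. x ^ d = 1}" "card {x::'a. x ^ d = 1} \<le> d"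
    using poly_roots_finite[OF p0] card_poly_roots_bound[OF p0] by auto
qed

text \<open>\<open>v1_g\<close> is the Eisenstein condition that forces total ramification,
  \<open>generated\<close> makes the whole type the function field, and \<open>roots_card\<close>
  and \<open>N_nz\<close> permit averaging over the \<open>N\<close>-th roots of unity.\<close>

locale kummer = ratfun K u for K :: "'a::field set" and u :: 'a +
  fixes y g :: 'a and N :: nat
  assumes N_pos: "N > 0" and g_L1: "g \<in> L1" and g_nz: "g \<noteq> 0" and v1_g: "v1 g = 1"
    and y_power: "y ^ N = g" and generated: "adjoin K {u, y} = UNIV"
    and roots_card: "card {\<zeta>\<in>K. \<zeta> ^ N = 1} = N" and N_nz: "of_nat N \<noteq> (0::'a)"
begin

section \<open>Expansions in powers of \<open>y\<close> over K(u)\<close>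

lemma y_nz: "y \<noteq> 0"
  using y_power g_nz N_pos by auto

definition span_y :: "'a set \<Rightarrow> 'a set" where
  "span_y C = {\<Sum>i<N. a i * y ^ i | a. \<forall>i<N. a i \<in> C}"

text \<open>The coefficients of z times an expansion in z, reduced by z^N = g. They do not depend on
  the choice of the root z, so the same rule holds for \<open>y\<close> and its conjugates.\<close>

definition shift :: "(nat \<Rightarrow> 'a) \<Rightarrow> nat \<Rightarrow> 'a" where
  "shift a i = (if i = 0 then a (N - 1) * g else a (i - 1))"

lemma shift_sum:
  assumes "z ^ N = g"
  shows "z * (\<Sum>i<N. a i * z ^ i) = (\<Sum>i<N. shift a i * z ^ i)"
proof -
  obtain M where M: "N = Suc M" using N_pos by (cases N) auto
  have "(\<Sum>i<N. shift a i * z ^ i) = shift a 0 * z ^ 0 + (\<Sum>i<M. shift a (Suc i) * z ^ Suc i)"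
    by (rule sum.lessThan_Suc_shift[of "\<lambda>i. shift a i * z ^ i" M, folded M])
  also have "\<dots> = a M * g + (\<Sum>i<M. a i * z ^ Suc i)"
  proof -
    have NM: "N - 1 = M" using M by simp
    have "shift a 0 = a M * g" "\<And>i. shift a (Suc i) = a i" unfolding shift_def NM by simp_all
    then show ?thesis by (simp only: power_0 mult_1_right)
  qed
  also have "a M * g = a M * z ^ N" using assms by simp
  also have "a M * z ^ N + (\<Sum>i<M. a i * z ^ Suc i) = (\<Sum>i<N. a i * z ^ Suc i)"
    unfolding sum.lessThan_Suc[of "\<lambda>i. a i * z ^ Suc i" M, folded M] by (rule add.commute)
  finally show ?thesis by (simp add: sum_distrib_left mult_ac)
qed

lemma shift_closed:
  assumes "is_subring C" "g \<in> C" "\<forall>i<N. a i \<in> C"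
  shows "\<forall>i<N. shift a i \<in> C"
  using assms N_pos by (auto simp: shift_def intro: subring_mult)

lemma span_y_I: "\<forall>i<N. a i \<in> C \<Longrightarrow> (\<Sum>i<N. a i * y ^ i) \<in> span_y C"
  by (auto simp: span_y_def)

lemma span_y_E:
  assumes "f \<in> span_y C"
  obtains a where "\<forall>i<N. a i \<in> C" "f = (\<Sum>i<N. a i * y ^ i)"
  using assms by (auto simp: span_y_def)

context
  fixes C assumes C: "is_subring C" "g \<in> C"
begin

lemma span_y_const:
  assumes "c \<in> C"
  shows "c \<in> span_y C"
proof -
  have "(\<Sum>i<N. (if i = 0 then c else 0) * y ^ i) \<in> span_y C"
    using assms subring_zero[OF C(1)] by (intro span_y_I) auto
  moreover have "(\<Sum>i<N. (if i = 0 then c else 0) * y ^ i) = (\<Sum>i<N. if i = 0 then c else 0)"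
    by (intro sum.cong) auto
  ultimately show ?thesis using N_pos by simp
qed

lemma span_y_add:
  assumes "f \<in> span_y C" "h \<in> span_y C"
  shows "f + h \<in> span_y C"
proof -
  obtain a b where "\<forall>i<N. a i \<in> C" "f = (\<Sum>i<N. a i * y ^ i)" "\<forall>i<N. b i \<in> C" "h = (\<Sum>i<N. b i * y ^ i)"
    using assms by (elim span_y_E)
  moreover have "(\<Sum>i<N. (a i + b i) * y ^ i) = (\<Sum>i<N. a i * y ^ i) + (\<Sum>i<N. b i * y ^ i)"
    by (simp add: distrib_right sum.distrib)
  ultimately show ?thesis
    using span_y_I[of "\<lambda>i. a i + b i" C] subring_add[OF C(1)] by metis
qed

lemma span_y_scale:
  assumes "c \<in> C" "f \<in> span_y C"
  shows "c * f \<in> span_y C"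
proof -
  obtain a where a: "\<forall>i<N. a i \<in> C" "f = (\<Sum>i<N. a i * y ^ i)" using assms(2) by (rule span_y_E)
  have "(\<Sum>i<N. (c * a i) * y ^ i) = c * f" by (simp add: a sum_distrib_left mult_ac)
  moreover have "\<forall>i<N. c * a i \<in> C" using a assms subring_mult[OF C(1)] by blast
  ultimately show ?thesis using span_y_I by metis
qed

lemma span_y_y:
  assumes "f \<in> span_y C"
  shows "y * f \<in> span_y C"
proof -
  obtain a where a: "\<forall>i<N. a i \<in> C" "f = (\<Sum>i<N. a i * y ^ i)" using assms by (rule span_y_E)
  show ?thesis unfolding a(2) shift_sum[OF y_power]
    by (rule span_y_I[OF shift_closed[OF C a(1)]])
qed

lemma span_y_power:
  assumes "f \<in> span_y C"
  shows "y ^ k * f \<in> span_y C"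
proof (induction k)
  case (Suc k)
  then show ?case using span_y_y[OF Suc] by (simp add: mult_ac)
qed (use assms in simp)

lemma span_y_zero: "0 \<in> span_y C"
  using span_y_const[OF subring_zero[OF C(1)]] .

lemma span_y_sum: "(\<And>i. i \<in> I \<Longrightarrow> h i \<in> span_y C) \<Longrightarrow> sum h I \<in> span_y C"
  by (induction I rule: infinite_finite_induct) (auto intro: span_y_zero span_y_add)

lemma span_y_mult:
  assumes "f \<in> span_y C" "h \<in> span_y C"
  shows "f * h \<in> span_y C"
proof -
  obtain a where a: "\<forall>i<N. a i \<in> C" "f = (\<Sum>i<N. a i * y ^ i)" using assms(1) by (rule span_y_E)
  have "f * h = (\<Sum>i<N. a i * (y ^ i * h))" unfolding a(2) sum_distrib_right by (simp only: mult.assoc)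
  also have "\<dots> \<in> span_y C" using a(1) assms(2) by (intro span_y_sum span_y_scale span_y_power) auto
  finally show ?thesis .
qed

lemma subring_span_y: "is_subring (span_y C)"
proof -
  have m1: "- 1 \<in> C" by (rule subring_uminus[OF C(1) subring_one[OF C(1)]])
  have "f - h \<in> span_y C" if "f \<in> span_y C" "h \<in> span_y C" for f h
    using span_y_add[OF that(1) span_y_scale[OF m1 that(2)]] by simp
  then show ?thesis
    using span_y_zero span_y_const[OF subring_one[OF C(1)]] span_y_add span_y_mult
    by (simp add: is_subring_def)
qed

end

text \<open>The powers of \<open>f\<close> with exponents 0 to \<open>N\<close> lie in the span of
  \<open>N\<close> elements over K(u) and are therefore dependent. Dividing a relation by its lowest
  power of \<open>f\<close> yields the inverse of \<open>f\<close>, so the span is a field.\<close>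

lemma span_y_L1: "span_y L1 = UNIV"
proof -
  note C = subringL g_L1
  have "inverse f \<in> span_y L1" if f: "f \<in> span_y L1" "f \<noteq> 0" for f
  proof -
    define B where "B = (\<lambda>i. y ^ i) ` {..<N}"
    have "\<exists>d. (\<forall>i\<in>{..N}. d i \<in> L1) \<and> (\<exists>i\<in>{..N}. d i \<noteq> 0) \<and> (\<Sum>i\<in>{..N}. d i * f ^ i) \<in> {0}"
    proof (rule steinitz_mod[OF subL subspace_zero, of B])
      show "finite B" by (simp add: B_def)
      show "card B < card {..N}" using card_image_le[of "{..<N}" "\<lambda>i. y ^ i"] by (simp add: B_def)
      fix k
      have "f ^ k \<in> span_y L1" using f by (intro subring_power subring_span_y C)
      then obtain a where a: "\<forall>i<N. a i \<in> L1" "f ^ k = (\<Sum>i<N. a i * y ^ i)" by (rule span_y_E)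
      \<comment> \<open>Powers of \<open>y\<close> with different exponents are not yet known to
        differ, so the coefficients of equal ones are added up.\<close>
      define c where "c b = (\<Sum>i | i \<in> {..<N} \<and> y ^ i = b. a i)" for b
      have "f ^ k = (\<Sum>b\<in>B. \<Sum>i | i \<in> {..<N} \<and> y ^ i = b. a i * y ^ i)"
        unfolding a(2) B_def by (rule sum.image_gen) simp
      also have "\<dots> = (\<Sum>b\<in>B. c b * b)"
        unfolding c_def sum_distrib_right by (intro sum.cong) auto
      finally have "f ^ k - (\<Sum>b\<in>B. c b * b) \<in> {0}" by simp
      moreover have "\<forall>b\<in>B. c b \<in> L1" unfolding c_def using a(1) by (auto intro!: subring_sum[OF subringL])
      ultimately show "\<exists>c. (\<forall>b\<in>B. c b \<in> L1) \<and> f ^ k - (\<Sum>b\<in>B. c b * b) \<in> {0}" by blast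
    qed simp
    then obtain d where dL: "\<forall>i\<in>{..N}. d i \<in> L1" and dn: "\<exists>i\<in>{..N}. d i \<noteq> 0"
      and ds: "(\<Sum>i\<in>{..N}. d i * f ^ i) \<in> {0}" by (elim exE conjE)
    have ds0: "(\<Sum>i\<in>{..N}. d i * f ^ i) = 0" using ds by simp
    define k where "k = (LEAST i. d i \<noteq> 0)"
    have ex: "\<exists>i. d i \<noteq> 0" using dn by blast
    then have dk: "d k \<noteq> 0" unfolding k_def by (rule LeastI_ex)
    have less: "d i = 0" if "i < k" for i using not_less_Least[of i "\<lambda>i. d i \<noteq> 0"] that by (simp add: k_def)
    have kN: "k \<le> N" using dn less by (meson atMost_iff le_trans not_le)
    have "k < Suc N" using kN by simp
    then have "(\<Sum>i\<le>N. d i * f ^ i) = f ^ k * (d k + f * (\<Sum>i\<in>{k<..<Suc N}. d i * f ^ (i - k - 1)))"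
      unfolding lessThan_Suc_atMost[symmetric] by (rule sum_power_split_least) (rule less)
    then have "f ^ k * (d k + f * (\<Sum>i\<in>{k<..<Suc N}. d i * f ^ (i - k - 1))) = 0"
      using ds0 by (simp add: algebra_simps)
    then have "d k + f * (\<Sum>i\<in>{k<..<Suc N}. d i * f ^ (i - k - 1)) = 0" using f by simp
    then have "f * (\<Sum>i\<in>{k<..<Suc N}. d i * f ^ (i - k - 1)) = - d k"
      by (simp add: add_eq_0_iff)
    then have "(- inverse (d k)) * (f * (\<Sum>i\<in>{k<..<Suc N}. d i * f ^ (i - k - 1))) = 1"
      using dk by simp
    then have "f * ((- inverse (d k)) * (\<Sum>i\<in>{k<..<Suc N}. d i * f ^ (i - k - 1))) = 1"
      by (simp only: mult.left_commute[of f])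
    then have "inverse f = (- inverse (d k)) * (\<Sum>i\<in>{k<..<Suc N}. d i * f ^ (i - k - 1))"
      by (rule inverse_unique)
    also have "\<dots> \<in> span_y L1"
      using dL kN f(1)
      by (intro span_y_scale[OF C] span_y_sum[OF C] subring_power[OF subring_span_y[OF C]] f(1)) auto
    finally show ?thesis .
  qed
  moreover have "inverse 0 \<in> span_y L1" using span_y_zero[OF C] by simp
  ultimately have "is_subfield (span_y L1)"
    unfolding is_subfield_def using subring_span_y[OF C] by metis
  moreover have "K \<union> {u, y} \<subseteq> span_y L1"
  proof -
    have "y * 1 \<in> span_y L1" by (intro span_y_y[OF C] span_y_const[OF C]) simp
    moreover have "u \<in> L1" using u_R1 by simp
    ultimately show ?thesis using span_y_const[OF C] by auto
  qed
  ultimately have "adjoin K {u, y} \<subseteq> span_y L1" by (rule adjoin_least)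
  then show ?thesis using generated by blast
qed

section \<open>The ring generated by \<open>y\<close> over the valuation ring of \<open>v1\<close>,
  later seen to be the valuation ring at \<open>Q\<close>\<close>

definition AA :: "'a set" where
  "AA = span_y (vring L1 v1)"

lemma O1: "is_subring (vring L1 v1)" "g \<in> vring L1 v1"
  using subring_vring g_L1 v1_g by (auto simp: vring_def vge_def)

lemma subring_AA: "is_subring AA"
  unfolding AA_def by (rule subring_span_y[OF O1])

lemma AA_y: "f \<in> AA \<Longrightarrow> y * f \<in> AA" and AA_const: "c \<in> vring L1 v1 \<Longrightarrow> c \<in> AA"
  and AA_scale: "c \<in> vring L1 v1 \<Longrightarrow> f \<in> AA \<Longrightarrow> c * f \<in> AA" and AA_power: "f \<in> AA \<Longrightarrow> y ^ k * f \<in> AA"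
  unfolding AA_def by (fact span_y_y[OF O1] span_y_const[OF O1] span_y_scale[OF O1] span_y_power[OF O1])+

lemma K_vring: "K \<subseteq> vring L1 v1"
  by (auto simp: vring_def vge_const)

text \<open>Nakayama's lemma: if \<open>y\<close> were a unit of \<open>AA\<close>, then \<open>AA = g AA\<close>, and the generators
  \<open>1, y, \<dots>, y^(N-1)\<close> could be eliminated one after the other.\<close>

lemma one_notin_y_AA:
  assumes b: "b \<in> AA"
  shows "y * b \<noteq> 1"
proof
  assume yb: "y * b = 1"
  have step: "\<exists>c. (\<forall>j. c j \<in> vring L1 v1) \<and> y ^ i = g * (\<Sum>j<N - r. c j * y ^ j)" if "r \<le> N" for r i
    using that
  proof (induction r arbitrary: i)
    case 0
    have "b ^ N * y ^ i \<in> AA"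
      using AA_power[OF subring_power[OF subring_AA b]] by (simp add: mult.commute)
    then obtain c where c: "\<forall>i<N. c i \<in> vring L1 v1" "b ^ N * y ^ i = (\<Sum>i<N. c i * y ^ i)"
      unfolding AA_def by (rule span_y_E)
    have "g * b ^ N = 1" using yb by (simp flip: y_power power_mult_distrib)
    then have "y ^ i = g * (b ^ N * y ^ i)" by (simp add: mult.assoc[symmetric])
    also have "\<dots> = g * (\<Sum>j<N. (if j < N then c j else 0) * y ^ j)" by (simp add: c(2))
    finally show ?case using c(1) subring_zero[OF O1(1)]
      by (intro exI[of _ "\<lambda>j. if j < N then c j else 0"]) auto
  next
    case (Suc r)
    define s where "s = N - Suc r"
    have s: "N - r = Suc s" using Suc(2) by (simp add: s_def)
    have IH: "\<exists>c. (\<forall>j. c j \<in> vring L1 v1) \<and> y ^ i = g * (\<Sum>j<Suc s. c j * y ^ j)" for i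
      using Suc(1)[of i] Suc(2) s by simp
    obtain c where c: "\<forall>j. c j \<in> vring L1 v1" "y ^ s = g * (\<Sum>j<Suc s. c j * y ^ j)" using IH by blast
    obtain d where d: "\<forall>j. d j \<in> vring L1 v1" "y ^ i = g * (\<Sum>j<Suc s. d j * y ^ j)" using IH by blast
    \<comment> \<open>\<open>g * c s\<close> has positive value, so \<open>e\<close> is a unit and
      the relation can be solved for \<open>y ^ s\<close> in terms of lower powers.\<close>
    define e where "e = 1 - g * c s"
    have gc: "g * c s \<in> L1" "vge v1 1 (g * c s)"
      using c(1) g_L1 vge_mult[of g "c s" 1 0] v1_g by (auto simp: vring_def vge_def)
    then have "vge v1 (v1 1 + 1) (- (g * c s))" using vge_minus by simp
    from v_add_eq[OF _ _ _ this] have e0: "e \<noteq> 0" "v1 e = 0" using gc by (auto simp: e_def)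
    have eL: "e \<in> L1" using gc by (simp add: e_def)
    have ei: "inverse e \<in> vring L1 v1" using e0 eL by (simp add: vring_def vge_def v_inverse)
    have "e * y ^ s = g * (\<Sum>j<s. c j * y ^ j)"
      using c(2) by (simp add: e_def algebra_simps)
    then have ys: "y ^ s = inverse e * (g * (\<Sum>j<s. c j * y ^ j))" using e0 by (simp add: field_simps)
    define c' where "c' j = d j + d s * inverse e * g * c j" for j
    have "y ^ i = g * ((\<Sum>j<s. d j * y ^ j) + d s * y ^ s)" using d(2) by simp
    also have "d s * y ^ s = (\<Sum>j<s. (d s * inverse e * g * c j) * y ^ j)"
      unfolding ys by (simp add: sum_distrib_left mult_ac)
    also have "(\<Sum>j<s. d j * y ^ j) + \<dots> = (\<Sum>j<s. c' j * y ^ j)"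
      by (simp add: c'_def distrib_right sum.distrib)
    finally have "y ^ i = g * (\<Sum>j<N - Suc r. c' j * y ^ j)" by (simp add: s_def)
    moreover have "\<forall>j. c' j \<in> vring L1 v1"
      unfolding c'_def using c d ei O1 by (auto intro!: subring_add[OF O1(1)] subring_mult[OF O1(1)])
    ultimately show ?case by blast
  qed
  \<comment> \<open>With all generators eliminated the sum is empty, and \<open>y ^ 0\<close> would
    vanish.\<close>
  from step[of N 0] show False by simp
qed

text \<open>The elements whose residue modulo y AA is a nonzero constant. Every nonzero function
  turns out to be a power of \<open>y\<close> times one of them, and the exponent is its valuation
  at \<open>Q\<close>.\<close>

definition UU :: "'a set" where
  "UU = {c + y * b | c b. c \<in> K \<and> c \<noteq> 0 \<and> b \<in> AA}"

lemma UU_AA: "w \<in> UU \<Longrightarrow> w \<in> AA"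
proof -
  assume "w \<in> UU"
  then obtain c b where "c \<in> K" "b \<in> AA" "w = c + y * b" by (auto simp: UU_def)
  then show ?thesis using K_vring AA_const[of c] AA_y[of b] subring_add[OF subring_AA] by blast
qed

lemma UU_add: "w \<in> UU \<Longrightarrow> b \<in> AA \<Longrightarrow> w + y * b \<in> UU"
proof -
  assume "w \<in> UU" "b \<in> AA"
  then obtain c a where h: "c \<in> K" "c \<noteq> 0" "a \<in> AA" "w = c + y * a" by (auto simp: UU_def)
  have "w + y * b = c + y * (a + b)" by (simp add: h algebra_simps)
  then show ?thesis unfolding UU_def using h subring_add[OF subring_AA h(3) \<open>b \<in> AA\<close>] by blast
qed

lemma UU_mult: "w \<in> UU \<Longrightarrow> w' \<in> UU \<Longrightarrow> w * w' \<in> UU"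
proof -
  assume "w \<in> UU" and w': "w' \<in> UU"
  then obtain c a where h: "c \<in> K" "c \<noteq> 0" "a \<in> AA" "w = c + y * a" by (auto simp: UU_def)
  obtain c' a' where h': "c' \<in> K" "c' \<noteq> 0" "a' \<in> AA" "w' = c' + y * a'" using w' by (auto simp: UU_def)
  have e: "w * w' = c * c' + y * (c * a' + a * w')" by (simp add: h h' algebra_simps)
  have "c * a' + a * w' \<in> AA"
    using h h' UU_AA[OF w'] K_vring
    by (intro subring_add[OF subring_AA] AA_scale subring_mult[OF subring_AA]) auto
  then show ?thesis unfolding UU_def e using h h' by (intro CollectI exI[of _ "c * c'"] exI[of _ "c * a' + a * w'"]) auto
qed

lemma UU_notin_y_AA:
  assumes "b \<in> AA"
  shows "y * b \<notin> UU"
proof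
  assume "y * b \<in> UU"
  then obtain c a where h: "c \<in> K" "c \<noteq> 0" "a \<in> AA" "y * b = c + y * a" by (auto simp: UU_def)
  have "y * (inverse c * (b - a)) = inverse c * (y * b - y * a)" by (simp add: algebra_simps)
  also have "\<dots> = 1" using h by simp
  finally have "y * (inverse c * (b - a)) = 1" .
  moreover have "inverse c * (b - a) \<in> AA"
    using h assms K_vring by (intro AA_scale subring_diff[OF subring_AA]) auto
  ultimately show False using one_notin_y_AA by blast
qed

lemma zero_notin_UU: "0 \<notin> UU"
  using UU_notin_y_AA[OF subring_zero[OF subring_AA]] by simp

lemma K_UU: "c \<in> K \<Longrightarrow> c \<noteq> 0 \<Longrightarrow> c \<in> UU"
  unfolding UU_def using subring_zero[OF subring_AA] by (intro CollectI exI[of _ c] exI[of _ 0]) simp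

lemma y_power_int_UU_unique:
  assumes "y powi k * w = y powi l * w'" "w \<in> UU" "w' \<in> UU"
  shows "k = l"
proof -
  have False if h: "y powi k * w = y powi l * w'" "w \<in> UU" "w' \<in> UU" "k < l" for k l w w'
  proof -
    define m where "m = nat (l - k - 1)"
    have "l = k + (1 + int m)" using h(4) by (simp add: m_def)
    then have "y powi l = y powi k * (y * y ^ m)" using y_nz by (simp add: power_int_add)
    then have "y powi k * w = y powi k * (y * (y ^ m * w'))" using h(1) by (simp add: mult_ac)
    then have "w = y * (y ^ m * w')" using y_nz by simp
    then show False using UU_notin_y_AA[OF AA_power[OF UU_AA[OF h(3)]]] h(2) by metis
  qed
  from this[of k w l w'] this[of l w' k w] assms show ?thesis by (metis linorder_neqE)
qed

text \<open>After a power of g = y^N is split off, the coefficient has value 0. It then differs from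
  a nonzero constant by a multiple of \<open>g\<close>, and so of \<open>y\<close>.\<close>

lemma monomial_UU:
  assumes a: "a \<in> L1" "a \<noteq> 0"
  shows "\<exists>w\<in>UU. a * y ^ i = y powi (int N * v1 a + int i) * w"
proof -
  define w where "w = a * g powi (- v1 a)"
  have w: "w \<in> L1" "w \<noteq> 0" "v1 w = 0"
    using a g_L1 g_nz v1_g by (simp_all add: w_def v_mult v_power_int)
  obtain c where c: "c \<in> K" "c \<noteq> 0" "vge v1 1 (w - c)" using v1_residue[OF w] by blast
  define b where "b = (w - c) / g"
  have "b \<in> vring L1 v1"
    using c w g_L1 g_nz v1_g by (cases "w - c = 0") (auto simp: b_def vring_def vge_def v_divide)
  moreover have "w = c + y * (y ^ (N - 1) * b)"
  proof -
    have "y * (y ^ (N - 1) * b) = y ^ Suc (N - 1) * b" by (simp add: mult.assoc)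
    also have "\<dots> = g * b" using y_power N_pos by simp
    finally show ?thesis using g_nz by (simp add: b_def)
  qed
  ultimately have "w \<in> UU" unfolding UU_def using c AA_power[OF AA_const] by blast
  moreover have "a * y ^ i = y powi (int N * v1 a + int i) * w"
  proof -
    have "y powi (int N * v1 a) = g powi v1 a" by (simp add: power_int_mult y_power)
    then show ?thesis using y_nz g_nz by (simp add: w_def power_int_add power_int_minus)
  qed
  ultimately show ?thesis by blast
qed

text \<open>The exponents N v1(a_i) + i are distinct modulo \<open>N\<close>, so the minimum is
  attained only once and every other term is a multiple of \<open>y\<close> relative to it.\<close>

lemma expansion_UU:
  assumes a: "\<forall>i<N. a i \<in> L1" and i0: "i0 < N" "a i0 \<noteq> 0"
    and min: "\<And>i. i < N \<Longrightarrow> a i \<noteq> 0 \<Longrightarrow> int N * v1 (a i0) + int i0 \<le> int N * v1 (a i) + int i"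
  shows "\<exists>w\<in>UU. (\<Sum>i<N. a i * y ^ i) = y powi (int N * v1 (a i0) + int i0) * w"
proof -
  define k where "k = int N * v1 (a i0) + int i0"
  have rest: "\<exists>b\<in>AA. a i * y ^ i = y powi k * (y * b)" if i: "i < N" "i \<noteq> i0" for i
  proof (cases "a i = 0")
    case True
    then show ?thesis using subring_zero[OF subring_AA] by (intro bexI[of _ 0]) auto
  next
    case False
    obtain w where w: "w \<in> UU" "a i * y ^ i = y powi (int N * v1 (a i) + int i) * w"
      using monomial_UU[of "a i" i] a i False by blast
    have "int N * v1 (a i) + int i \<noteq> k"
    proof
      assume "int N * v1 (a i) + int i = k"
      then have "(int i + int N * v1 (a i)) mod int N = (int i0 + int N * v1 (a i0)) mod int N"
        by (simp add: k_def add.commute)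
      then have "int i mod int N = int i0 mod int N" by simp
      then show False using i i0 by simp
    qed
    then have "k < int N * v1 (a i) + int i" using min[OF i(1) False] by (simp add: k_def)
    moreover define m where "m = nat (int N * v1 (a i) + int i - k - 1)"
    ultimately have e: "int N * v1 (a i) + int i = k + (1 + int m)" by simp
    have "a i * y ^ i = y powi k * (y * (y ^ m * w))"
      unfolding w(2) e using y_nz by (simp add: power_int_add mult_ac)
    then show ?thesis using AA_power[OF UU_AA[OF w(1)]] by blast
  qed
  then obtain b where b: "\<And>i. i < N \<Longrightarrow> i \<noteq> i0 \<Longrightarrow> b i \<in> AA \<and> a i * y ^ i = y powi k * (y * b i)" by metis
  obtain w where w: "w \<in> UU" "a i0 * y ^ i0 = y powi k * w"
    using monomial_UU[of "a i0" i0] a i0 by (auto simp: k_def)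
  have "(\<Sum>i<N. a i * y ^ i) = a i0 * y ^ i0 + (\<Sum>i\<in>{..<N} - {i0}. a i * y ^ i)"
    using i0 by (simp add: sum.remove)
  also have "(\<Sum>i\<in>{..<N} - {i0}. a i * y ^ i) = (\<Sum>i\<in>{..<N} - {i0}. y powi k * (y * b i))"
    using b by (intro sum.cong) auto
  also have "a i0 * y ^ i0 + \<dots> = y powi k * (w + y * (\<Sum>i\<in>{..<N} - {i0}. b i))"
    unfolding w(2) by (simp add: sum_distrib_left distrib_left)
  finally have "(\<Sum>i<N. a i * y ^ i) = y powi k * (w + y * (\<Sum>i\<in>{..<N} - {i0}. b i))" .
  moreover have "w + y * (\<Sum>i\<in>{..<N} - {i0}. b i) \<in> UU"
    using b by (intro UU_add w(1) subring_sum[OF subring_AA]) auto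
  ultimately show ?thesis unfolding k_def by blast
qed

lemma exists_min_term:
  assumes "i1 < N" "a i1 \<noteq> (0::'a)"
  shows "\<exists>i0<N. a i0 \<noteq> 0 \<and>
    (\<forall>i<N. a i \<noteq> 0 \<longrightarrow> int N * v1 (a i0) + int i0 \<le> int N * v1 (a i) + int i)"
proof -
  define S where "S = (\<lambda>i. int N * v1 (a i) + int i) ` {i. i < N \<and> a i \<noteq> 0}"
  have "finite S" "S \<noteq> {}" using assms by (auto simp: S_def)
  then have S: "Min S \<in> S" "\<And>x. x \<in> S \<Longrightarrow> Min S \<le> x" by auto
  obtain i0 where i0: "i0 < N" "a i0 \<noteq> 0" "Min S = int N * v1 (a i0) + int i0"
    using S(1) unfolding S_def by auto
  have "int N * v1 (a i0) + int i0 \<le> int N * v1 (a i) + int i" if "i < N" "a i \<noteq> 0" for i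
    unfolding i0(3)[symmetric] using that by (intro S(2)) (auto simp: S_def)
  with i0 show ?thesis by blast
qed

lemma coeffs_unique_0:
  assumes a: "\<forall>i<N. a i \<in> L1" and "(\<Sum>i<N. a i * y ^ i) = 0"
  shows "\<forall>i<N. a i = 0"
proof (rule ccontr)
  assume "\<not> ?thesis"
  then obtain i1 where "i1 < N" "a i1 \<noteq> 0" by blast
  then obtain i0 where "i0 < N" "a i0 \<noteq> 0"
      "\<forall>i<N. a i \<noteq> 0 \<longrightarrow> int N * v1 (a i0) + int i0 \<le> int N * v1 (a i) + int i"
    using exists_min_term by blast
  then obtain w where "w \<in> UU" "(\<Sum>i<N. a i * y ^ i) = y powi (int N * v1 (a i0) + int i0) * w"
    using expansion_UU[OF a] by blast
  then show False using assms(2) zero_notin_UU y_nz by auto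
qed

section \<open>The valuation at \<open>Q\<close>\<close>

definition vv :: "'a \<Rightarrow> int" where
  "vv f = (THE k. \<exists>w\<in>UU. f = y powi k * w)"

lemma vv_eq: "w \<in> UU \<Longrightarrow> vv (y powi k * w) = k"
  unfolding vv_def
proof (rule the_equality)
  assume w: "w \<in> UU"
  then show "\<exists>w'\<in>UU. y powi k * w = y powi k * w'" by blast
  show "l = k" if "\<exists>w'\<in>UU. y powi k * w = y powi l * w'" for l
    using that w y_power_int_UU_unique by blast
qed

lemma vv_sum:
  assumes a: "\<forall>i<N. a i \<in> L1" and i0: "i0 < N" "a i0 \<noteq> 0"
    and min: "\<And>i. i < N \<Longrightarrow> a i \<noteq> 0 \<Longrightarrow> int N * v1 (a i0) + int i0 \<le> int N * v1 (a i) + int i"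
  shows "vv (\<Sum>i<N. a i * y ^ i) = int N * v1 (a i0) + int i0"
proof -
  obtain w where "w \<in> UU" "(\<Sum>i<N. a i * y ^ i) = y powi (int N * v1 (a i0) + int i0) * w"
    using expansion_UU[OF assms] by blast
  then show ?thesis using vv_eq by simp
qed

lemma vv_monomial: "a \<in> L1 \<Longrightarrow> a \<noteq> 0 \<Longrightarrow> vv (a * y ^ i) = int N * v1 a + int i"
  using monomial_UU[of a i] vv_eq by auto

lemma vv_L1: "a \<in> L1 \<Longrightarrow> a \<noteq> 0 \<Longrightarrow> vv a = int N * v1 a"
  using vv_monomial[of a 0] by simp

lemma coeffs_exist: obtains a where "\<forall>i<N. a i \<in> L1" "f = (\<Sum>i<N. a i * y ^ i)"
  using span_y_L1 span_y_E[of f L1] by blast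

lemma vv_rep: "f \<noteq> 0 \<Longrightarrow> \<exists>w\<in>UU. f = y powi (vv f) * w"
proof -
  assume f: "f \<noteq> 0"
  obtain a where a: "\<forall>i<N. a i \<in> L1" "f = (\<Sum>i<N. a i * y ^ i)" by (rule coeffs_exist)
  have "\<exists>i1<N. a i1 \<noteq> 0"
  proof (rule ccontr)
    assume "\<not> ?thesis"
    then show False using f a(2) by simp
  qed
  then obtain i0 where "i0 < N" "a i0 \<noteq> 0"
      "\<forall>i<N. a i \<noteq> 0 \<longrightarrow> int N * v1 (a i0) + int i0 \<le> int N * v1 (a i) + int i"
    using exists_min_term by blast
  then obtain w where w: "w \<in> UU" "f = y powi (int N * v1 (a i0) + int i0) * w"
    using expansion_UU[OF a(1)] a(2) by blast
  with vv_eq[OF w(1)] show ?thesis by auto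
qed

lemma AA_vv_nonneg:
  assumes "f \<in> AA" "f \<noteq> 0"
  shows "vv f \<ge> 0"
proof (rule ccontr)
  assume neg: "\<not> vv f \<ge> 0"
  obtain w where w: "w \<in> UU" "f = y powi (vv f) * w" using vv_rep assms by blast
  define m where "m = nat (- vv f - 1)"
  have e: "vv f = - (1 + int m)" using neg by (simp add: m_def)
  have "y powi (1 + int m) * f = y powi (1 + int m) * (y powi (- (1 + int m)) * w)"
    using w(2) unfolding e by (rule arg_cong)
  also have "\<dots> = w" using y_nz by (simp add: mult.assoc[symmetric] flip: power_int_add)
  also have "y powi (1 + int m) * f = y * (y ^ m * f)"
    using y_nz by (simp add: power_int_add)
  finally have "y * (y ^ m * f) = w" .
  then show False using UU_notin_y_AA[OF AA_power[OF assms(1)]] w(1) by metis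
qed

lemma vv_nonneg_AA:
  assumes "vge vv 0 f"
  shows "f \<in> AA"
proof (cases "f = 0")
  case True
  then show ?thesis using subring_zero[OF subring_AA] by simp
next
  case False
  obtain w where w: "w \<in> UU" "f = y powi (vv f) * w" using vv_rep False by blast
  have "vv f = int (nat (vv f))" using assms False by (simp add: vge_def)
  then have "y powi (vv f) = y ^ nat (vv f)" by (metis power_int_of_nat)
  then show ?thesis using w AA_power[OF UU_AA[OF w(1)], of "nat (vv f)"] by simp
qed

sublocale F: dval K UNIV vv
proof
  show "is_subfield K" "is_subfield (UNIV :: 'a set)" "K \<subseteq> UNIV" by (auto simp: subK is_subfield_UNIV)
  show mult: "vv (a * b) = vv a + vv b" if ab: "a \<noteq> 0" "b \<noteq> 0" for a b
  proof -
    obtain w where w: "w \<in> UU" "a = y powi (vv a) * w" using vv_rep ab by blast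
    obtain w' where w': "w' \<in> UU" "b = y powi (vv b) * w'" using vv_rep ab by blast
    have "a * b = (y powi (vv a) * w) * (y powi (vv b) * w')"
      by (rule arg_cong2[of _ _ _ _ "(*)"]) (fact w(2), fact w'(2))
    also have "\<dots> = y powi (vv a + vv b) * (w * w')" using y_nz by (simp add: power_int_add)
    finally show ?thesis using vv_eq[OF UU_mult[OF w(1) w'(1)], of "vv a + vv b"] by simp
  qed
  have le: "vv a \<le> vv (a + b)" if ab: "a \<noteq> 0" "b \<noteq> 0" "a + b \<noteq> 0" "vv a \<le> vv b" for a b
  proof -
    have ba: "vv (b / a) \<ge> 0" using mult[of a "b / a"] ab by simp
    then have "1 + b / a \<in> AA"
      using subring_add[OF subring_AA subring_one[OF subring_AA] vv_nonneg_AA[of "b / a"]] by (simp add: vge_def)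
    moreover have nz: "1 + b / a \<noteq> 0" using ab by (simp add: field_simps)
    ultimately have "vv (1 + b / a) \<ge> 0" by (rule AA_vv_nonneg)
    moreover have "vv (a * (1 + b / a)) = vv a + vv (1 + b / a)" using ab nz by (intro mult) auto
    moreover have "a * (1 + b / a) = a + b" using ab by (simp add: field_simps)
    ultimately show ?thesis by simp
  qed
  show "min (vv a) (vv b) \<le> vv (a + b)" if "a \<noteq> 0" "b \<noteq> 0" "a + b \<noteq> 0" for a b
    using le[of a b] le[of b a] that by (cases "vv a \<le> vv b") (auto simp: add.commute)
  show "vv c = 0" if "c \<in> K" "c \<noteq> 0" for c
    using vv_eq[OF K_UU[OF that], of 0] by simp
  show "\<exists>t\<in>UNIV. t \<noteq> 0 \<and> vv t = 1"
    using vv_eq[OF K_UU[of 1], of 1] y_nz by (intro bexI[of _ y]) auto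
qed

abbreviation QQ :: "'a set" where
  "QQ \<equiv> vplace UNIV vv"

lemma vv_residue:
  assumes "a \<noteq> 0" "vv a = 0"
  shows "\<exists>c\<in>K. vge vv 1 (a - c)"
proof -
  obtain w where "w \<in> UU" "a = y powi (vv a) * w" using vv_rep assms by blast
  then obtain c b where h: "c \<in> K" "b \<in> AA" "a = c + y * b" using assms by (auto simp: UU_def)
  have "vv y = 1" using vv_eq[OF K_UU[of 1], of 1] by simp
  then have "vge vv (1 + 0) (y * b)"
    using AA_vv_nonneg[OF h(2)] by (intro F.vge_mult) (auto simp: vge_def)
  then show ?thesis using h by (intro bexI[of _ c]) auto
qed

lemma vplace_L1_subset: "vplace L1 v1 \<subseteq> QQ"
proof
  fix a assume a: "a \<in> vplace L1 v1"
  have "vge vv 1 a"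
  proof (cases "a = 0")
    case False
    then have "a \<in> L1" "v1 a \<ge> 1" using a by (auto simp: vplace_def vge_def)
    moreover have "1 * 1 \<le> int N * v1 a" using N_pos \<open>v1 a \<ge> 1\<close> by (intro mult_mono) auto
    ultimately show ?thesis using False by (simp add: vge_def vv_L1)
  qed simp
  then show "a \<in> QQ" by (simp add: vplace_def)
qed

lemma inverse_u_in_vplace: "inverse u \<in> vplace L1 v1"
  using v1_inverse_u u_R1 by (simp add: vplace_def vge_def)

text \<open>The ring of such a place contains the valuation ring of \<open>v1\<close>. It also
  contains \<open>y\<close>, for otherwise it would contain 1/y and with it y = g (1/y)^(N-1). So it
  contains \<open>AA\<close>, and with it the valuation ring of \<open>vv\<close>, which is
  maximal.\<close>

lemma place_over_unique:
  assumes P: "is_place K UNIV P" and T: "inverse u \<in> P"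
  shows "P = QQ"
proof -
  let ?V = "place_ring K UNIV P"
  have VR: "is_valuation_ring K UNIV ?V" by (rule place_valuation_ring[OF F.subL P])
  note V = valuation_ringD[OF VR]
  have O1V: "vring L1 v1 \<subseteq> ?V" using place_containing_inverse_u(1)[OF F.subL _ P T] by simp
  have "y \<in> ?V"
  proof (rule ccontr)
    assume "y \<notin> ?V"
    then have "inverse y \<in> ?V" using V(6) by simp
    then have "g * inverse y ^ (N - 1) \<in> ?V"
      using O1V O1(2) by (intro subring_mult[OF V(1)] subring_power[OF V(1)]) auto
    moreover have "g * inverse y ^ (N - 1) = y"
    proof -
      have "g = y * y ^ (N - 1)" using y_power N_pos by (metis Suc_pred' power_Suc)
      then show ?thesis using y_nz by (simp add: power_inverse)
    qed
    ultimately show False using \<open>y \<notin> ?V\<close> by simp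
  qed
  have "AA \<subseteq> ?V"
  proof
    fix f assume "f \<in> AA"
    then obtain a where a: "\<forall>i<N. a i \<in> vring L1 v1" "f = (\<Sum>i<N. a i * y ^ i)"
      unfolding AA_def by (rule span_y_E)
    show "f \<in> ?V" unfolding a(2)
      using a(1) O1V \<open>y \<in> ?V\<close> by (intro subring_sum[OF V(1)] subring_mult[OF V(1)] subring_power[OF V(1)]) auto
  qed
  moreover have "vring UNIV vv \<subseteq> AA" using vv_nonneg_AA by (auto simp: vring_def)
  moreover have "?V \<subset> UNIV" using V(5) by blast
  ultimately have "?V = vring UNIV vv" using F.vring_maximal[OF V(1)] by blast
  then have "val_ideal ?V = QQ" using F.val_ideal_vring by simp
  then show ?thesis using place_eq[OF F.subL P] by (metis (no_types))
qed

lemma the_place_over_eq: "the_place_over K UNIV (vplace L1 v1) = QQ"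
  unfolding the_place_over_def
proof (rule the_equality)
  show "is_place K UNIV QQ \<and> vplace L1 v1 \<subseteq> QQ"
    using F.is_place_vplace vplace_L1_subset by blast
  show "P = QQ" if "is_place K UNIV P \<and> vplace L1 v1 \<subseteq> P" for P
    using place_over_unique that inverse_u_in_vplace by blast
qed

section \<open>The automorphisms that multiply \<open>y\<close> by a root of unity\<close>

definition cf :: "'a \<Rightarrow> nat \<Rightarrow> 'a" where
  "cf f = (SOME a. (\<forall>i<N. a i \<in> L1) \<and> f = (\<Sum>i<N. a i * y ^ i))"

lemma cf: "\<forall>i<N. cf f i \<in> L1" "f = (\<Sum>i<N. cf f i * y ^ i)"
proof -
  have "\<exists>a. (\<forall>i<N. a i \<in> L1) \<and> f = (\<Sum>i<N. a i * y ^ i)" using coeffs_exist[of f] by metis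
  from someI_ex[OF this] have *: "(\<forall>i<N. cf f i \<in> L1) \<and> f = (\<Sum>i<N. cf f i * y ^ i)"
    by (fold cf_def)
  from * show "\<forall>i<N. cf f i \<in> L1" by (rule conjunct1)
  from * show "f = (\<Sum>i<N. cf f i * y ^ i)" by (rule conjunct2)
qed

lemma cf_sum:
  assumes a: "\<forall>i<N. a i \<in> L1" and i: "i < N"
  shows "cf (\<Sum>i<N. a i * y ^ i) i = a i"
proof -
  define f where "f = (\<Sum>i<N. a i * y ^ i)"
  have "(\<Sum>i<N. (cf f i - a i) * y ^ i) = (\<Sum>i<N. cf f i * y ^ i) - (\<Sum>i<N. a i * y ^ i)"
    by (simp add: left_diff_distrib sum_subtractf)
  also have "\<dots> = 0" using cf(2)[of f] by (simp add: f_def)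
  finally have "\<forall>i<N. cf f i - a i = 0" using cf(1) a by (intro coeffs_unique_0) auto
  then show ?thesis using i by (simp add: f_def)
qed

text \<open>For an \<open>N\<close>-th root of unity in \<open>K\<close> this is the automorphism
  over K(u) taking \<open>y\<close> to \<open>\<zeta> * y\<close>. It is defined on expansions, and
  its multiplicativity rests on \<open>shift_sum\<close> for the conjugate root.\<close>

definition sg :: "'a \<Rightarrow> 'a \<Rightarrow> 'a" where
  "sg \<zeta> f = (\<Sum>i<N. cf f i * (\<zeta> * y) ^ i)"

lemma sg_sum: "\<forall>i<N. a i \<in> L1 \<Longrightarrow> sg \<zeta> (\<Sum>i<N. a i * y ^ i) = (\<Sum>i<N. a i * (\<zeta> * y) ^ i)"
  unfolding sg_def using cf_sum by (intro sum.cong) auto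

lemma sg_add: "sg \<zeta> (f + h) = sg \<zeta> f + sg \<zeta> h"
proof -
  have "f + h = (\<Sum>i<N. (cf f i + cf h i) * y ^ i)"
    using cf(2)[of f] cf(2)[of h] by (simp add: distrib_right sum.distrib)
  then have "sg \<zeta> (f + h) = (\<Sum>i<N. (cf f i + cf h i) * (\<zeta> * y) ^ i)"
    using sg_sum[of "\<lambda>i. cf f i + cf h i"] cf(1) by simp
  then show ?thesis by (simp add: sg_def distrib_right sum.distrib)
qed

lemma sg_scale: "a \<in> L1 \<Longrightarrow> sg \<zeta> (a * f) = a * sg \<zeta> f"
proof -
  assume a: "a \<in> L1"
  have "a * f = (\<Sum>i<N. (a * cf f i) * y ^ i)"
    by (subst cf(2)) (simp add: sum_distrib_left mult_ac)
  then have "sg \<zeta> (a * f) = (\<Sum>i<N. (a * cf f i) * (\<zeta> * y) ^ i)"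
    using sg_sum[of "\<lambda>i. a * cf f i"] cf(1) a by simp
  then show ?thesis by (simp add: sg_def sum_distrib_left mult_ac)
qed

lemma sg_L1: "a \<in> L1 \<Longrightarrow> sg \<zeta> a = a"
proof -
  assume a: "a \<in> L1"
  define b where "b i = (if i = 0 then a else 0)" for i :: nat
  have b: "\<forall>i<N. b i \<in> L1" using a by (simp add: b_def)
  have "(\<Sum>i<N. b i * z ^ i) = (\<Sum>i<N. if i = 0 then a else 0)" for z
    by (intro sum.cong) (auto simp: b_def)
  then have "(\<Sum>i<N. b i * z ^ i) = a" for z using N_pos by simp
  then show ?thesis using sg_sum[OF b] by simp
qed

context
  fixes \<zeta> assumes zeta: "\<zeta> ^ N = 1" "\<zeta> \<in> K"
begin

lemma sg_y: "sg \<zeta> (y * f) = \<zeta> * y * sg \<zeta> f"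
proof -
  have z: "(\<zeta> * y) ^ N = g" using zeta y_power by (simp add: power_mult_distrib)
  have "y * f = (\<Sum>i<N. shift (cf f) i * y ^ i)"
    by (subst cf(2)) (rule shift_sum[OF y_power])
  then have "sg \<zeta> (y * f) = (\<Sum>i<N. shift (cf f) i * (\<zeta> * y) ^ i)"
    using sg_sum[OF shift_closed[OF subringL g_L1 cf(1)]] by simp
  also have "\<dots> = \<zeta> * y * sg \<zeta> f" unfolding sg_def by (rule shift_sum[OF z, symmetric])
  finally show ?thesis .
qed

lemma sg_power: "sg \<zeta> (y ^ k * f) = (\<zeta> * y) ^ k * sg \<zeta> f"
proof (induction k)
  case (Suc k)
  then show ?case using sg_y[of "y ^ k * f"] by (simp add: mult_ac)
qed simp

lemma sg_setsum: "sg \<zeta> (sum h I) = (\<Sum>i\<in>I. sg \<zeta> (h i))"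
proof (induction I rule: infinite_finite_induct)
  case (insert x F)
  then show ?case by (simp add: sg_add)
qed (simp_all add: sg_L1)

lemma sg_mult: "sg \<zeta> (f * h) = sg \<zeta> f * sg \<zeta> h"
proof -
  have "f * h = (\<Sum>i<N. cf f i * (y ^ i * h))"
    by (subst cf(2)[of f]) (simp only: sum_distrib_right mult.assoc)
  then have "sg \<zeta> (f * h) = (\<Sum>i<N. sg \<zeta> (cf f i * (y ^ i * h)))" by (simp add: sg_setsum)
  also have "\<dots> = (\<Sum>i<N. cf f i * ((\<zeta> * y) ^ i * sg \<zeta> h))"
    using cf(1) by (intro sum.cong) (auto simp: sg_scale sg_power)
  finally have e: "sg \<zeta> (f * h) = (\<Sum>i<N. cf f i * ((\<zeta> * y) ^ i * sg \<zeta> h))" .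
  show ?thesis unfolding e sg_def[of \<zeta> f] sum_distrib_right by (simp only: mult.assoc)
qed

lemma sg_inverse_zeta: "sg \<zeta> (sg (inverse \<zeta>) f) = f"
proof -
  have z0: "\<zeta> \<noteq> 0" using zeta N_pos by (auto simp: power_0_left)
  have "sg (inverse \<zeta>) f = (\<Sum>i<N. (cf f i * inverse \<zeta> ^ i) * y ^ i)"
    by (simp add: sg_def power_mult_distrib mult_ac)
  moreover have "\<forall>i<N. cf f i * inverse \<zeta> ^ i \<in> L1" using cf(1) zeta(2) by simp
  ultimately have "sg \<zeta> (sg (inverse \<zeta>) f) = (\<Sum>i<N. (cf f i * inverse \<zeta> ^ i) * (\<zeta> * y) ^ i)"
    using sg_sum by simp
  also have "\<dots> = (\<Sum>i<N. cf f i * y ^ i)"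
    using z0 by (intro sum.cong refl) (simp add: power_mult_distrib power_inverse)
  finally show ?thesis using cf(2)[of f] by simp
qed

lemma sg_minus: "sg \<zeta> (f - h) = sg \<zeta> f - sg \<zeta> h"
  using sg_add[of \<zeta> "f - h" h] by simp

lemma sg_inverse: "sg \<zeta> (inverse f) = inverse (sg \<zeta> f)"
proof (cases "f = 0")
  case True
  then show ?thesis using sg_L1[of 0] by simp
next
  case False
  then have "sg \<zeta> f * sg \<zeta> (inverse f) = 1" using sg_mult[of f "inverse f"] sg_L1[of 1] by simp
  then show ?thesis by (rule inverse_unique[symmetric])
qed

text \<open>The preimage of a valuation ring under an automorphism is a valuation ring. It does not
  belong to \<open>Q\<close>: as 1/u is fixed, \<open>P\<close> itself would then contain
  1/u.\<close>

lemma place_image: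
  assumes P: "is_place K UNIV P" "P \<noteq> QQ"
  obtains P' where "is_place K UNIV P'" "P' \<noteq> QQ" "place_ring K UNIV P' = {f. sg \<zeta> f \<in> place_ring K UNIV P}"
proof -
  let ?V = "place_ring K UNIV P"
  note V = valuation_ringD[OF place_valuation_ring[OF F.subL P(1)]]
  define W where "W = {f. sg \<zeta> f \<in> ?V}"
  have "is_subring W"
    using V(1) sg_L1[of 0] sg_L1[of 1] by (auto simp: is_subring_def W_def sg_add sg_minus sg_mult)
  moreover have "K \<subseteq> W" using V(2) by (auto simp: W_def sg_L1)
  moreover have "K \<noteq> W"
  proof -
    obtain f where f: "f \<in> ?V" "f \<notin> K" using V(2,4) by blast
    have "sg (inverse \<zeta>) f \<in> W" using f by (simp add: W_def sg_inverse_zeta)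
    moreover have "sg (inverse \<zeta>) f \<notin> K"
    proof
      assume "sg (inverse \<zeta>) f \<in> K"
      then have "sg \<zeta> (sg (inverse \<zeta>) f) \<in> K" by (simp add: sg_L1)
      then show False using f by (simp add: sg_inverse_zeta)
    qed
    ultimately show ?thesis by blast
  qed
  moreover have "W \<noteq> UNIV"
  proof -
    obtain f where "f \<notin> ?V" using V(5) by blast
    then have "sg (inverse \<zeta>) f \<notin> W" by (simp add: W_def sg_inverse_zeta)
    then show ?thesis by blast
  qed
  moreover have "f \<in> W \<or> inverse f \<in> W" for f using V(6)[of "sg \<zeta> f"] by (auto simp: W_def sg_inverse)
  ultimately have WR: "is_valuation_ring K UNIV W" unfolding is_valuation_ring_def by blast
  have "val_ideal W \<noteq> QQ"
  proof
    assume "val_ideal W = QQ"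
    then have "inverse u \<in> val_ideal W" using inverse_u_in_vplace vplace_L1_subset by blast
    moreover have "u \<in> L1" "inverse u \<in> L1" using u_R1 by auto
    ultimately have "inverse u \<in> val_ideal ?V" using u_nonzero by (simp add: val_ideal_def W_def sg_L1)
    then have "inverse u \<in> P" by (subst place_eq[OF F.subL P(1)])
    then show False using place_over_unique P by blast
  qed
  with place_val_ideal[OF F.subL WR] show thesis by (intro that[of "val_ideal W"]) (auto simp: W_def)
qed

end

section \<open>The ring of functions regular away from \<open>Q\<close>\<close>

definition RR :: "'a set" where
  "RR = {f. \<forall>P. is_place K UNIV P \<longrightarrow> P \<noteq> QQ \<longrightarrow> f \<in> place_ring K UNIV P}"

lemma subring_RR: "is_subring RR"
proof -
  have "is_subring (place_ring K UNIV P)" if "is_place K UNIV P" for P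
    using valuation_ringD(1)[OF place_valuation_ring[OF F.subL that]] .
  then show ?thesis unfolding is_subring_def RR_def by blast
qed

lemma R1_RR: "R1 \<subseteq> RR"
proof
  fix f assume "f \<in> R1"
  then obtain p where p: "p \<in> polys_over K" "f = poly p u" by (auto simp: R1_def)
  have "f \<in> place_ring K UNIV P" if P: "is_place K UNIV P" "P \<noteq> QQ" for P
  proof -
    note V = valuation_ringD[OF place_valuation_ring[OF F.subL P(1)]]
    have "u \<in> place_ring K UNIV P"
    proof (rule ccontr)
      assume "u \<notin> place_ring K UNIV P"
      then have "inverse u \<in> val_ideal (place_ring K UNIV P)" using V(6)[of u] by (simp add: val_ideal_def)
      then have "inverse u \<in> P" by (subst place_eq[OF F.subL P(1)])
      then show False using place_over_unique P by blast
    qed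
    then show ?thesis unfolding p(2) using poly_in_subring[OF ringK p(1) V(2,1)] by blast
  qed
  then show "f \<in> RR" by (simp add: RR_def)
qed

text \<open>As \<open>u\<close> has a pole at \<open>Q\<close>, every place whose ring contains K[u]
  is different from \<open>Q\<close>, and \<open>in_R1_if_regular\<close> applies.\<close>

lemma RR_L1: "f \<in> RR \<Longrightarrow> f \<in> L1 \<Longrightarrow> f \<in> R1"
proof (rule in_R1_if_regular[OF F.subL])
  fix P assume f: "f \<in> RR" and P: "is_place K UNIV P" "R1 \<subseteq> place_ring K UNIV P"
  have "P \<noteq> QQ"
  proof
    assume "P = QQ"
    then have "u \<in> vring UNIV vv" using P(2) u_R1 F.place_ring_vplace by auto
    moreover have "u \<in> L1" using u_R1 by simp
    ultimately show False using vv_L1[of u] u_nonzero v1_u N_pos by (simp add: vring_def vge_def)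
  qed
  then show "f \<in> place_ring K UNIV P" using f P by (simp add: RR_def)
qed auto

text \<open>Valuation rings are integrally closed: if 1/f is regular, then so is f = f^k
  (1/f)^(k-1).\<close>

lemma RR_power:
  assumes "f ^ k \<in> RR" "k > 0"
  shows "f \<in> RR"
proof -
  have "f \<in> place_ring K UNIV P" if P: "is_place K UNIV P" "P \<noteq> QQ" for P
  proof (rule ccontr)
    note V = valuation_ringD[OF place_valuation_ring[OF F.subL P(1)]]
    assume f: "f \<notin> place_ring K UNIV P"
    then have "inverse f \<in> place_ring K UNIV P" using V(6) by simp
    moreover have "f ^ k \<in> place_ring K UNIV P" using assms P by (simp add: RR_def)
    ultimately have "f ^ k * inverse f ^ (k - 1) \<in> place_ring K UNIV P"
      by (intro subring_mult[OF V(1) _ subring_power[OF V(1)]])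
    moreover have "f \<noteq> 0" using f subring_zero[OF V(1)] by auto
    then have "f ^ k * inverse f ^ (k - 1) = f"
      using assms(2) by (cases k) (auto simp: power_inverse)
    ultimately show False using f by simp
  qed
  then show ?thesis by (simp add: RR_def)
qed

text \<open>The \<open>N\<close>-th power of the term lies in K(u), where being regular away from
  \<open>Q\<close> means being a polynomial in \<open>u\<close>.\<close>

lemma monomial_RR_iff:
  assumes "a \<in> L1"
  shows "a * y ^ i \<in> RR \<longleftrightarrow> a ^ N * g ^ i \<in> R1"
proof -
  have e: "(a * y ^ i) ^ N = a ^ N * g ^ i"
    by (simp add: power_mult_distrib flip: y_power power_mult) (simp add: mult.commute)
  have "a ^ N * g ^ i \<in> L1" using assms g_L1 by simp
  then show ?thesis
    using RR_L1 R1_RR RR_power[OF _ N_pos, of "a * y ^ i"] subring_power[OF subring_RR, of "a * y ^ i" N]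
    unfolding e by blast
qed

lemma sg_RR:
  assumes "f \<in> RR" "\<zeta> ^ N = 1" "\<zeta> \<in> K"
  shows "sg \<zeta> f \<in> RR"
proof -
  have "sg \<zeta> f \<in> place_ring K UNIV P" if P: "is_place K UNIV P" "P \<noteq> QQ" for P
  proof -
    obtain P' where "is_place K UNIV P'" "P' \<noteq> QQ" "place_ring K UNIV P' = {f. sg \<zeta> f \<in> place_ring K UNIV P}"
      using place_image[OF assms(2,3) P] .
    then show ?thesis using assms(1) by (auto simp: RR_def)
  qed
  then show ?thesis by (simp add: RR_def)
qed

definition roots :: "'a set" where
  "roots = {\<zeta>\<in>K. \<zeta> ^ N = 1}"

lemma finite_roots: "finite roots"
  using card_roots_of_unity_le(1)[OF N_pos] by (rule finite_subset[rotated]) (auto simp: roots_def)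

text \<open>Orthogonality of characters. If all roots had equal \<open>i\<close>-th and
  \<open>j\<close>-th powers for distinct indices, all \<open>N\<close> of them would be roots of
  X^d - 1 with d = |i - j| < N.\<close>

lemma roots_orthogonal:
  assumes "i < N" "j < N"
  shows "(\<Sum>\<zeta>\<in>roots. \<zeta> ^ i * inverse \<zeta> ^ j) = (if i = j then of_nat N else 0)"
proof (cases "i = j")
  case True
  have "\<zeta> ^ i * inverse \<zeta> ^ j = 1" if "\<zeta> \<in> roots" for \<zeta>
  proof -
    have "\<zeta> \<noteq> 0" using that N_pos by (auto simp: roots_def power_0_left)
    then show ?thesis using True by (simp add: power_inverse)
  qed
  then have "(\<Sum>\<zeta>\<in>roots. \<zeta> ^ i * inverse \<zeta> ^ j) = of_nat (card roots)" by simp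
  then show ?thesis using True roots_card by (simp add: roots_def)
next
  case False
  have nz: "\<zeta> \<noteq> 0" if "\<zeta> \<in> roots" for \<zeta> using that N_pos by (auto simp: roots_def power_0_left)
  have "\<exists>\<eta>\<in>roots. \<eta> ^ i * inverse \<eta> ^ j \<noteq> 1"
  proof (rule ccontr)
    assume "\<not> ?thesis"
    then have all: "\<eta> ^ i * inverse \<eta> ^ j = 1" if "\<eta> \<in> roots" for \<eta> using that by blast
    define d where "d = (if i < j then j - i else i - j)"
    have d: "0 < d" "d < N" using False assms by (auto simp: d_def)
    have "roots \<subseteq> {x. x ^ d = 1}"
    proof
      fix \<eta> assume e: "\<eta> \<in> roots"
      have ij: "\<eta> ^ i = \<eta> ^ j" using all[OF e] nz[OF e] by (simp add: power_inverse field_simps)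
      show "\<eta> \<in> {x. x ^ d = 1}"
      proof (cases "i < j")
        case True
        then have "i + d = j" by (simp add: d_def)
        then have "\<eta> ^ i * \<eta> ^ d = \<eta> ^ i" using ij power_add[of \<eta> i d] by simp
        then show ?thesis using nz[OF e] by simp
      next
        case False
        then have "j + d = i" by (simp add: d_def)
        then have "\<eta> ^ j * \<eta> ^ d = \<eta> ^ j" using ij power_add[of \<eta> j d] by simp
        then show ?thesis using nz[OF e] by simp
      qed
    qed
    then have "card roots \<le> d"
      using card_mono[OF card_roots_of_unity_le(1)[OF d(1)]] card_roots_of_unity_le(2)[OF d(1)] le_trans by blast
    then show False using d roots_card by (simp add: roots_def)
  qed
  then obtain \<eta> where eta: "\<eta> \<in> roots" "\<eta> ^ i * inverse \<eta> ^ j \<noteq> 1" by blast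
  define S where "S = (\<Sum>\<zeta>\<in>roots. \<zeta> ^ i * inverse \<zeta> ^ j)"
  have "bij_betw ((*) \<eta>) roots roots"
  proof -
    have inj: "inj_on ((*) \<eta>) roots" using nz[OF eta(1)] by (auto simp: inj_on_def)
    moreover have "(*) \<eta> ` roots \<subseteq> roots" using eta(1) by (auto simp: roots_def power_mult_distrib)
    ultimately have "(*) \<eta> ` roots = roots" using finite_roots by (intro endo_inj_surj)
    with inj show ?thesis by (simp add: bij_betw_def)
  qed
  then have "S = (\<Sum>\<zeta>\<in>roots. (\<eta> * \<zeta>) ^ i * inverse (\<eta> * \<zeta>) ^ j)"
    unfolding S_def by (rule sum.reindex_bij_betw[symmetric])
  also have "\<dots> = (\<eta> ^ i * inverse \<eta> ^ j) * S"
    unfolding S_def by (simp add: power_mult_distrib sum_distrib_left mult_ac)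
  finally have "(\<eta> ^ i * inverse \<eta> ^ j - 1) * S = 0" by (simp add: algebra_simps)
  then show ?thesis using eta(2) False by (simp add: S_def)
qed

lemma component_RR:
  assumes f: "f \<in> RR" and j: "j < N"
  shows "cf f j * y ^ j \<in> RR"
proof -
  have "(\<Sum>\<zeta>\<in>roots. inverse \<zeta> ^ j * sg \<zeta> f) = (\<Sum>\<zeta>\<in>roots. \<Sum>i<N. (cf f i * y ^ i) * (\<zeta> ^ i * inverse \<zeta> ^ j))"
    by (simp add: sg_def sum_distrib_left power_mult_distrib mult_ac)
  also have "\<dots> = (\<Sum>i<N. \<Sum>\<zeta>\<in>roots. (cf f i * y ^ i) * (\<zeta> ^ i * inverse \<zeta> ^ j))"
    by (rule sum.swap)
  also have "\<dots> = (\<Sum>i<N. (cf f i * y ^ i) * (if i = j then of_nat N else 0))"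
    by (intro sum.cong refl) (simp add: roots_orthogonal j flip: sum_distrib_left)
  also have "\<dots> = (\<Sum>i<N. if i = j then cf f j * y ^ j * of_nat N else 0)"
    by (intro sum.cong) auto
  also have "\<dots> = cf f j * y ^ j * of_nat N" using j by simp
  finally have e: "(\<Sum>\<zeta>\<in>roots. inverse \<zeta> ^ j * sg \<zeta> f) = cf f j * y ^ j * of_nat N" .
  have KRR: "K \<subseteq> RR" using K_R1 R1_RR by blast
  have "(\<Sum>\<zeta>\<in>roots. inverse \<zeta> ^ j * sg \<zeta> f) \<in> RR"
  proof (rule subring_sum[OF subring_RR], rule subring_mult[OF subring_RR])
    fix \<zeta> assume "\<zeta> \<in> roots"
    then have z: "\<zeta> \<in> K" "\<zeta> ^ N = 1" by (auto simp: roots_def)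
    then have "inverse \<zeta> ^ j \<in> K" by simp
    then show "inverse \<zeta> ^ j \<in> RR" using KRR by blast
    show "sg \<zeta> f \<in> RR" using sg_RR[OF f] z by blast
  qed
  moreover have "of_nat N \<in> K"
  proof -
    have "(of_nat k :: 'a) \<in> K" for k by (induction k) auto
    then show ?thesis .
  qed
  then have "inverse (of_nat N) \<in> RR" using KRR subfield_inverse[OF subfieldK] by blast
  ultimately have "cf f j * y ^ j * of_nat N * inverse (of_nat N) \<in> RR"
    unfolding e by (rule subring_mult[OF subring_RR])
  then show ?thesis using N_nz by (simp add: mult.assoc)
qed

lemma RR_min_component:
  assumes f: "f \<in> RR" "f \<noteq> 0"
  obtains a i where "a \<in> L1" "a \<noteq> 0" "i < N" "a ^ N * g ^ i \<in> R1" "vv f = int N * v1 a + int i"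
proof -
  have "\<exists>i1<N. cf f i1 \<noteq> 0"
  proof (rule ccontr)
    assume "\<not> ?thesis"
    then have "(\<Sum>i<N. cf f i * y ^ i) = 0" by simp
    then show False using f(2) cf(2)[of f] by simp
  qed
  then obtain i0 where i0: "i0 < N" "cf f i0 \<noteq> 0"
      "\<forall>i<N. cf f i \<noteq> 0 \<longrightarrow> int N * v1 (cf f i0) + int i0 \<le> int N * v1 (cf f i) + int i"
    using exists_min_term by blast
  have "vv f = int N * v1 (cf f i0) + int i0"
    using vv_sum[OF cf(1) i0(1,2)] i0(3) cf(2)[of f] by simp
  moreover have "cf f i0 ^ N * g ^ i0 \<in> R1"
    using component_RR[OF f(1) i0(1)] cf(1) i0(1) monomial_RR_iff by blast
  ultimately show thesis using i0 cf(1) that by blast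
qed

sublocale F: one_place_complete K UNIV vv RR
proof
  show "is_subring RR" "K \<subseteq> RR" "RR \<subseteq> UNIV" using subring_RR K_R1 R1_RR by auto
  show "\<exists>b\<in>RR. b \<noteq> 0 \<and> b * f \<in> RR" for f
  proof -
    \<comment> \<open>The functions with a denominator in K[u] are closed under sums and products
      and include K(u) and \<open>y\<close>, hence everything.\<close>
    define Fr where "Fr = {f. \<exists>b\<in>R1. b \<noteq> 0 \<and> b * f \<in> RR}"
    have RRm: "a * b \<in> RR" if "a \<in> RR" "b \<in> RR" for a b using that subring_mult[OF subring_RR] by blast
    have add: "f + h \<in> Fr" if fh: "f \<in> Fr" "h \<in> Fr" for f h
    proof -
      obtain b c where bc: "b \<in> R1" "b \<noteq> 0" "b * f \<in> RR" "c \<in> R1" "c \<noteq> 0" "c * h \<in> RR"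
        using fh by (auto simp: Fr_def)
      have "b * c * (f + h) = c * (b * f) + b * (c * h)" by (simp add: algebra_simps)
      also have "\<dots> \<in> RR" using bc R1_RR by (intro subring_add[OF subring_RR RRm[OF _ bc(3)] RRm[OF _ bc(6)]]) auto
      finally show ?thesis using bc subring_mult[OF subring_R1 bc(1,4)] by (auto simp: Fr_def intro!: bexI[of _ "b * c"])
    qed
    have mult: "f * h \<in> Fr" if fh: "f \<in> Fr" "h \<in> Fr" for f h
    proof -
      obtain b c where bc: "b \<in> R1" "b \<noteq> 0" "b * f \<in> RR" "c \<in> R1" "c \<noteq> 0" "c * h \<in> RR"
        using fh by (auto simp: Fr_def)
      have "b * c * (f * h) = (b * f) * (c * h)" by (simp add: algebra_simps)
      also have "\<dots> \<in> RR" by (rule RRm[OF bc(3,6)])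
      finally show ?thesis using bc subring_mult[OF subring_R1 bc(1,4)] by (auto simp: Fr_def intro!: bexI[of _ "b * c"])
    qed
    have L1: "a \<in> Fr" if "a \<in> L1" for a
      using frac[OF that] R1_RR by (auto simp: Fr_def)
    have "y \<in> Fr"
    proof -
      obtain b where b: "b \<in> R1" "b \<noteq> 0" "b * g \<in> R1" using frac[OF g_L1] by blast
      have "b ^ N * g ^ 1 = b ^ (N - 1) * (b * g)"
      proof -
        have "b ^ N = b ^ (N - 1) * b" using N_pos by (simp add: power_eq_if)
        then show ?thesis by simp
      qed
      also have "\<dots> \<in> R1" using b by (intro subring_mult[OF subring_R1 subring_power[OF subring_R1]])
      finally have "b * y ^ 1 \<in> RR" using monomial_RR_iff[of b 1] b(1) by simp
      then show ?thesis using b by (auto simp: Fr_def)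
    qed
    then have yk: "y ^ k \<in> Fr" for k by (induction k) (auto intro: L1 mult)
    have "(\<Sum>i<n. cf f i * y ^ i) \<in> Fr" if "n \<le> N" for n
      using that
    proof (induction n)
      case 0
      show ?case using L1[of 0] by simp
    next
      case (Suc n)
      then have "cf f n * y ^ n \<in> Fr" using cf(1) by (intro mult[OF L1 yk]) auto
      with Suc show ?case using add by simp
    qed
    then have "f \<in> Fr" using cf(2)[of f] by (metis order_refl)
    then show ?thesis using R1_RR by (auto simp: Fr_def)
  qed
  show "vv f \<le> 0" if f: "f \<in> RR" "f \<noteq> 0" for f
  proof -
    obtain a i where h: "a \<in> L1" "a \<noteq> 0" "i < N" "a ^ N * g ^ i \<in> R1" "vv f = int N * v1 a + int i"
      using f by (rule RR_min_component)
    \<comment> \<open>Because \<open>v1 g = 1\<close>, the left side is N v1(a) + i, the value of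
      \<open>f\<close>.\<close>
    have "v1 (a ^ N * g ^ i) \<le> 0" using R_neg[OF h(4)] h(2) g_nz by simp
    then show ?thesis using h g_L1 g_nz v1_g by (simp add: v_mult v_power)
  qed
  show "\<exists>c\<in>K. vge vv 1 (a - c)" if "a \<noteq> 0" "vv a = 0" for a using vv_residue that by blast
  show "RR \<subseteq> place_ring K UNIV P" if "is_place K UNIV P" "P \<noteq> QQ" for P using that by (auto simp: RR_def)
  show "a \<in> RR" if "\<And>P. is_place K UNIV P \<Longrightarrow> P \<noteq> QQ \<Longrightarrow> a \<in> place_ring K UNIV P" for a
    using that by (simp add: RR_def)
qed

lemma orders_eq:
  "F.orders = {nat (- (int N * v1 a + int i)) | a i. a \<in> L1 \<and> a \<noteq> 0 \<and> i < N \<and> a ^ N * g ^ i \<in> R1}"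
proof (intro equalityI subsetI)
  fix s assume "s \<in> F.orders"
  then obtain f where f: "f \<in> RR" "f \<noteq> 0" "s = nat (- vv f)" by (auto simp: F.orders_def)
  show "s \<in> {nat (- (int N * v1 a + int i)) | a i. a \<in> L1 \<and> a \<noteq> 0 \<and> i < N \<and> a ^ N * g ^ i \<in> R1}"
  proof -
    obtain a i where "a \<in> L1" "a \<noteq> 0" "i < N" "a ^ N * g ^ i \<in> R1" "vv f = int N * v1 a + int i"
      using f(1,2) by (rule RR_min_component)
    then show ?thesis unfolding f(3) by auto
  qed
next
  fix s assume "s \<in> {nat (- (int N * v1 a + int i)) | a i. a \<in> L1 \<and> a \<noteq> 0 \<and> i < N \<and> a ^ N * g ^ i \<in> R1}"
  then obtain a i where h: "a \<in> L1" "a \<noteq> 0" "i < N" "a ^ N * g ^ i \<in> R1" "s = nat (- (int N * v1 a + int i))"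
    by auto
  have "a * y ^ i \<in> RR" "a * y ^ i \<noteq> 0" "vv (a * y ^ i) = int N * v1 a + int i"
    using h y_nz monomial_RR_iff vv_monomial by auto
  then show "s \<in> F.orders" unfolding F.orders_def h(5) by force
qed

end

subsection \<open>The Weierstrass semigroup\<close>

lemma add_one_dvd_odd_power_add_one:
  assumes "odd n"
  shows "q + 1 dvd q ^ n + (1::nat)"
proof -
  obtain k where n: "n = 2 * k + 1" using assms by (elim oddE)
  have "int q + 1 dvd int q ^ (2 * k + 1) + 1"
  proof (induction k)
    case (Suc k)
    have "int q ^ (2 * Suc k + 1) + 1 = int q ^ 2 * (int q ^ (2 * k + 1) + 1) + (int q + 1) * (1 - int q)"
      by (simp add: algebra_simps power2_eq_square)
    then show ?case using Suc by simp
  qed simp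
  then have "int (q + 1) dvd int (q ^ n + 1)" by (simp add: n add.commute)
  then show ?thesis by (simp only: int_dvd_int_iff)
qed

text \<open>The intended \<open>A\<close> and \<open>B\<close> are those of
  \<open>ggs_polynomials\<close>; \<open>derivative\<close> is the form in which squarefreeness of u
  A B is used.\<close>

locale ggs = kummer K u y g N for K :: "'a::field set" and u y g :: 'a and N :: nat +
  fixes q n m :: nat and A B :: "'a poly"
  assumes q2: "q \<ge> 2" and n3: "n \<ge> 3" and odd_n: "odd n" and N_def: "N = q ^ n + 1"
    and m_def: "m = N div (q + 1)"
    and A: "A \<in> polys_over K" "A \<noteq> 0" and B: "B \<in> polys_over K" "B \<noteq> 0" "degree B = q * (q - 1)"
    and g_eq: "g = poly A u * poly B u ^ (q + 1) / u ^ (q ^ 3)"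
    and derivative: "pderiv (monom 1 1 * A * B) = 1"
begin

section \<open>Exponents of \<open>u\<close> and \<open>B\<close> in the coefficients of regular
  functions\<close>

lemma m_mult: "m * (q + 1) = N" and m_pos: "m > 0"
proof -
  show *: "m * (q + 1) = N"
    unfolding m_def N_def by (rule dvd_div_mult_self[OF add_one_dvd_odd_power_add_one[OF odd_n]])
  then show "m > 0" using N_pos by (cases m) auto
qed

text \<open>Here \<open>cI i = \<lceil>i / m\<rceil>\<close>, and \<open>uexp i = \<lceil>i q^3 / N\<rceil>\<close> for \<open>i < N\<close>.\<close>

definition cI :: "nat \<Rightarrow> int" where
  "cI i = - ((- int i) div int m)"

text \<open>For i from 1 to q^n this is the number of gaps congruent to \<open>i\<close> modulo
  \<open>N\<close>, one more than the bound for \<open>j\<close> in the theorem.\<close>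

definition T :: "nat \<Rightarrow> int" where
  "T i = int q - 1 + (int q ^ 2 - int q) * cI i - int (i * q ^ 3 div N)"

definition uexp :: "nat \<Rightarrow> nat" where
  "uexp i = q ^ 3 - (N - i) * q ^ 3 div N"

text \<open>The remainder on the right is the excess exponent of \<open>u\<close> in the
  \<open>N\<close>-th power of a coefficient. Being less than \<open>N\<close>, it is admissible in
  \<open>in_R1_if_power\<close>.\<close>

lemma uexp: assumes "i < N" shows "uexp i * N = i * q ^ 3 + (N - i) * q ^ 3 mod N"
proof -
  have "(N - i) * q ^ 3 div N \<le> N * q ^ 3 div N" by (intro div_le_mono mult_right_mono) auto
  then have le: "(N - i) * q ^ 3 div N \<le> q ^ 3" using N_pos by simp
  have "int (uexp i * N) = (int (q ^ 3) - int ((N - i) * q ^ 3 div N)) * int N"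
    using le by (simp add: uexp_def of_nat_diff)
  also have "\<dots> = int (q ^ 3) * int N - int (N * ((N - i) * q ^ 3 div N))" by (simp add: algebra_simps)
  also have "int (N * ((N - i) * q ^ 3 div N)) = int ((N - i) * q ^ 3) - int ((N - i) * q ^ 3 mod N)"
    using mult_div_mod_eq[of N "(N - i) * q ^ 3"] by linarith
  also have "int ((N - i) * q ^ 3) = (int N - int i) * int (q ^ 3)" using assms by (simp add: of_nat_diff)
  finally have "int (uexp i * N) = int (i * q ^ 3 + (N - i) * q ^ 3 mod N)" by (simp add: algebra_simps)
  then show ?thesis by (simp only: of_nat_eq_iff)
qed

lemma polyB_nz: "poly B u \<noteq> 0"
  using poly_u_eq_0 B by auto

lemma poly_in_L1: "p \<in> polys_over K \<Longrightarrow> poly p u \<in> L1"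
  using R1_I R1_L1 by blast

lemma u_L1: "u \<in> L1"
  using u_R1 R1_L1 by blast

text \<open>With p the element on the right, collecting exponents gives a^N g^i = E(u) p^N, where
  \<open>E\<close> has exponents less than \<open>N\<close> at \<open>u\<close>, \<open>A\<close>
  and \<open>B\<close>. So \<open>E\<close> divides the (N-1)-st power of u A B, as
  \<open>in_R1_if_power\<close> requires.\<close>

lemma power_in_R1_iff:
  assumes a: "a \<in> L1" and i: "i < N"
  shows "a ^ N * g ^ i \<in> R1 \<longleftrightarrow> a * poly B u ^ (i div m) / u ^ uexp i \<in> R1"
proof -
  define p where "p = a * poly B u ^ (i div m) / u ^ uexp i"
  define e1 e3 where "e1 = (N - i) * q ^ 3 mod N" and "e3 = (q + 1) * (i mod m)"
  have e1: "e1 \<le> N - 1" using N_pos by (simp add: e1_def Suc_leI less_Suc_eq_le[symmetric])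
  have "(q + 1) * (i mod m) < (q + 1) * m" using m_pos by (intro mult_strict_left_mono) auto
  then have e3: "e3 \<le> N - 1" using m_mult by (simp add: e3_def mult.commute)
  define E where "E = monom 1 1 ^ e1 * A ^ i * B ^ e3"
  have X1: "monom 1 1 \<in> polys_over K" by (rule X_closed(6)) simp
  have E: "E \<in> polys_over K" unfolding E_def using A B X1 by (intro X_closed(5,8))
  have EG: "E dvd (monom 1 1 * A * B) ^ (N - 1)"
    unfolding E_def power_mult_distrib using e1 e3 i by (intro mult_dvd_mono le_imp_power_dvd) auto
  \<comment> \<open>As N = m (q + 1), dividing \<open>i\<close> by \<open>m\<close> splits the
    exponent of \<open>B\<close> into a multiple of \<open>N\<close> and a remainder less than
    \<open>N\<close>.\<close>
  have Bexp: "(q + 1) * i = (i div m) * N + e3"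
  proof -
    have "(q + 1) * i = (q + 1) * (m * (i div m) + i mod m)" by (simp only: mult_div_mod_eq)
    also have "(q + 1) * (m * b + r) = b * (m * (q + 1)) + (q + 1) * r" for b r
      by (simp add: algebra_simps)
    then have "(q + 1) * (m * (i div m) + i mod m) = (i div m) * (m * (q + 1)) + e3"
      unfolding e3_def .
    finally show ?thesis by (simp only: m_mult)
  qed
  have 1: "a ^ N * g ^ i * u ^ (i * q ^ 3) = a ^ N * poly A u ^ i * poly B u ^ ((q + 1) * i)"
    using u_nonzero by (simp add: g_eq power_divide power_mult_distrib flip: power_mult)
      (simp add: mult.commute mult.left_commute power_add)
  have "poly E u * p ^ N * u ^ (uexp i * N) = u ^ e1 * (a ^ N * poly A u ^ i * (poly B u ^ (i div m * N) * poly B u ^ e3))"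
    using u_nonzero by (simp add: E_def p_def poly_monom power_divide power_mult_distrib flip: power_mult)
  then have "poly E u * p ^ N * u ^ (i * q ^ 3) * u ^ e1 = a ^ N * poly A u ^ i * poly B u ^ ((q + 1) * i) * u ^ e1"
    unfolding uexp[OF i, folded e1_def] Bexp power_add by (simp add: mult_ac)
  then have 2: "poly E u * p ^ N * u ^ (i * q ^ 3) = a ^ N * poly A u ^ i * poly B u ^ ((q + 1) * i)"
    using u_nonzero by simp
  have "a ^ N * g ^ i * u ^ (i * q ^ 3) = poly E u * p ^ N * u ^ (i * q ^ 3)" by (simp only: 1 2)
  then have e: "a ^ N * g ^ i = poly E u * p ^ N" using u_nonzero by simp
  have pL: "p \<in> L1" unfolding p_def using a poly_in_L1[OF B(1)] u_L1 by simp
  show ?thesis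
  proof
    assume "a ^ N * g ^ i \<in> R1"
    then have "p \<in> R1" using in_R1_if_power[OF pL derivative E EG] e N_pos by simp
    then show "a * poly B u ^ (i div m) / u ^ uexp i \<in> R1" by (simp add: p_def)
  next
    assume "a * poly B u ^ (i div m) / u ^ uexp i \<in> R1"
    then have "poly E u * p ^ N \<in> R1" unfolding p_def[symmetric]
      using E by (intro subring_mult[OF subring_R1] subring_power[OF subring_R1] R1_I)
    then show "a ^ N * g ^ i \<in> R1" by (simp add: e)
  qed
qed

lemma v1_B: "v1 (poly B u) = - int (q * (q - 1))"
  using v1_poly[OF B(1,2)] B(3) by simp

text \<open>A term with y^i has a pole order congruent to -i modulo \<open>N\<close>, which turns
  the index \<open>i\<close> into N - i unless i = 0.\<close>

lemma order_value:
  assumes p: "p \<in> polys_over K" "p \<noteq> 0" and i: "i < N"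
  shows "- (int N * v1 (u ^ uexp i / poly B u ^ (i div m) * poly p u) + int i) =
    (if i = 0 then int N * int (degree p) else int N * (T (N - i) + int (degree p)) + int (N - i))"
proof -
  have pu: "poly p u \<noteq> 0" using poly_u_eq_0 p by simp
  have v: "v1 (u ^ uexp i / poly B u ^ (i div m) * poly p u) =
      - int (uexp i) + int (i div m) * int (q * (q - 1)) - int (degree p)"
    using pu u_nonzero polyB_nz u_L1 poly_in_L1 p B
    by (simp add: v_mult v_divide v_power v1_u v1_B v1_poly)
  have qq: "int (q * (q - 1)) = int q ^ 2 - int q"
    using q2 by (simp add: of_nat_diff algebra_simps power2_eq_square)
  show ?thesis
  proof (cases "i = 0")
    case True
    have "uexp 0 = 0" using N_pos by (simp add: uexp_def)
    then show ?thesis using True unfolding v by (simp add: algebra_simps)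
  next
    case False
    have "(N - i) * q ^ 3 div N \<le> N * q ^ 3 div N" by (intro div_le_mono mult_right_mono) auto
    then have "(N - i) * q ^ 3 div N \<le> q ^ 3" using N_pos by simp
    then have ue: "int (uexp i) = int q ^ 3 - int ((N - i) * q ^ 3 div N)" by (simp add: uexp_def of_nat_diff)
    \<comment> \<open>As N = m (q + 1), the ceiling at N - i is q + 1 minus the floor at
      \<open>i\<close>.\<close>
    have "- int (N - i) = int i + int m * (- (int q + 1))" using i m_mult by (simp add: of_nat_diff algebra_simps flip: m_mult)
    then have "cI (N - i) = - ((int i + int m * (- (int q + 1))) div int m)" by (simp add: cI_def)
    also have "\<dots> = - (int i div int m - (int q + 1))" using m_pos by (subst div_mult_self2) auto
    finally have b: "int (i div m) = int q + 1 - cI (N - i)" by (simp add: zdiv_int)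
    have Ni: "int (N - i) = int N - int i" using i by simp
    have "int (uexp i) - int (i div m) * (int q ^ 2 - int q) = T (N - i) + 1"
      unfolding ue b T_def by (simp add: algebra_simps power2_eq_square power3_eq_cube)
    then show ?thesis unfolding v qq Ni using False
      by (simp add: algebra_simps)
  qed
qed

lemma T_nonneg_and_orders:
  assumes p: "p \<in> polys_over K" "p \<noteq> 0" and i: "i < N"
  defines "s \<equiv> (if i = 0 then int N * int (degree p) else int N * (T (N - i) + int (degree p)) + int (N - i))"
  shows "s \<ge> 0" "nat s \<in> F.orders"
proof -
  define a where "a = u ^ uexp i / poly B u ^ (i div m) * poly p u"
  have a: "a \<in> L1" "a \<noteq> 0"
    using u_L1 poly_in_L1 p B u_nonzero polyB_nz poly_u_eq_0 by (auto simp: a_def)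
  have "a * poly B u ^ (i div m) / u ^ uexp i = poly p u" using u_nonzero polyB_nz by (simp add: a_def)
  then have R: "a ^ N * g ^ i \<in> R1" using power_in_R1_iff[OF a(1) i] R1_I[OF p(1)] by simp
  have s: "s = - (int N * v1 a + int i)" unfolding s_def a_def using order_value[OF p i] by simp
  have "vv (a * y ^ i) \<le> 0" using F.R_neg[of "a * y ^ i"] monomial_RR_iff[OF a(1)] R a y_nz by simp
  then show "s \<ge> 0" using vv_monomial[OF a, of i] s by simp
  show "nat s \<in> F.orders" unfolding orders_eq s using a i R by blast
qed

text \<open>Functions in \<open>RR\<close> have no zero at \<open>Q\<close>, so N T(i) + i is not
  negative, while i < N.\<close>

lemma T_nonneg:
  assumes "1 \<le> i" "i \<le> q ^ n"
  shows "T i \<ge> 0"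
proof (rule ccontr)
  assume "\<not> T i \<ge> 0"
  then have "int N * T i \<le> int N * (-1)" by (intro mult_left_mono) auto
  moreover have "int N * (T i + 0) + int i \<ge> 0"
    using T_nonneg_and_orders(1)[OF X_closed(2), of "N - i"] assms by (auto simp: N_def split: if_splits)
  ultimately have "int N \<le> int i" by simp
  then have "N \<le> i" by (simp only: of_nat_le_iff)
  then show False using assms by (simp add: N_def)
qed

text \<open>The index \<open>j\<close> is the degree of the polynomial factor of a coefficient, and
  the factors u^j realize every \<open>j\<close>.\<close>

lemma orders_iff:
  "s \<in> F.orders \<longleftrightarrow> (\<exists>j. s = N * j) \<or> (\<exists>i j. 1 \<le> i \<and> i \<le> q ^ n \<and> int s = int N * (T i + int j) + int i)"
proof
  assume "s \<in> F.orders"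
  then obtain a i where h: "a \<in> L1" "a \<noteq> 0" "i < N" "a ^ N * g ^ i \<in> R1" "s = nat (- (int N * v1 a + int i))"
    unfolding orders_eq by blast
  obtain p where p: "p \<in> polys_over K" "a * poly B u ^ (i div m) / u ^ uexp i = poly p u"
    using power_in_R1_iff[OF h(1,3)] h(4) by (auto simp: R1_def)
  then have a: "a = u ^ uexp i / poly B u ^ (i div m) * poly p u"
    using u_nonzero polyB_nz by (simp add: field_simps)
  then have p0: "p \<noteq> 0" using h(2) by auto
  define w where "w = (if i = 0 then int N * int (degree p) else int N * (T (N - i) + int (degree p)) + int (N - i))"
  have "s = nat w" unfolding h(5) a w_def using order_value[OF p(1) p0 h(3)] by simp
  moreover have "w \<ge> 0" unfolding w_def by (rule T_nonneg_and_orders(1)[OF p(1) p0 h(3)])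
  ultimately have sw: "int s = w" by simp
  show "(\<exists>j. s = N * j) \<or> (\<exists>i j. 1 \<le> i \<and> i \<le> q ^ n \<and> int s = int N * (T i + int j) + int i)"
  proof (cases "i = 0")
    case True
    then have "int s = int (N * degree p)" using sw by (simp add: w_def)
    then have "s = N * degree p" by (simp only: of_nat_eq_iff)
    then show ?thesis by blast
  next
    case False
    then show ?thesis using sw h(3) unfolding w_def
      by (intro disjI2 exI[of _ "N - i"] exI[of _ "degree p"]) (auto simp: N_def)
  qed
next
  have X1: "monom (1::'a) j \<in> polys_over K" "monom (1::'a) j \<noteq> 0" "degree (monom (1::'a) j) = j" for j
    using X_closed(6)[of 1 j] by (auto simp: degree_monom_eq)
  assume "(\<exists>j. s = N * j) \<or> (\<exists>i j. 1 \<le> i \<and> i \<le> q ^ n \<and> int s = int N * (T i + int j) + int i)"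
  then show "s \<in> F.orders"
  proof (elim disjE exE conjE)
    fix j assume "s = N * j"
    then have "s = nat (int N * int (degree (monom (1::'a) j)))" using X1(3) by (simp flip: of_nat_mult)
    then show ?thesis using T_nonneg_and_orders(2)[OF X1(1,2), of 0 j] N_pos by simp
  next
    fix i j assume i: "1 \<le> i" "i \<le> q ^ n" and s: "int s = int N * (T i + int j) + int i"
    have "N - i < N" "N - i \<noteq> 0" "N - (N - i) = i" using i by (auto simp: N_def)
    then have "nat (int N * (T i + int j) + int i) \<in> F.orders"
      using T_nonneg_and_orders(2)[OF X1(1,2), of "N - i" j] X1(3)[of j] by simp
    then show ?thesis by (simp flip: s)
  qed
qed

section \<open>The gaps, their number and the genus\<close>

lemma not_orders_iff:
  assumes i: "1 \<le> i" "i \<le> q ^ n"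
  shows "N * j + i \<notin> F.orders \<longleftrightarrow> int j < T i"
proof -
  have iN: "i < N" using i by (simp add: N_def)
  have "N * j + i \<noteq> N * k" for k
  proof
    assume "N * j + i = N * k"
    then have "(N * j + i) mod N = 0" by simp
    then show False using iN i by simp
  qed
  moreover have "(\<exists>i' k. 1 \<le> i' \<and> i' \<le> q ^ n \<and> int (N * j + i) = int N * (T i' + int k) + int i') \<longleftrightarrow> T i \<le> int j"
  proof
    assume "\<exists>i' k. 1 \<le> i' \<and> i' \<le> q ^ n \<and> int (N * j + i) = int N * (T i' + int k) + int i'"
    then obtain i' k where h: "1 \<le> i'" "i' \<le> q ^ n" "int (N * j + i) = int N * (T i' + int k) + int i'" by blast
    have "i' < N" using h(2) by (simp add: N_def)
    then have "(int N * (T i' + int k) + int i') mod int N = int i'" by simp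
    moreover have "(N * j + i) mod N = i" using iN by simp
    then have "int (N * j + i) mod int N = int i" by (simp only: zmod_int[symmetric])
    ultimately have "i = i'" using h(3) by (simp only: of_nat_eq_iff)
    then have "int N * int j = int N * (T i + int k)" using h(3) by simp
    then have "int j = T i + int k" using N_pos by simp
    then show "T i \<le> int j" by simp
  next
    assume "T i \<le> int j"
    then have "int (N * j + i) = int N * (T i + int (nat (int j - T i))) + int i" by simp
    then show "\<exists>i' k. 1 \<le> i' \<and> i' \<le> q ^ n \<and> int (N * j + i) = int N * (T i' + int k) + int i'"
      using i by blast
  qed
  ultimately show ?thesis unfolding orders_iff by auto
qed

lemma gaps_eq: "UNIV - F.orders = {N * j + i | i j. 1 \<le> i \<and> i \<le> q ^ n \<and> int j < T i}"
proof (intro equalityI subsetI)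
  fix s assume s: "s \<in> UNIV - F.orders"
  define i j where "i = s mod N" and "j = s div N"
  have sij: "s = N * j + i" by (simp add: i_def j_def)
  have "s \<noteq> N * j" using s orders_iff[of s] by blast
  then have "i \<noteq> 0" using sij by auto
  moreover have "i \<le> q ^ n" using N_pos by (simp add: i_def N_def less_Suc_eq_le[symmetric])
  ultimately show "s \<in> {N * j + i | i j. 1 \<le> i \<and> i \<le> q ^ n \<and> int j < T i}"
    using s not_orders_iff[of i j] sij by (intro CollectI exI[of _ i] exI[of _ j]) auto
qed (use not_orders_iff in auto)

lemma finite_gaps: "finite (UNIV - F.orders)" and card_gaps: "int (card (UNIV - F.orders)) = (\<Sum>i=1..q ^ n. T i)"
proof -
  define S where "S = (SIGMA i:{1..q ^ n}. {..<nat (T i)})"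
  have img: "UNIV - F.orders = (\<lambda>(i, j). N * j + i) ` S"
    unfolding gaps_eq S_def by (auto simp: image_iff) (metis zless_nat_eq_int_zless)+
  have inj: "inj_on (\<lambda>(i, j). N * j + i) S"
  proof (rule inj_onI, clarify)
    fix i j i' j' assume "(i, j) \<in> S" "(i', j') \<in> S" and e: "N * j + i = N * j' + i'"
    then have "i < N" "i' < N" by (auto simp: S_def N_def)
    moreover have "(N * j + i) mod N = (N * j' + i') mod N" "(N * j + i) div N = (N * j' + i') div N"
      using e by simp_all
    ultimately show "i = i' \<and> j = j'" by simp
  qed
  show "finite (UNIV - F.orders)" unfolding img S_def by auto
  have "card (UNIV - F.orders) = card S" unfolding img by (rule card_image[OF inj])
  also have "\<dots> = (\<Sum>i=1..q ^ n. nat (T i))" by (simp add: S_def card_SigmaI)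
  finally show "int (card (UNIV - F.orders)) = (\<Sum>i=1..q ^ n. T i)"
    using T_nonneg by (simp add: of_nat_sum)
qed

text \<open>\<open>N\<close> is coprime to \<open>q\<close>, so i q^3 / N is not an integer and the
  two floors add up to q^3 - 1. The two ceilings add up to q + 2, or to q + 1 if \<open>m\<close>
  divides \<open>i\<close>.\<close>

lemma T_pair:
  assumes i: "1 \<le> i" "i \<le> q ^ n"
  shows "T i + T (N - i) = int q ^ 2 - 1 - (if m dvd i then int q ^ 2 - int q else 0)"
proof -
  have iN: "i < N" using i by (simp add: N_def)
  define r where "r = i * q ^ 3 mod N"
  have "coprime N q"
  proof -
    have "coprime (q ^ n + 1) (q ^ n)" by (metis coprime_Suc_left_nat Suc_eq_plus1)
    then show ?thesis using n3 by (simp add: N_def)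
  qed
  then have "coprime N (q ^ 3)" by simp
  then have "\<not> N dvd i * q ^ 3"
    using coprime_dvd_mult_left_iff i iN by (metis One_nat_def dvd_imp_le not_less not_one_le_zero le_zero_eq neq0_conv)
  then have r0: "r > 0" by (simp add: r_def mod_greater_zero_iff_not_dvd)
  have rN: "r < N" using N_pos by (simp add: r_def)
  have f: "int (i * q ^ 3 div N) + int ((N - i) * q ^ 3 div N) = int q ^ 3 - 1"
  proof -
    have e: "i * q ^ 3 = N * (i * q ^ 3 div N) + r" by (simp add: r_def)
    have le: "i * q ^ 3 \<le> N * q ^ 3" using iN by simp
    have "int ((N - i) * q ^ 3) = int N * int q ^ 3 - int (i * q ^ 3)" using iN by (simp add: of_nat_diff left_diff_distrib)
    also have "\<dots> = (int N - int r) + int N * (int q ^ 3 - int (i * q ^ 3 div N) - 1)"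
      by (subst e) (simp add: algebra_simps)
    finally have "int ((N - i) * q ^ 3) div int N = (int N - int r + int N * (int q ^ 3 - int (i * q ^ 3 div N) - 1)) div int N"
      by simp
    also have "\<dots> = (int q ^ 3 - int (i * q ^ 3 div N) - 1) + (int N - int r) div int N"
      using N_pos by (subst div_mult_self2) auto
    also have "(int N - int r) div int N = 0" using r0 rN by (intro div_pos_pos_trivial) auto
    finally show ?thesis by (simp add: zdiv_int)
  qed
  have c: "cI i + cI (N - i) = int q + 1 + (if m dvd i then 0 else 1)"
  proof -
    have "- int (N - i) = int i + int m * (- (int q + 1))" using iN by (simp add: of_nat_diff algebra_simps flip: m_mult)
    then have "cI (N - i) = - ((int i + int m * (- (int q + 1))) div int m)" by (simp add: cI_def)
    also have "\<dots> = int q + 1 - int i div int m" using m_pos by (subst div_mult_self2) auto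
    finally have cN: "cI (N - i) = int q + 1 - int i div int m" .
    have "- ((- int i) div int m) = int i div int m + (if m dvd i then 0 else 1)"
      using m_pos by (simp add: div_minus_minus zdiv_zminus1_eq_if dvd_eq_mod_eq_0 flip: zmod_int)
    then show ?thesis using cN by (simp add: cI_def)
  qed
  have "T i + T (N - i) = 2 * (int q - 1) + (int q ^ 2 - int q) * (cI i + cI (N - i)) -
      (int (i * q ^ 3 div N) + int ((N - i) * q ^ 3 div N))"
    by (simp add: T_def algebra_simps)
  also have "\<dots> = int q ^ 2 - 1 - (if m dvd i then int q ^ 2 - int q else 0)"
    unfolding f c by (simp add: algebra_simps power2_eq_square power3_eq_cube)
  finally show ?thesis .
qed

text \<open>Reflecting \<open>i\<close> to N - i pairs the summands. The correction term occurs for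
  the q multiples m, 2m, ..., qm of \<open>m\<close> below N = m (q + 1).\<close>

lemma sum_T: "2 * (\<Sum>i=1..q ^ n. T i) = int N * (int q ^ 2 - 1) + 1 - int q ^ 3"
proof -
  have "(\<Sum>i=1..q ^ n. T (N - i)) = (\<Sum>i=1..q ^ n. T i)"
    by (rule sum.reindex_bij_witness[of _ "\<lambda>i. N - i" "\<lambda>i. N - i"]) (auto simp: N_def)
  then have "2 * (\<Sum>i=1..q ^ n. T i) = (\<Sum>i=1..q ^ n. T i + T (N - i))" by (simp add: sum.distrib)
  also have "\<dots> = (\<Sum>i=1..q ^ n. int q ^ 2 - 1 - (if m dvd i then int q ^ 2 - int q else 0))"
    by (intro sum.cong refl T_pair) auto
  also have "\<dots> = int (q ^ n) * (int q ^ 2 - 1) - (\<Sum>i=1..q ^ n. if m dvd i then int q ^ 2 - int q else 0)"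
    by (simp add: sum_subtractf)
  also have "(\<Sum>i=1..q ^ n. if m dvd i then int q ^ 2 - int q else 0) = (\<Sum>i\<in>{i\<in>{1..q ^ n}. m dvd i}. int q ^ 2 - int q)"
    by (rule sum.inter_filter[symmetric]) simp
  also have "{i\<in>{1..q ^ n}. m dvd i} = (*) m ` {1..q}"
  proof (intro equalityI subsetI)
    fix i assume "i \<in> {i\<in>{1..q ^ n}. m dvd i}"
    then obtain k where k: "i = m * k" "1 \<le> m * k" "m * k \<le> q ^ n" by auto
    have "m * k < m * (q + 1)" using k(3) m_mult by (simp add: N_def)
    then have "k < q + 1" using mult_less_cancel1 by blast
    then have "k \<le> q" by simp
    moreover have "k \<ge> 1" using k(2) by (cases k) auto
    ultimately show "i \<in> (*) m ` {1..q}" using k(1) by auto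
  next
    fix i assume "i \<in> (*) m ` {1..q}"
    then obtain k where "i = m * k" "k \<in> {1..q}" by blast
    then have k: "i = m * k" "1 \<le> k" "k \<le> q" by auto
    have "m * k < m * (q + 1)" using k(3) m_pos by (intro mult_strict_left_mono) auto
    then have "m * k \<le> q ^ n" using m_mult by (simp add: N_def)
    then show "i \<in> {i\<in>{1..q ^ n}. m dvd i}" using k m_pos by auto
  qed
  also have "(\<Sum>i\<in>(*) m ` {1..q}. int q ^ 2 - int q) = int q * (int q ^ 2 - int q)"
    using m_pos by (simp add: card_image inj_on_def)
  finally show ?thesis by (simp add: N_def algebra_simps power2_eq_square power3_eq_cube)
qed

text \<open>The right side equals (q - 1) (q^(n+1) + q^n - q^2).\<close>

lemma genus_eq: "2 * genus K (UNIV :: 'a set) = int N * (int q ^ 2 - 1) + 1 - int q ^ 3"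
  using F.genus_eq_card_gaps[OF finite_gaps] card_gaps sum_T by simp

text \<open>Here m = q^2 - q + 1 and the floor of i q^3 / N is i - 1. With i >= (cI(i) - 1) m + 1
  this gives T(i) <= q^2 - cI(i), and for cI(i) = 1 the value is exactly q^2 - i. So the maximum q^2
  - 1 occurs only at i = 1.\<close>

lemma T_le_if_3:
  assumes n: "n = 3" and i: "1 \<le> i" "i \<le> q ^ n"
  shows "T i \<le> int q ^ 2 - 1" "i \<noteq> 1 \<Longrightarrow> T i \<le> int q ^ 2 - 2" "T 1 = int q ^ 2 - 1"
proof -
  have mi: "int m = int q ^ 2 - int q + 1"
  proof -
    have "int m * (int q + 1) = (int q ^ 2 - int q + 1) * (int q + 1)"
      using arg_cong[OF m_mult, of int] by (simp add: N_def n algebra_simps power2_eq_square power3_eq_cube)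
    then show ?thesis by simp
  qed
  have f: "i * q ^ 3 div N = i - 1" if "1 \<le> i" "i \<le> q ^ 3" for i
  proof (rule div_nat_eqI)
    have "i = Suc (i - 1)" using that by simp
    then have "i * q ^ 3 = (i - 1) * q ^ 3 + q ^ 3" by (metis add.commute mult_Suc)
    then show "N * (i - 1) \<le> i * q ^ 3" "i * q ^ 3 < N * Suc (i - 1)"
      using that by (simp_all add: N_def n algebra_simps)
  qed
  have T: "T i = int q + (int q ^ 2 - int q) * cI i - int i" if "1 \<le> i" "i \<le> q ^ 3" for i
    using f[OF that] that by (simp add: T_def of_nat_diff)
  have c: "int i \<ge> (cI i - 1) * int m + 1" for i
  proof -
    define X r where "X = (- int i) div int m" and "r = (- int i) mod int m"
    have "X * int m + r = - int i" unfolding X_def r_def by (rule div_mult_mod_eq)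
    moreover have "r < int m" using m_pos by (simp add: r_def)
    ultimately show ?thesis unfolding cI_def X_def[symmetric] by (simp add: algebra_simps)
  qed
  have i': "i \<le> q ^ 3" using i n by simp
  have c1: "cI i \<ge> 1"
  proof -
    have "(- int i) div int m < 0" using i m_pos by (simp add: pos_imp_zdiv_neg_iff)
    then show ?thesis by (simp add: cI_def)
  qed
  have le: "T i \<le> int q ^ 2 - cI i"
    using T[OF i(1) i'] c[of i] unfolding mi by (simp add: algebra_simps)
  then show "T i \<le> int q ^ 2 - 1" using c1 by simp
  have one: "T i = int q ^ 2 - int i" if "cI i = 1" using T[OF i(1) i'] that by simp
  show "T i \<le> int q ^ 2 - 2" if "i \<noteq> 1"
  proof (cases "cI i = 1")
    case True
    then show ?thesis using one i that by simp
  next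
    case False
    then show ?thesis using le c1 by simp
  qed
  have "2 * 1 \<le> int q * (int q - 1)" using q2 by (intro mult_mono) auto
  then have "m > 1" using mi by (simp add: power2_eq_square algebra_simps)
  then have "(- int 1) div int m = - 1" by (simp add: zdiv_zminus1_eq_if)
  then have "cI 1 = 1" by (simp add: cI_def)
  then show "T 1 = int q ^ 2 - 1" using T[of 1] q2 by simp
qed

text \<open>N - q^3 is the residue of 2g - 1 modulo \<open>N\<close>. There the ceiling is at most q
  + 1, and the floor is at least q^3 - q because q^5 <= N, which is where n >= 5 enters.\<close>

lemma T_le_if_5:
  assumes n: "n \<ge> 5"
  shows "T (N - q ^ 3) \<le> int q - 1"
proof -
  have qN: "q ^ 5 \<le> q ^ n" using q2 n by (intro power_increasing) auto
  have q35: "q ^ 3 \<le> q ^ 5" using q2 by (intro power_increasing) auto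
  have lt: "q ^ 3 \<le> N" using qN q35 by (simp add: N_def)
  have "cI (N - q ^ 3) \<le> int q + 1"
  proof -
    have "- int N = int m * (- (int q + 1))" by (simp add: algebra_simps flip: m_mult)
    then have "- (int q + 1) = (- int N) div int m"
      using m_pos nonzero_mult_div_cancel_left[of "int m" "- (int q + 1)"] by simp
    also have "\<dots> \<le> (- int (N - q ^ 3)) div int m" using m_pos by (intro zdiv_mono1) auto
    finally show ?thesis by (simp add: cI_def)
  qed
  then have "(int q ^ 2 - int q) * cI (N - q ^ 3) \<le> (int q ^ 2 - int q) * (int q + 1)"
    using q2 by (intro mult_left_mono) (auto simp: power2_eq_square)
  moreover have "int q ^ 3 - int q \<le> int ((N - q ^ 3) * q ^ 3 div N)"
  proof -
    have "q * q ^ 5 \<le> q * N" using qN by (intro mult_left_mono) (auto simp: N_def)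
    then have "int q ^ 3 * int q ^ 3 \<le> int q * int N"
      by (simp flip: of_nat_power of_nat_mult) (simp add: eval_nat_numeral mult_ac)
    then have "(int q ^ 3 - int q) * int N \<le> (int N - int q ^ 3) * int q ^ 3" by (simp add: algebra_simps)
    also have "\<dots> = int ((N - q ^ 3) * q ^ 3)" using lt by (simp add: of_nat_diff)
    finally have "((int q ^ 3 - int q) * int N) div int N \<le> int ((N - q ^ 3) * q ^ 3) div int N"
      using N_pos by (intro zdiv_mono1) auto
    then show ?thesis using N_pos by (simp add: zdiv_int)
  qed
  ultimately show ?thesis
    unfolding T_def by (simp add: algebra_simps power2_eq_square power3_eq_cube)
qed

section \<open>Symmetry\<close>

lemma pole_numbers_QQ: "pole_numbers K UNIV QQ = F.orders"
  by (rule F.pole_numbers_eq_orders)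

text \<open>2g - 1 = N (q^2 - 2) + (N - q^3). For n = 3 the last summand is 1, and T(1) = q^2 - 1
  makes this a gap that no other exceeds. For n >= 5 it could be a gap only if T(N - q^3) > q^2 -
  2.\<close>

lemma symmetric_iff: "semigroup_symmetric K UNIV QQ \<longleftrightarrow> n = 3"
proof -
  have gap: "gap_numbers K UNIV QQ = UNIV - F.orders" by (simp add: gap_numbers_def pole_numbers_QQ)
  have g2: "2 * genus K (UNIV :: 'a set) - 1 = int N * (int q ^ 2 - 1) - int q ^ 3" using genus_eq by simp
  have qq: "int q ^ 2 \<ge> 2 * int q" using q2 by (simp add: power2_eq_square)
  show ?thesis
  proof
    assume "semigroup_symmetric K UNIV QQ"
    then obtain s where s: "s \<in> UNIV - F.orders" "int s = int N * (int q ^ 2 - 1) - int q ^ 3"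
      unfolding semigroup_symmetric_def gap g2 by blast
    obtain i j where ij: "s = N * j + i" "1 \<le> i" "i \<le> q ^ n" "int j < T i" using s(1) unfolding gaps_eq by blast
    show "n = 3"
    proof (rule ccontr)
      assume "n \<noteq> 3"
      then have n5: "n \<ge> 5" using n3 odd_n by (cases "n = 4") auto
      have "q ^ 3 < q ^ n" using q2 n5 by (intro power_strict_increasing) auto
      then have lt: "q ^ 3 < N" unfolding N_def by linarith
      have "q ^ 3 > 0" using q2 by simp
      then have q3: "N - q ^ 3 < N" using lt by linarith
      have "int (N - q ^ 3) = int N - int (q ^ 3)" using lt by (intro of_nat_diff) simp
      then have q3': "int (N - q ^ 3) = int N - int q ^ 3" by simp
      have e: "int N * int j + int i = int N * (int q ^ 2 - 2) + int (N - q ^ 3)"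
        using s(2) unfolding ij(1) q3' by (simp add: algebra_simps)
      have "int i mod int N = int (N - q ^ 3) mod int N"
        using arg_cong[OF e, of "\<lambda>x. x mod int N"] by simp
      moreover have "i < N" using ij(3) by (simp add: N_def)
      ultimately have i: "i = N - q ^ 3" using q3 by (simp flip: of_nat_mod)
      then have "int N * int j = int N * (int q ^ 2 - 2)" using e by simp
      then have "int j = int q ^ 2 - 2" using N_pos by simp
      then have "int q ^ 2 - 2 < int q - 1" using ij(4) T_le_if_5[OF n5] i by simp
      then show False using qq q2 by linarith
    qed
  next
    assume n: "n = 3"
    define j where "j = nat (int q ^ 2 - 2)"
    have j: "int j = int q ^ 2 - 2" using qq q2 by (simp add: j_def)
    have one: "1 \<le> q ^ n" using q2 by simp
    have mem: "N * j + 1 \<in> UNIV - F.orders"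
      using not_orders_iff[of 1 j] T_le_if_3(3)[OF n order_refl one] j one by simp
    have "s' \<le> N * j + 1" if s': "s' \<in> UNIV - F.orders" for s'
    proof -
      obtain i k where ik: "s' = N * k + i" "1 \<le> i" "i \<le> q ^ n" "int k < T i"
        using s' unfolding gaps_eq by blast
      show ?thesis
      proof (cases "i = 1")
        case True
        then have "k \<le> j" using ik(4) T_le_if_3(3)[OF n order_refl one] j by simp
        then show ?thesis using True ik(1) by simp
      next
        case False
        then have "int k < int j" using ik T_le_if_3(2)[OF n ik(2,3)] j by simp
        \<comment> \<open>A smaller quotient outweighs the larger remainder, since N k + i < N (k +
          1).\<close>
        then have "N * Suc k \<le> N * j" by (intro mult_left_mono) auto
        then show ?thesis using ik(1,3) by (simp add: N_def)
      qed
    qed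
    moreover have "int (N * j + 1) = int N * (int q ^ 2 - 1) - int q ^ 3"
    proof -
      have "int (N * j + 1) = int N * (int q ^ 2 - 2) + 1" by (simp add: j)
      also have "\<dots> = int N * (int q ^ 2 - 1) - int q ^ 3" by (simp add: N_def n algebra_simps)
      finally show ?thesis .
    qed
    ultimately show "semigroup_symmetric K UNIV QQ"
      unfolding semigroup_symmetric_def gap g2 using mem by blast
  qed
qed

lemma submonoid_orders: "is_submonoid F.orders"
  unfolding is_submonoid_def
proof (intro conjI ballI)
  show "0 \<in> F.orders" using orders_iff[of 0] by auto
  fix s s' assume "s \<in> F.orders" "s' \<in> F.orders"
  then obtain f f' where f: "f \<in> RR" "f \<noteq> 0" "s = nat (- vv f)" "f' \<in> RR" "f' \<noteq> 0" "s' = nat (- vv f')"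
    by (auto simp: F.orders_def)
  have "f * f' \<in> RR" "f * f' \<noteq> 0" using f subring_mult[OF subring_RR] by auto
  moreover have "s + s' = nat (- vv (f * f'))"
    using f F.R_neg[OF f(1,2)] F.R_neg[OF f(4,5)] by (simp add: F.v_mult)
  ultimately show "s + s' \<in> F.orders" unfolding F.orders_def by blast
qed

lemma submonoid_mult: "is_submonoid M \<Longrightarrow> a \<in> M \<Longrightarrow> a * k \<in> M"
  by (induction k) (auto simp: is_submonoid_def)

text \<open>The generators are \<open>N\<close> and the least pole number of each nonzero residue
  class modulo \<open>N\<close>; all other pole numbers arise by adding multiples of
  \<open>N\<close>.\<close>

lemma orders_hull:
  "F.orders = is_submonoid hull ({N} \<union> {s. \<exists>i. 1 \<le> i \<and> i \<le> q ^ n \<and> int s = int N * T i + int i})"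
proof (rule hull_unique[symmetric])
  show "{N} \<union> {s. \<exists>i. 1 \<le> i \<and> i \<le> q ^ n \<and> int s = int N * T i + int i} \<subseteq> F.orders"
  proof
    fix s assume "s \<in> {N} \<union> {s. \<exists>i. 1 \<le> i \<and> i \<le> q ^ n \<and> int s = int N * T i + int i}"
    then consider "s = N * 1" | i where "1 \<le> i" "i \<le> q ^ n" "int s = int N * (T i + int 0) + int i" by auto
    then show "s \<in> F.orders" unfolding orders_iff by cases blast+
  qed
  show "is_submonoid F.orders" by (rule submonoid_orders)
  fix M assume M: "{N} \<union> {s. \<exists>i. 1 \<le> i \<and> i \<le> q ^ n \<and> int s = int N * T i + int i} \<subseteq> M" "is_submonoid M"
  show "F.orders \<subseteq> M"
  proof
    fix s assume "s \<in> F.orders"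
    then consider j where "s = N * j"
      | i j where "1 \<le> i" "i \<le> q ^ n" "int s = int N * (T i + int j) + int i" unfolding orders_iff by blast
    then show "s \<in> M"
    proof cases
      case 1
      then show ?thesis using submonoid_mult[OF M(2), of N j] M(1) by blast
    next
      case 2
      define s0 where "s0 = nat (int N * T i + int i)"
      have "int s0 = int N * T i + int i" using T_nonneg[OF 2(1,2)] by (simp add: s0_def)
      moreover from this have "s0 \<in> M" using M(1) 2 by blast
      moreover have "int s = int (s0 + N * j)" using 2(3) calculation(1) by (simp add: algebra_simps)
      then have "s = s0 + N * j" by (simp only: of_nat_eq_iff)
      moreover have "N * j \<in> M" using submonoid_mult[OF M(2), of N j] M(1) by blast
      ultimately show ?thesis using M(2) by (simp add: is_submonoid_def)
    qed
  qed
qed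

lemma T_real:
  "T i = int q + (int q ^ 2 - int q) * \<lceil>real i / real m\<rceil> - \<lfloor>real (i * q ^ 3) / real N\<rfloor> - 1"
proof -
  have "\<lceil>real i / real m\<rceil> = cI i"
    using ceiling_divide_eq_div[of "int i" "int m"] by (simp add: cI_def)
  moreover have "\<lfloor>real (i * q ^ 3) / real N\<rfloor> = int (i * q ^ 3 div N)"
    by (rule floor_divide_of_nat_eq)
  ultimately show ?thesis by (simp add: T_def)
qed

end

subsection \<open>The GGS curve\<close>

text \<open>Translation by 1 permutes \<open>K\<close>, so it leaves the sum of all elements
  unchanged.\<close>

lemma of_nat_card_subfield:
  fixes K :: "'a::field set"
  assumes K: "is_subfield K" and "finite K"
  shows "of_nat (card K) = (0::'a)"
proof -
  note R = subfield_subring[OF K]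
  have "bij_betw (\<lambda>a. a + 1) K K"
    by (rule bij_betwI[of _ _ _ "\<lambda>a. a - 1"]) (auto intro: subring_add[OF R] subring_diff[OF R] subring_one[OF R])
  then have "(\<Sum>a\<in>K. a + 1) = (\<Sum>a\<in>K. a)" by (rule sum.reindex_bij_betw)
  then show ?thesis by (simp add: sum.distrib)
qed

text \<open>Multiplication by \<open>a\<close> permutes the nonzero elements and so leaves their
  product unchanged.\<close>

lemma power_card_subfield:
  fixes K :: "'a::field set"
  assumes K: "is_subfield K" and fin: "finite K" and a: "a \<in> K" "a \<noteq> 0"
  shows "a ^ (card K - 1) = 1"
proof -
  note R = subfield_subring[OF K]
  have "bij_betw ((*) a) (K - {0}) (K - {0})"
    by (rule bij_betwI[of _ _ _ "\<lambda>b. b / a"])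
      (use a in \<open>auto intro: subring_mult[OF R] subfield_divide[OF K]\<close>)
  then have "(\<Prod>x\<in>K - {0}. a * x) = (\<Prod>x\<in>K - {0}. x)" by (rule prod.reindex_bij_betw)
  moreover have "(\<Prod>x\<in>K - {0}. x) \<noteq> 0" using fin by simp
  moreover have "card (K - {0}) = card K - 1" using subring_zero[OF R] fin by simp
  ultimately show ?thesis by (simp add: prod.distrib)
qed

text \<open>The \<open>d\<close>-th power map sends the d N nonzero elements of \<open>K\<close> to
  \<open>N\<close>-th roots of unity with at most \<open>d\<close> elements in each fibre, so there
  are at least \<open>N\<close> roots.\<close>

lemma card_roots_of_unity:
  fixes K :: "'a::field set"
  assumes K: "is_subfield K" and fin: "finite K" and card: "card K - 1 = d * N" and pos: "d > 0" "N > 0"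
  shows "card {\<zeta>\<in>K. \<zeta> ^ N = 1} = N"
proof (rule antisym)
  have sub: "{\<zeta>\<in>K. \<zeta> ^ N = 1} \<subseteq> {\<zeta>. \<zeta> ^ N = 1}" by blast
  show "card {\<zeta>\<in>K. \<zeta> ^ N = 1} \<le> N"
    using card_mono[OF card_roots_of_unity_le(1)[OF pos(2)] sub] card_roots_of_unity_le(2)[OF pos(2)] by (rule order_trans)
  let ?U = "K - {0}"
  define h where "h a = a ^ d" for a :: 'a
  have fiber: "card {a \<in> ?U. h a = b} \<le> d" if b: "b \<in> h ` ?U" for b
  proof -
    obtain a where a: "a \<in> ?U" "b = h a" using b by blast
    have "{c \<in> ?U. h c = b} \<subseteq> (*) a ` {x. x ^ d = 1}"
    proof
      fix c assume "c \<in> {c \<in> ?U. h c = b}"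
      then have "(c / a) ^ d = 1" "c = a * (c / a)" using a by (auto simp: h_def power_divide)
      then show "c \<in> (*) a ` {x. x ^ d = 1}" by blast
    qed
    then have "card {c \<in> ?U. h c = b} \<le> card ((*) a ` {x. x ^ d = 1})"
      using card_roots_of_unity_le(1)[OF pos(1)] by (intro card_mono) auto
    also have "\<dots> \<le> card {x::'a. x ^ d = 1}" using card_roots_of_unity_le(1)[OF pos(1)] by (rule card_image_le)
    also have "\<dots> \<le> d" by (rule card_roots_of_unity_le(2)[OF pos(1)])
    finally show ?thesis .
  qed
  have img: "h ` ?U \<subseteq> {\<zeta>\<in>K. \<zeta> ^ N = 1}"
  proof
    fix z assume "z \<in> h ` ?U"
    then obtain a where a: "a \<in> K" "a \<noteq> 0" "z = a ^ d" by (auto simp: h_def)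
    have "z ^ N = a ^ (card K - 1)" unfolding a(3) card by (simp only: power_mult)
    then show "z \<in> {\<zeta>\<in>K. \<zeta> ^ N = 1}"
      using power_card_subfield[OF K fin a(1,2)] a subring_power[OF subfield_subring[OF K]] by simp
  qed
  have "d * N = card ?U" using subring_zero[OF subfield_subring[OF K]] fin card by simp
  also have "\<dots> = (\<Sum>b\<in>h ` ?U. card {a \<in> ?U. h a = b})"
    using sum.image_gen[of ?U "\<lambda>_. 1::nat" h] fin by simp
  also have "\<dots> \<le> (\<Sum>b\<in>h ` ?U. d)" using fiber by (intro sum_mono)
  also have "\<dots> = d * card (h ` ?U)" by simp
  also have "\<dots> \<le> d * card {\<zeta>\<in>K. \<zeta> ^ N = 1}" using fin img by (intro mult_left_mono card_mono) auto
  finally show "N \<le> card {\<zeta>\<in>K. \<zeta> ^ N = 1}" using pos by simp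
qed

lemma primepow_char:
  assumes "primepow q" "of_nat q = (0::'a::field)"
  shows "prime CHAR('a)" "\<exists>e. q = CHAR('a) ^ e"
proof -
  obtain p e where pe: "prime p" "q = p ^ e" using assms(1) by (auto simp: primepow_def)
  have "of_nat p = (0::'a)" using assms(2) pe(2) by simp
  then have "CHAR('a) dvd p" by (simp add: of_nat_eq_0_iff_char_dvd)
  moreover have "CHAR('a) \<noteq> 1" by (metis of_nat_1 of_nat_CHAR zero_neq_one)
  ultimately have "CHAR('a) = p" using pe(1) by (metis prime_nat_iff)
  then show "prime CHAR('a)" "\<exists>e. q = CHAR('a) ^ e" using pe by auto
qed

text \<open>A polynomial relation for 1/(x - a), reversed and composed with X - a, becomes one for
  \<open>x\<close>.\<close>

lemma transcendental_inverse_shift: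
  assumes K: "is_subfield K" and x: "transcendental_over K x" and a: "a \<in> K"
  shows "x \<noteq> a" "transcendental_over K (inverse (x - a))"
proof -
  note R = subfield_subring[OF K]
  have L: "[:- a, 1:] \<in> polys_over K"
    using a by (simp add: polys_over_pCons[OF R] polys_over_zero[OF R] subring_uminus[OF R] subring_one[OF R])
  have tr: "p = 0" if "p \<in> polys_over K" "poly p x = 0" for p
    using x that by (auto simp: transcendental_over_def polys_over_def)
  show ne: "x \<noteq> a" using tr[OF L] by auto
  have comp: "p \<circ>\<^sub>p [:- a, 1:] \<in> polys_over K" if "p \<in> polys_over K" for p
    using that
  proof (induction p)
    case (pCons c p)
    then have "[:c:] \<in> polys_over K" "p \<in> polys_over K"
      by (auto simp: polys_over_pCons[OF R] polys_over_zero[OF R])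
    then show ?case using pCons L unfolding pcompose_pCons by (intro polys_over_add[OF R] polys_over_mult[OF R]) auto
  qed (simp add: polys_over_zero[OF R])
  show "transcendental_over K (inverse (x - a))"
    unfolding transcendental_over_def
  proof (intro allI impI, elim conjE)
    fix p assume "\<forall>i. coeff p i \<in> K" and p0: "poly p (inverse (x - a)) = 0"
    then have "reflect_poly p \<in> polys_over K" by (intro polys_over_reflect[OF R]) (simp add: polys_over_def)
    moreover have "poly (reflect_poly p) (x - a) = 0"
      using p0 ne by (subst poly_reflect_poly_nz) auto
    then have "poly (reflect_poly p \<circ>\<^sub>p [:- a, 1:]) x = 0" by (simp add: poly_pcompose)
    ultimately have "reflect_poly p \<circ>\<^sub>p [:- a, 1:] = 0" using tr comp by blast
    then have "reflect_poly p = 0" by (simp add: pcompose_eq_0_iff)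
    then show "p = 0" by simp
  qed
qed

text \<open>Since \<open>q\<close> is a power of the characteristic, A^q = 1 + X^(q (q-1)). Hence X
  A B = X - X^(q^2), where the second term has derivative zero.\<close>

lemma ggs_polynomials:
  fixes q :: nat
  assumes q: "q \<ge> 2" "of_nat q = (0::'a::field)" and fresh: "prime CHAR('a)" "q = CHAR('a) ^ e"
  defines "A \<equiv> 1 + monom (1::'a) (q - 1)"
  defines "B \<equiv> A ^ (q - 1) - monom 1 (q * (q - 1))"
  shows "A \<noteq> 0" "degree A = q - 1" "B \<noteq> 0" "degree B = q * (q - 1)" "pderiv (monom 1 1 * A * B) = 1"
proof -
  have cA: "coeff A (q - 1) = 1" using q by (simp add: A_def coeff_1)
  then show "A \<noteq> 0" by auto
  have "degree A \<le> q - 1" unfolding A_def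
    using degree_add_le_max[of 1 "monom (1::'a) (q - 1)"] degree_monom_le[of "1::'a" "q - 1"] by simp
  then show dA: "degree A = q - 1" using le_degree[of A "q - 1"] cA by simp
  have lt: "degree (A ^ (q - 1)) < q * (q - 1)"
  proof -
    have "degree (A ^ (q - 1)) \<le> (q - 1) * (q - 1)" using degree_power_le[of A "q - 1"] dA by simp
    also have "\<dots> < q * (q - 1)" using q by simp
    finally show ?thesis .
  qed
  then have cB: "coeff B (q * (q - 1)) = - 1" by (simp add: B_def coeff_eq_0)
  then show "B \<noteq> 0" by auto
  have "degree B \<le> q * (q - 1)" unfolding B_def
    using lt degree_monom_le[of "1::'a" "q * (q - 1)"] by (intro degree_diff_le) simp_all
  then show "degree B = q * (q - 1)" using le_degree[of B "q * (q - 1)"] cB by simp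
  have "A ^ q = 1 ^ q + monom 1 (q - 1) ^ q"
    unfolding A_def by (rule freshmans_dream'[of q e]) (use fresh in simp_all)
  also have "monom (1::'a) (q - 1) ^ q = monom 1 (q * (q - 1))" by (simp add: monom_power mult.commute)
  finally have Aq: "A * A ^ (q - 1) = 1 + monom 1 (q * (q - 1))"
    using q by (simp flip: power_Suc)
  have "monom 1 1 * A * B = monom 1 1 * (A * A ^ (q - 1)) - monom 1 1 * A * monom 1 (q * (q - 1))"
    by (simp add: B_def algebra_simps)
  also have "\<dots> = monom 1 1 + monom 1 (1 + q * (q - 1)) - (monom 1 (1 + q * (q - 1)) + monom 1 (1 + (q - 1) + q * (q - 1)))"
    unfolding Aq by (simp add: A_def algebra_simps mult_monom)
  also have "1 + (q - 1) + q * (q - 1) = q * q" using q by (simp add: algebra_simps)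
  finally have "monom 1 1 * A * B = monom 1 1 - monom 1 (q * q)" by simp
  then show "pderiv (monom 1 1 * A * B) = 1"
    using q by (simp add: pderiv_diff pderiv_monom)
qed

theorem proposition5p4:
  fixes K :: "'a::field set" and x y :: 'a and \<alpha> :: "nat \<Rightarrow> 'a" and q n m k :: nat
    and Q :: "nat \<Rightarrow> 'a set"
  assumes "primepow q" and "n \<ge> 3" and "odd n"
    and "is_subfield K" and "card K = q ^ (2 * n)"
    and "transcendental_over K x"
    and "adjoin K {x, y} = UNIV"
    and "y ^ (q ^ n + 1) = (x ^ q + x) * ((x ^ q + x) ^ (q - 1) - 1) ^ (q + 1)"
    and "bij_betw \<alpha> {1..q} {a \<in> K. a ^ q + a = 0}"
    and "\<And>i. i \<in> {1..q} \<Longrightarrow>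
           Q i = the_place_over K UNIV (the_zero_of K (adjoin K {x}) (x - \<alpha> i))"
    and "k \<in> {1..q}"
    and "m = (q ^ n + 1) div (q + 1)"
  shows "gap_numbers K UNIV (Q k) =
           {(q ^ n + 1) * j + i | i j. 1 \<le> i \<and> i \<le> q ^ n \<and>
              int j \<le> int q + (int q ^ 2 - int q) * \<lceil>real i / real m\<rceil>
                - \<lfloor>real (i * q ^ 3) / real (q ^ n + 1)\<rfloor> - 2}
       \<and> pole_numbers K UNIV (Q k) =
           is_submonoid hull ({q ^ n + 1} \<union>
             {s. \<exists>i. 1 \<le> i \<and> i \<le> q ^ n \<and>
                int s = int (q ^ n + 1) * (int q + (int q ^ 2 - int q) * \<lceil>real i / real m\<rceil>
                  - \<lfloor>real (i * q ^ 3) / real (q ^ n + 1)\<rfloor> - 1) + int i})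
       \<and> (semigroup_symmetric K UNIV (Q k) \<longleftrightarrow> n = 3)"
proof -
  note K = assms(4)
  have q2: "q \<ge> 2" using primepow_gt_Suc_0[OF assms(1)] by simp
  have fin: "finite K" using assms(5) q2 by (intro card_ge_0_finite) simp
  have "of_nat (q ^ (2 * n)) = (0::'a)" using of_nat_card_subfield[OF K fin] assms(5) by simp
  then have q0: "of_nat q = (0::'a)" by simp
  obtain e where fresh: "prime CHAR('a)" "q = CHAR('a) ^ e" using primepow_char[OF assms(1) q0] by blast
  define a where "a = \<alpha> k"
  have a: "a \<in> K" "a ^ q + a = 0" using bij_betwE[OF assms(9)] assms(11) by (auto simp: a_def)
  define u where "u = inverse (x - a)"
  have xa: "x \<noteq> a" and tr: "transcendental_over K u"
    using transcendental_inverse_shift[OF K assms(6) a(1)] by (simp_all add: u_def)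
  have u0: "u \<noteq> 0" and xu: "x = a + inverse u" using xa by (simp_all add: u_def)
  have adj: "adjoin K {u} = adjoin K {x}" and gen: "adjoin K {u, y} = UNIV"
  proof -
    have xin: "x \<in> adjoin K S" if "u \<in> S" for S
      unfolding xu using is_subfield_adjoin[of K S] adjoin_superset[of K S] that a(1)
      by (intro subring_add[OF subfield_subring] subfield_inverse) auto
    have uin: "u \<in> adjoin K S" if "x \<in> S" for S
      unfolding u_def using is_subfield_adjoin[of K S] adjoin_superset[of K S] that a(1)
      by (intro subfield_inverse subring_diff[OF subfield_subring]) auto
    show "adjoin K {u} = adjoin K {x}"
      using xin[of "{u}"] uin[of "{x}"] adjoin_superset[of K] by (intro equalityI adjoin_least is_subfield_adjoin) auto
    have "adjoin K {x, y} \<subseteq> adjoin K {u, y}"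
      using xin[of "{u, y}"] adjoin_superset[of K "{u, y}"] by (intro adjoin_least is_subfield_adjoin) auto
    then show "adjoin K {u, y} = UNIV" using assms(7) by blast
  qed
  define A where "A = 1 + monom (1::'a) (q - 1)"
  define B where "B = A ^ (q - 1) - monom 1 (q * (q - 1))"
  note AB = ggs_polynomials[OF q2 q0 fresh, folded A_def, folded B_def]
  define g where "g = poly A u * poly B u ^ (q + 1) / u ^ (q ^ 3)"
  have yN: "y ^ (q ^ n + 1) = g"
  proof -
    define h where "h = x ^ q + x"
    have "x ^ q = a ^ q + inverse u ^ q" unfolding xu by (rule freshmans_dream'[OF fresh])
    \<comment> \<open>The root \<open>a\<close> cancels because a^q + a = 0, so the equation has the
      same form for every \<open>k\<close>.\<close>
    then have h: "h = inverse u ^ q + inverse u" using a(2) by (simp add: h_def xu algebra_simps)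
    have "u ^ q * inverse u = u ^ (q - 1)" using u0 q2 by (simp add: power_diff divide_inverse)
    then have hA: "u ^ q * h = poly A u"
      using u0 by (simp add: h A_def poly_monom distrib_left power_inverse)
    have uq: "u ^ (q * (q - 1)) = (u ^ q) ^ (q - 1)" by (rule power_mult)
    have hB: "u ^ (q * (q - 1)) * (h ^ (q - 1) - 1) = poly B u"
    proof -
      have "u ^ (q * (q - 1)) * (h ^ (q - 1) - 1) = (u ^ q * h) ^ (q - 1) - u ^ (q * (q - 1))"
        by (simp only: uq power_mult_distrib right_diff_distrib mult_1_right)
      then show ?thesis by (simp add: hA B_def poly_monom)
    qed
    \<comment> \<open>The power of \<open>u\<close> clearing all denominators: \<open>q\<close> for
      the factor \<open>h\<close>, and q (q - 1) for each of the q + 1 factors h^(q-1) - 1.\<close>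
    have ex: "q ^ 3 = q + q * (q - 1) * (q + 1)"
    proof -
      have "int (q ^ 3) = int (q + q * (q - 1) * (q + 1))"
        using q2 by (simp add: of_nat_diff algebra_simps power3_eq_cube)
      then show ?thesis by (simp only: of_nat_eq_iff)
    qed
    have "u ^ (q ^ 3) * (h * (h ^ (q - 1) - 1) ^ (q + 1)) =
        (u ^ q * h) * (u ^ (q * (q - 1)) * (h ^ (q - 1) - 1)) ^ (q + 1)"
      unfolding ex power_add[of u q] power_mult[of u "q * (q - 1)"] power_mult_distrib by (simp only: mult_ac)
    then have "h * (h ^ (q - 1) - 1) ^ (q + 1) = g"
      unfolding hA hB g_def using u0 by (simp add: field_simps)
    then show ?thesis using assms(8) by (simp add: h_def)
  qed
  interpret ratfun K u by unfold_locales (fact K, fact tr)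
  have A: "A \<in> polys_over K" unfolding A_def by (intro X_closed) simp_all
  have B: "B \<in> polys_over K" unfolding B_def using A by (intro X_closed) simp_all
  have L: "poly A u \<in> L1" "poly B u \<in> L1" "u \<in> L1" using A B R1_I R1_L1 u_R1 by blast+
  have nz: "poly A u \<noteq> 0" "poly B u \<noteq> 0" using poly_u_eq_0 A B AB by auto
  have gL: "g \<in> L1" "g \<noteq> 0" using L nz u0 by (auto simp: g_def)
  have vg: "v1 g = 1"
  proof -
    \<comment> \<open>By the degrees of \<open>A\<close> and \<open>B\<close> the value is q^3 - (q
      - 1) - (q + 1) q (q - 1) = 1.\<close>
    have "v1 g = - int (q - 1) - int (q + 1) * int (q * (q - 1)) + int (q ^ 3)"
      unfolding g_def using L nz u0 A B AB v1_poly v1_u by (simp add: v_divide v_mult v_power algebra_simps)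
    then show ?thesis using q2 by (simp add: of_nat_diff algebra_simps power3_eq_cube)
  qed
  \<comment> \<open>q^n + 1 divides the order of the multiplicative group of \<open>K\<close>, so
    all roots of unity needed for the Kummer extension lie in \<open>K\<close>.\<close>
  have cK: "card K - 1 = (q ^ n - 1) * (q ^ n + 1)"
    unfolding assms(5) mult_2 power_add by (simp add: algebra_simps)
  have "1 < q ^ n" using q2 assms(2) by (intro one_less_power) auto
  then have roots: "card {\<zeta>\<in>K. \<zeta> ^ (q ^ n + 1) = 1} = q ^ n + 1"
    by (intro card_roots_of_unity[OF K fin cK]) auto
  \<comment> \<open>q^n + 1 equals 1 in the field, because \<open>q\<close> vanishes there.\<close>
  have N0: "of_nat (q ^ n + 1) \<noteq> (0::'a)" using q0 assms(2) by (simp add: power_0_left)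
  interpret ggs K u y g "q ^ n + 1" q n m A B
    by unfold_locales
      (fact gL vg yN gen roots N0 q2 assms(2,3,12) A B AB g_def | simp)+
  have Q: "Q k = QQ"
  proof -
    have "inverse u = x - \<alpha> k" by (simp add: u_def a_def)
    then show ?thesis
      unfolding assms(10)[OF assms(11)] adj[symmetric] L1_eq[symmetric]
      using the_zero_of_inverse_u the_place_over_eq by simp
  qed
  \<comment> \<open>The strict bound by \<open>T i\<close>, which ends in -1, becomes a weak bound
    ending in -2.\<close>
  have gaps: "int j < T i \<longleftrightarrow> int j \<le> int q + (int q ^ 2 - int q) * \<lceil>real i / real m\<rceil>
      - \<lfloor>real (i * q ^ 3) / real (q ^ n + 1)\<rfloor> - 2" for i j
    unfolding T_real by linarith
  show ?thesis
    unfolding Q gap_numbers_def pole_numbers_QQ gaps_eq gaps symmetric_iff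
    using orders_hull unfolding T_real by blast
qed

end
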